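(* Let $(M,g,f)$ be a compact gradient shrinking Ricci soliton, i.e. $(M,g)$ is a compact $n$-dimensional Riemannian manifold and $f$ is a smooth real-valued function on $M$ such that $\nabla^2 f+\mathrm{Ric}=\lambda g$ for some real constant $\lambda>0$. If the second invariant $S_2(f)$ of the Hessian $\nabla^2 f$ is constant on $M$, then the soliton is rigid.
   Context: All Riemannian manifolds are assumed complete, connected, orientable and without boundary. $\nabla^2 f$ denotes the Hessian of $f$ and $\mathrm{Ric}$ the Ricci tensor of $g$. The invariants $S_m(f)$, $0\le m\le n$, of the Hessian (viewed as an endomorphism of the tangent bundle via $g$) are the functions on $M$ defined by $\det(I+\alpha\nabla^2 f)=S_0(f)+\alpha S_1(f)+\cdots+\alpha^n S_n(f)$ for every scalar $\alpha$; thus $S_2(f)$ is the coefficient of $\alpha^2$. A gradient Ricci soliton is called rigid if it is isometric to a quotient of $N\times\mathbb{R}^k$, where $N$ is an Einstein manifold and $k\ge 0$ is an integer. *)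

theory Defs
  imports
    "HOL-Analysis.Abstract_Euclidean_Space"
    "HOL-Analysis.Abstract_Topological_Spaces"
    "HOL-Analysis.Derivative"
    "HOL-Algebra.Bij"
    "Jordan_Normal_Form.Determinant"
    "Jordan_Normal_Form.Gauss_Jordan_Elimination"
begin

section \<open>Smooth functions on open subsets of Euclidean space\<close>

text \<open>
  The library space \<open>Euclidean_space n\<close> consists of the sequences \<open>x :: nat \<Rightarrow> real\<close> vanishing
  from index \<open>n\<close> on.  The dimension is thus a natural number, which is needed because the
  factors of a product \<open>N \<times> \<real>\<^sup>k\<close> have dimensions that are not known in advance.
\<close>

definition partial :: "nat \<Rightarrow> ((nat \<Rightarrow> real) \<Rightarrow> real) \<Rightarrow> (nat \<Rightarrow> real) \<Rightarrow> real" where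
  "partial i F x = deriv (\<lambda>t. F (x(i := t))) (x i)"

text \<open>\<open>Ck_on n U k F\<close>: all partial derivatives of \<open>F\<close> of order at most \<open>k\<close> exist and are
  continuous on the open set \<open>U\<close>.\<close>

primrec Ck_on :: "nat \<Rightarrow> (nat \<Rightarrow> real) set \<Rightarrow> nat \<Rightarrow> ((nat \<Rightarrow> real) \<Rightarrow> real) \<Rightarrow> bool" where
  "Ck_on n U 0 F \<longleftrightarrow> continuous_map (subtopology (Euclidean_space n) U) euclideanreal F"
| "Ck_on n U (Suc k) F \<longleftrightarrow>
     continuous_map (subtopology (Euclidean_space n) U) euclideanreal F \<and>
     (\<forall>i<n. (\<forall>x\<in>U. (\<lambda>t. F (x(i := t))) differentiable (at (x i))) \<and>
            Ck_on n U k (partial i F))"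

definition smooth_on :: "nat \<Rightarrow> (nat \<Rightarrow> real) set \<Rightarrow> ((nat \<Rightarrow> real) \<Rightarrow> real) \<Rightarrow> bool" where
  "smooth_on n U F \<longleftrightarrow> (\<forall>k. Ck_on n U k F)"


section \<open>Smooth manifolds with a metric\<close>

text \<open>A chart is a domain together with a coordinate map, of which only the values on the domain
  matter.\<close>

type_synonym 'a chart = "'a set \<times> ('a \<Rightarrow> nat \<Rightarrow> real)"

text \<open>Tangent vectors at a point are derivations, i.e. functionals on real functions; the metric
  takes a point and two tangent vectors at that point.\<close>

type_synonym 'a tvec = "('a \<Rightarrow> real) \<Rightarrow> real"

record 'a riem =
  rtop :: "'a topology"
  rdim :: nat
  ratlas :: "'a chart set"
  rmetric :: "'a \<Rightarrow> 'a tvec \<Rightarrow> 'a tvec \<Rightarrow> real"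

definition chart_inv :: "'a chart \<Rightarrow> (nat \<Rightarrow> real) \<Rightarrow> 'a" where
  "chart_inv c = inv_into (fst c) (snd c)"

definition is_chart :: "'a topology \<Rightarrow> nat \<Rightarrow> 'a chart \<Rightarrow> bool" where
  "is_chart T n c \<longleftrightarrow>
     openin T (fst c) \<and> openin (Euclidean_space n) (snd c ` fst c) \<and>
     homeomorphic_map (subtopology T (fst c))
       (subtopology (Euclidean_space n) (snd c ` fst c)) (snd c)"

definition transition :: "'a chart \<Rightarrow> 'a chart \<Rightarrow> nat \<Rightarrow> (nat \<Rightarrow> real) \<Rightarrow> real" where
  "transition c d i = (\<lambda>x. snd d (chart_inv c x) i)"

definition smooth_atlas :: "'a topology \<Rightarrow> nat \<Rightarrow> 'a chart set \<Rightarrow> bool" where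
  "smooth_atlas T n A \<longleftrightarrow>
     (\<forall>c\<in>A. is_chart T n c) \<and> (\<Union>c\<in>A. fst c) = topspace T \<and>
     (\<forall>c\<in>A. \<forall>d\<in>A. \<forall>i<n. smooth_on n (snd c ` (fst c \<inter> fst d)) (transition c d i))"

definition smooth_manifold :: "'a riem \<Rightarrow> bool" where
  "smooth_manifold M \<longleftrightarrow>
     Hausdorff_space (rtop M) \<and> second_countable (rtop M) \<and>
     smooth_atlas (rtop M) (rdim M) (ratlas M)"

text \<open>There is an atlas of the same smooth structure whose transition maps all have positive
  Jacobian determinant.\<close>

definition orientable :: "'a riem \<Rightarrow> bool" where
  "orientable M \<longleftrightarrow>
     (\<exists>A. smooth_atlas (rtop M) (rdim M) A \<and>
          smooth_atlas (rtop M) (rdim M) (A \<union> ratlas M) \<and>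
          (\<forall>c\<in>A. \<forall>d\<in>A. \<forall>p \<in> fst c \<inter> fst d.
             Determinant.det (mat (rdim M) (rdim M)
               (\<lambda>(i, j). partial j (transition c d i) (snd c p))) > 0))"

definition smooth_fun_on :: "'a riem \<Rightarrow> 'a set \<Rightarrow> ('a \<Rightarrow> real) \<Rightarrow> bool" where
  "smooth_fun_on M W f \<longleftrightarrow>
     (\<forall>c\<in>ratlas M. smooth_on (rdim M) (snd c ` (fst c \<inter> W)) (f \<circ> chart_inv c))"

definition smooth_near :: "'a riem \<Rightarrow> 'a \<Rightarrow> ('a \<Rightarrow> real) \<Rightarrow> bool" where
  "smooth_near M p f \<longleftrightarrow> (\<exists>W. openin (rtop M) W \<and> p \<in> W \<and> smooth_fun_on M W f)"

definition smooth_map :: "'a riem \<Rightarrow> 'b riem \<Rightarrow> ('a \<Rightarrow> 'b) \<Rightarrow> bool" where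
  "smooth_map A B F \<longleftrightarrow>
     continuous_map (rtop A) (rtop B) F \<and>
     (\<forall>c\<in>ratlas A. \<forall>d\<in>ratlas B. \<forall>i<rdim B.
        smooth_on (rdim A) (snd c ` {p \<in> fst c. F p \<in> fst d})
          (\<lambda>x. snd d (F (chart_inv c x)) i))"

text \<open>Derivations of germs of smooth functions at \<open>p\<close>.  They are extended by \<open>0\<close> to functions that
  are not smooth near \<open>p\<close>, so that equal derivations are equal as functionals.\<close>

definition tangent_space :: "'a riem \<Rightarrow> 'a \<Rightarrow> 'a tvec set" where
  "tangent_space M p = {v.
     (\<forall>f h a b. smooth_near M p f \<longrightarrow> smooth_near M p h \<longrightarrow>
        v (\<lambda>q. a * f q + b * h q) = a * v f + b * v h) \<and>
     (\<forall>f h. smooth_near M p f \<longrightarrow> smooth_near M p h \<longrightarrow>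
        v (\<lambda>q. f q * h q) = f p * v h + h p * v f) \<and>
     (\<forall>f h W. smooth_near M p f \<longrightarrow> smooth_near M p h \<longrightarrow> openin (rtop M) W \<longrightarrow> p \<in> W \<longrightarrow>
        (\<forall>q\<in>W. f q = h q) \<longrightarrow> v f = v h) \<and>
     (\<forall>f. \<not> smooth_near M p f \<longrightarrow> v f = 0)}"

text \<open>The \<open>i\<close>-th coordinate vector of the chart \<open>c\<close> at \<open>p\<close>.\<close>

definition coord_vec :: "'a riem \<Rightarrow> 'a chart \<Rightarrow> nat \<Rightarrow> 'a \<Rightarrow> 'a tvec" where
  "coord_vec M c i p =
     (\<lambda>f. if smooth_near M p f then partial i (f \<circ> chart_inv c) (snd c p) else 0)"

text \<open>The differential of \<open>F\<close> at \<open>p\<close>; \<open>B\<close> is the target manifold.\<close>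

definition pushforward :: "'b riem \<Rightarrow> ('a \<Rightarrow> 'b) \<Rightarrow> 'a \<Rightarrow> 'a tvec \<Rightarrow> 'b tvec" where
  "pushforward B F p v = (\<lambda>h. if smooth_near B (F p) h then v (h \<circ> F) else 0)"

definition inner_product_at :: "'a riem \<Rightarrow> 'a \<Rightarrow> bool" where
  "inner_product_at M p \<longleftrightarrow>
     (\<forall>u\<in>tangent_space M p. \<forall>v\<in>tangent_space M p. \<forall>w\<in>tangent_space M p. \<forall>a b.
        rmetric M p (\<lambda>f. a * u f + b * v f) w = a * rmetric M p u w + b * rmetric M p v w) \<and>
     (\<forall>v\<in>tangent_space M p. \<forall>w\<in>tangent_space M p. rmetric M p v w = rmetric M p w v) \<and>
     (\<forall>v\<in>tangent_space M p. v \<noteq> (\<lambda>_. 0) \<longrightarrow> rmetric M p v v > 0)"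


section \<open>Tensor components in a chart\<close>

text \<open>All components are functions of the coordinates \<open>x\<close> in the image of the chart \<open>c\<close>.\<close>

definition gcomp :: "'a riem \<Rightarrow> 'a chart \<Rightarrow> nat \<Rightarrow> nat \<Rightarrow> (nat \<Rightarrow> real) \<Rightarrow> real" where
  "gcomp M c i j x =
     rmetric M (chart_inv c x) (coord_vec M c i (chart_inv c x)) (coord_vec M c j (chart_inv c x))"

definition ginv_mat :: "'a riem \<Rightarrow> 'a chart \<Rightarrow> (nat \<Rightarrow> real) \<Rightarrow> real mat" where
  "ginv_mat M c x = the (mat_inverse (mat (rdim M) (rdim M) (\<lambda>(i, j). gcomp M c i j x)))"

text \<open>The Christoffel symbol of the Levi-Civita connection with upper index \<open>k\<close> and lower
  indices \<open>i\<close>, \<open>j\<close>.\<close>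

definition christoffel ::
    "'a riem \<Rightarrow> 'a chart \<Rightarrow> nat \<Rightarrow> nat \<Rightarrow> nat \<Rightarrow> (nat \<Rightarrow> real) \<Rightarrow> real" where
  "christoffel M c k i j x = (1 / 2) * (\<Sum>l<rdim M. ginv_mat M c x $$ (k, l) *
     (partial i (gcomp M c j l) x + partial j (gcomp M c i l) x - partial l (gcomp M c i j) x))"

text \<open>The component along \<open>\<partial>\<^sub>l\<close> of \<open>R(\<partial>\<^sub>i, \<partial>\<^sub>j)\<partial>\<^sub>k\<close>, where
  \<open>R(X,Y)Z = \<nabla>\<^sub>X \<nabla>\<^sub>Y Z - \<nabla>\<^sub>Y \<nabla>\<^sub>X Z - \<nabla>\<^bsub>[X,Y]\<^esub> Z\<close>.\<close>

definition curvature ::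
    "'a riem \<Rightarrow> 'a chart \<Rightarrow> nat \<Rightarrow> nat \<Rightarrow> nat \<Rightarrow> nat \<Rightarrow> (nat \<Rightarrow> real) \<Rightarrow> real" where
  "curvature M c l i j k x =
     partial i (christoffel M c l j k) x - partial j (christoffel M c l i k) x +
     (\<Sum>m<rdim M. christoffel M c m j k x * christoffel M c l i m x -
                  christoffel M c m i k x * christoffel M c l j m x)"

text \<open>\<open>Ric(Y,Z)\<close> is the trace of \<open>X \<mapsto> R(X,Y)Z\<close>, which is positive on round spheres.\<close>

definition ricci :: "'a riem \<Rightarrow> 'a chart \<Rightarrow> nat \<Rightarrow> nat \<Rightarrow> (nat \<Rightarrow> real) \<Rightarrow> real" where
  "ricci M c j k x = (\<Sum>i<rdim M. curvature M c i i j k x)"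

definition hessian :: "'a riem \<Rightarrow> 'a chart \<Rightarrow> ('a \<Rightarrow> real) \<Rightarrow> nat \<Rightarrow> nat \<Rightarrow> (nat \<Rightarrow> real) \<Rightarrow> real" where
  "hessian M c f i j x =
     partial i (partial j (f \<circ> chart_inv c)) x -
     (\<Sum>k<rdim M. christoffel M c k i j x * partial k (f \<circ> chart_inv c) x)"


section \<open>Riemannian manifolds\<close>

text \<open>A curve satisfying the geodesic equation on the open set \<open>I\<close> of times.\<close>

definition geodesic_on :: "'a riem \<Rightarrow> real set \<Rightarrow> (real \<Rightarrow> 'a) \<Rightarrow> bool" where
  "geodesic_on M I \<gamma> \<longleftrightarrow>
     continuous_map (top_of_set I) (rtop M) \<gamma> \<and>
     (\<forall>c\<in>ratlas M. \<forall>t\<in>I. \<gamma> t \<in> fst c \<longrightarrow>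
        (\<forall>k<rdim M.
           (\<lambda>s. snd c (\<gamma> s) k) differentiable (at t) \<and>
           (deriv (\<lambda>s. snd c (\<gamma> s) k) has_real_derivative
              - (\<Sum>i<rdim M. \<Sum>j<rdim M. christoffel M c k i j (snd c (\<gamma> t)) *
                   deriv (\<lambda>s. snd c (\<gamma> s) i) t * deriv (\<lambda>s. snd c (\<gamma> s) j) t)) (at t)))"

definition geodesically_complete :: "'a riem \<Rightarrow> bool" where
  "geodesically_complete M \<longleftrightarrow>
     (\<forall>a b \<gamma>. a < b \<longrightarrow> geodesic_on M {a<..<b} \<gamma> \<longrightarrow>
        (\<exists>\<delta>. geodesic_on M UNIV \<delta> \<and> (\<forall>t\<in>{a<..<b}. \<delta> t = \<gamma> t)))"

text \<open>Riemannian manifolds are always complete, connected, orientable and without boundary (charts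
  have open images in Euclidean space).\<close>

definition riemannian_manifold :: "'a riem \<Rightarrow> bool" where
  "riemannian_manifold M \<longleftrightarrow>
     smooth_manifold M \<and>
     (\<forall>p\<in>topspace (rtop M). inner_product_at M p) \<and>
     (\<forall>c\<in>ratlas M. \<forall>i<rdim M. \<forall>j<rdim M. smooth_on (rdim M) (snd c ` fst c) (gcomp M c i j)) \<and>
     topspace (rtop M) \<noteq> {} \<and> connected_space (rtop M) \<and> orientable M \<and> geodesically_complete M"

definition einstein :: "'a riem \<Rightarrow> bool" where
  "einstein M \<longleftrightarrow>
     (\<exists>\<mu>. \<forall>c\<in>ratlas M. \<forall>x\<in>snd c ` fst c. \<forall>i<rdim M. \<forall>j<rdim M.
        ricci M c i j x = \<mu> * gcomp M c i j x)"

definition euclidean_riem :: "nat \<Rightarrow> (nat \<Rightarrow> real) riem" where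
  "euclidean_riem k =
     \<lparr>rtop = Euclidean_space k, rdim = k,
      ratlas = {(topspace (Euclidean_space k), \<lambda>x. x)},
      rmetric = (\<lambda>x v w. \<Sum>i<k. v (\<lambda>y. y i) * w (\<lambda>y. y i))\<rparr>"

definition prod_chart :: "nat \<Rightarrow> 'a chart \<Rightarrow> 'b chart \<Rightarrow> ('a \<times> 'b) chart" where
  "prod_chart m c d =
     (fst c \<times> fst d, \<lambda>(p, q) i. if i < m then snd c p i else snd d q (i - m))"

definition prod_riem :: "'a riem \<Rightarrow> 'b riem \<Rightarrow> ('a \<times> 'b) riem" where
  "prod_riem A B =
     \<lparr>rtop = prod_topology (rtop A) (rtop B), rdim = rdim A + rdim B,
      ratlas = {prod_chart (rdim A) c d | c d. c \<in> ratlas A \<and> d \<in> ratlas B},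
      rmetric = (\<lambda>z v w.
        rmetric A (fst z) (pushforward A fst z v) (pushforward A fst z w) +
        rmetric B (snd z) (pushforward B snd z v) (pushforward B snd z w))\<rparr>"


section \<open>Isometries and quotients\<close>

definition preserves_metric :: "'a riem \<Rightarrow> 'b riem \<Rightarrow> ('a \<Rightarrow> 'b) \<Rightarrow> bool" where
  "preserves_metric A B F \<longleftrightarrow>
     (\<forall>p\<in>topspace (rtop A). \<forall>v\<in>tangent_space A p. \<forall>w\<in>tangent_space A p.
        rmetric B (F p) (pushforward B F p v) (pushforward B F p w) = rmetric A p v w)"

definition isometry :: "'a riem \<Rightarrow> 'b riem \<Rightarrow> ('a \<Rightarrow> 'b) \<Rightarrow> bool" where
  "isometry A B F \<longleftrightarrow>
     bij_betw F (topspace (rtop A)) (topspace (rtop B)) \<and>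
     smooth_map A B F \<and> smooth_map B A (inv_into (topspace (rtop A)) F) \<and>
     preserves_metric A B F"

text \<open>A metric-preserving map has injective differentials, so equality of dimensions makes it a
  local diffeomorphism.\<close>

definition local_isometry :: "'a riem \<Rightarrow> 'b riem \<Rightarrow> ('a \<Rightarrow> 'b) \<Rightarrow> bool" where
  "local_isometry A B F \<longleftrightarrow> rdim A = rdim B \<and> smooth_map A B F \<and> preserves_metric A B F"

text \<open>The second condition says that \<open>\<Gamma>\<close> acts freely and properly discontinuously.\<close>

definition deck_group :: "'a riem \<Rightarrow> ('a \<Rightarrow> 'a) set \<Rightarrow> bool" where
  "deck_group P \<Gamma> \<longleftrightarrow>
     subgroup \<Gamma> (BijGroup (topspace (rtop P))) \<and> (\<forall>\<gamma>\<in>\<Gamma>. isometry P P \<gamma>) \<and>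
     (\<forall>x\<in>topspace (rtop P). \<exists>U. openin (rtop P) U \<and> x \<in> U \<and>
        (\<forall>\<gamma>\<in>\<Gamma>. \<gamma> \<noteq> \<one>\<^bsub>BijGroup (topspace (rtop P))\<^esub> \<longrightarrow> \<gamma> ` U \<inter> U = {}))"

text \<open>\<open>Q\<close>, together with the projection \<open>\<pi>\<close>, is the quotient of \<open>P\<close> by \<open>\<Gamma>\<close>: the points of \<open>Q\<close>
  correspond to the orbits, and \<open>Q\<close> carries the unique smooth structure and metric for which
  \<open>\<pi>\<close> is a local isometry.\<close>

definition quotient_by :: "'a riem \<Rightarrow> ('a \<Rightarrow> 'a) set \<Rightarrow> 'b riem \<Rightarrow> ('a \<Rightarrow> 'b) \<Rightarrow> bool" where
  "quotient_by P \<Gamma> Q \<pi> \<longleftrightarrow>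
     deck_group P \<Gamma> \<and> riemannian_manifold Q \<and>
     \<pi> ` topspace (rtop P) = topspace (rtop Q) \<and>
     (\<forall>x\<in>topspace (rtop P). \<forall>y\<in>topspace (rtop P). \<pi> x = \<pi> y \<longleftrightarrow> (\<exists>\<gamma>\<in>\<Gamma>. \<gamma> x = y)) \<and>
     local_isometry P Q \<pi>"

text \<open>Taking the points of \<open>N\<close> and \<open>Q\<close> from the type of points of \<open>M\<close> is no restriction: \<open>Q\<close> is in
  bijection with \<open>M\<close>.  If \<open>M\<close> has positive dimension, it has at least the cardinality of the
  continuum, which \<open>N\<close> cannot exceed; if \<open>M\<close> has dimension \<open>0\<close>, then \<open>N\<close> is a point.\<close>

definition rigid :: "'a riem \<Rightarrow> bool" where
  "rigid M \<longleftrightarrow>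
     (\<exists>(N :: 'a riem) k \<Gamma> (Q :: 'a riem) \<pi> F.
        riemannian_manifold N \<and> einstein N \<and>
        quotient_by (prod_riem N (euclidean_riem k)) \<Gamma> Q \<pi> \<and> isometry M Q F)"


section \<open>Gradient Ricci solitons and the invariants of the Hessian\<close>

definition gradient_ricci_soliton :: "'a riem \<Rightarrow> ('a \<Rightarrow> real) \<Rightarrow> real \<Rightarrow> bool" where
  "gradient_ricci_soliton M f lam \<longleftrightarrow>
     riemannian_manifold M \<and> smooth_fun_on M (topspace (rtop M)) f \<and>
     (\<forall>c\<in>ratlas M. \<forall>x\<in>snd c ` fst c. \<forall>i<rdim M. \<forall>j<rdim M.
        hessian M c f i j x + ricci M c i j x = lam * gcomp M c i j x)"

text \<open>The matrix of the Hessian as an endomorphism of the tangent space.\<close>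

definition hessian_endo :: "'a riem \<Rightarrow> 'a chart \<Rightarrow> ('a \<Rightarrow> real) \<Rightarrow> (nat \<Rightarrow> real) \<Rightarrow> real mat" where
  "hessian_endo M c f x =
     ginv_mat M c x * mat (rdim M) (rdim M) (\<lambda>(i, j). hessian M c f i j x)"

text \<open>\<open>det (I + \<alpha> A)\<close> as a polynomial in the indeterminate \<open>\<alpha>\<close>.\<close>

definition det_poly :: "nat \<Rightarrow> real mat \<Rightarrow> real poly" where
  "det_poly n A = Determinant.det (1\<^sub>m n + [:0, 1:] \<cdot>\<^sub>m map_mat (\<lambda>a. [:a:]) A)"

text \<open>The invariant \<open>S\<^sub>m(f)\<close> as a function on \<open>M\<close>.  Its value at \<open>p\<close> does not depend on the chart
  around \<open>p\<close> in which it is computed, since the matrices of an endomorphism are similar.\<close>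

definition hessian_invariant :: "'a riem \<Rightarrow> ('a \<Rightarrow> real) \<Rightarrow> nat \<Rightarrow> 'a \<Rightarrow> real" where
  "hessian_invariant M f m p =
     (let c = (SOME c. c \<in> ratlas M \<and> p \<in> fst c)
      in coeff (det_poly (rdim M) (hessian_endo M c f (snd c p))) m)"

end

theory Submission
  imports Defs "HOL-Library.Function_Algebras"
begin

text \<open>
  Write \<open>u = \<Delta>f\<close>, \<open>w = |\<nabla>f|\<^sup>2\<close>.  The soliton equation, the contracted second Bianchi identity and
  the Ricci identity give \<open>\<nabla>u = 2 \<nabla>\<^sup>2f(\<nabla>f) - 2\<lambda>\<nabla>f\<close>, hence \<open>w - u - 2\<lambda>f\<close> is constant, and
  \<open>\<Delta>u = 2 |\<nabla>\<^sup>2f|\<^sup>2 - 2\<lambda>u + \<langle>\<nabla>f, \<nabla>u\<rangle>\<close>.  Moreover \<open>2 S\<^sub>2(f) = u\<^sup>2 - |\<nabla>\<^sup>2f|\<^sup>2\<close>.  Since \<open>u \<le> 0\<close> at a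
  maximum and \<open>u \<ge> 0\<close> at a minimum of \<open>f\<close>, \<open>u\<close> has a zero; so the constant \<open>S\<^sub>2(f)\<close> is at most \<open>0\<close> and
  \<open>|\<nabla>\<^sup>2f|\<^sup>2 \<ge> u\<^sup>2\<close> everywhere.  At a maximum of \<open>u\<close> this yields \<open>u \<le> \<lambda>\<close>.

  Let \<open>t\<close> be \<open>f\<close> shifted such that \<open>w = u + 2\<lambda>t\<close>, and \<open>v = 2\<lambda> - u\<close>.  At a maximum of
  \<open>3/2 t - 1/2 ln (1 + t) - ln v\<close>, nonpositivity of the Laplacian forces \<open>u = w = t = 0\<close>, so that this
  function is at most \<open>- ln (2\<lambda>)\<close>.  As \<open>v \<le> 2\<lambda>(1 + t)\<close>, this says \<open>t \<le> ln (1 + t)\<close>, i.e. \<open>t = 0\<close>.  Hence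
  \<open>f\<close> is constant and \<open>M\<close> is Einstein.
\<close>

section \<open>Calculus on open subsets of Euclidean space\<close>

text \<open>Only maximum principles are used; nothing is integrated over M. Constancy of
  \<open>S\<^sub>2\<close> carries its sign from the zero of u to all of M. The weights 3/2 and 1/2
  of the test function come from the last step: w >= 0 means v <= 2 lam (1 + t), so the bound
  becomes 3/2 t - 1/2 ln (1 + t) <= ln (1 + t), and 3/2 = 1/2 + 1 leaves exactly t <= ln (1 + t),
  the reverse of an elementary inequality. The derivative p = 3/2 - 1/(2(1 + t)) of the part in t is
  1 at t = 0. There the terms v p u and - 2 lam u of v times the Laplacian leave only - u^2, which 2
  |Hess f|^2 >= 2 u^2 outweighs, while the convexity of - 1/2 ln (1 + t) adds a positive multiple of
  w. The bound u <= lam comes first because it gives v >= lam > 0 and 1 + t = (v + w)/(2 lam) > 0,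
  so both logarithms make sense; the inequality at the maximum uses it again. The local formulas are
  algebra in a commutative ring with commuting derivations and are interpreted in each chart. Since
  maxima and constants are global, u, |Hess f|^2 and w must also be shown independent of the
  chart.\<close>

definition ebox :: "nat \<Rightarrow> (nat \<Rightarrow> real) \<Rightarrow> real \<Rightarrow> (nat \<Rightarrow> real) set" where
  "ebox n x e = {y \<in> topspace (Euclidean_space n). \<forall>i<n. \<bar>y i - x i\<bar> < e}"

lemma mem_topspace_Euclidean: "x \<in> topspace (Euclidean_space n) \<longleftrightarrow> (\<forall>i\<ge>n. x i = 0)"
  by (simp add: topspace_Euclidean_space)

lemma ebox_mono: "d \<le> e \<Longrightarrow> ebox n x d \<subseteq> ebox n x e"
  by (auto simp: ebox_def)

lemma openin_Euclidean_subset: "openin (Euclidean_space n) U \<Longrightarrow> x \<in> U \<Longrightarrow> x \<in> topspace (Euclidean_space n)"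
  using openin_subset by blast

text \<open>A basic open set of the product topology restricts finitely many coordinates, and those
  from \<open>n\<close> on are pinned to 0. Cubes rather than balls are used because paths that
  change one coordinate at a time stay inside them.\<close>

lemma openin_Euclidean_ebox:
  assumes "openin (Euclidean_space n) U" "x \<in> U"
  obtains e where "e > 0" "ebox n x e \<subseteq> U"
proof -
  have xE: "x \<in> topspace (Euclidean_space n)"
    using assms openin_Euclidean_subset by blast
  obtain W where W: "openin (powertop_real UNIV) W"
      and U: "U = W \<inter> {x. \<forall>i\<ge>n. x i = 0}"
    using assms(1) unfolding Euclidean_space_def openin_subtopology by auto
  obtain V where V: "\<And>i. openin euclideanreal (V i)" "x \<in> Pi\<^sub>E UNIV V" "Pi\<^sub>E UNIV V \<subseteq> W"
    using W assms(2) U unfolding openin_product_topology_alt by fastforce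
  have "\<exists>e>0. ball (x i) e \<subseteq> V i" for i
    using V(1)[of i] V(2) by (auto simp: open_contains_ball PiE_iff)
  then obtain E where E: "\<And>i. E i > 0" "\<And>i. ball (x i) (E i) \<subseteq> V i" by metis
  \<comment> \<open>The element 1 keeps the set nonempty for \<open>n = 0\<close>.\<close>
  define e where "e = Min (insert 1 (E ` {..<n}))"
  have "e > 0" unfolding e_def using E(1) by (subst Min_gr_iff) auto
  have eE: "e \<le> E i" if "i < n" for i
    unfolding e_def using that by (intro Min_le) auto
  have "ebox n x e \<subseteq> U"
  proof
    fix y assume y: "y \<in> ebox n x e"
    have "y i \<in> V i" for i
    proof (cases "i < n")
      case True
      then have "\<bar>y i - x i\<bar> < E i" using y eE[OF True] by (force simp: ebox_def)
      then have "y i \<in> ball (x i) (E i)" by (simp add: dist_real_def abs_minus_commute)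
      then show ?thesis using E(2) by blast
    next
      case False
      then have "y i = x i" using y xE by (auto simp: ebox_def mem_topspace_Euclidean)
      then show ?thesis using V(2) by (auto simp: PiE_iff)
    qed
    then have "y \<in> W" using V(3) by auto
    then show "y \<in> U" using y U by (auto simp: ebox_def mem_topspace_Euclidean)
  qed
  with \<open>e > 0\<close> show thesis by (rule that)
qed

lemma continuous_Euclidean_ebox:
  assumes "openin (Euclidean_space n) U" "continuous_map (subtopology (Euclidean_space n) U) euclideanreal F"
    and "x \<in> U" "e > 0"
  obtains d where "d > 0" "ebox n x d \<subseteq> U" "\<And>y. y \<in> ebox n x d \<Longrightarrow> \<bar>F y - F x\<bar> < e"
proof -
  have "openin (subtopology (Euclidean_space n) U)
      {y \<in> topspace (subtopology (Euclidean_space n) U). F y \<in> ball (F x) e}"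
    using assms(2) by (intro openin_continuous_map_preimage) auto
  then have "openin (Euclidean_space n) {y \<in> topspace (subtopology (Euclidean_space n) U). F y \<in> ball (F x) e}"
    using assms(1) openin_trans_full by blast
  moreover have "x \<in> {y \<in> topspace (subtopology (Euclidean_space n) U). F y \<in> ball (F x) e}"
    using assms openin_Euclidean_subset by auto
  ultimately obtain d where d: "d > 0"
    "ebox n x d \<subseteq> {y \<in> topspace (subtopology (Euclidean_space n) U). F y \<in> ball (F x) e}"
    by (rule openin_Euclidean_ebox)
  show thesis
    by (rule that[OF d(1)]) (use d(2) in \<open>auto simp: dist_real_def abs_minus_commute\<close>)
qed

lemma eventually_upd_in:
  assumes "openin (Euclidean_space n) U" "x \<in> U" "i < n"
  shows "\<forall>\<^sub>F t in nhds (x i). x(i := t) \<in> U"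
proof -
  obtain e where e: "e > 0" "ebox n x e \<subseteq> U" using openin_Euclidean_ebox assms by blast
  have "x(i := t) \<in> U" if "dist t (x i) < e" for t
  proof -
    have "x(i := t) \<in> ebox n x e"
      using that e(1) assms openin_Euclidean_subset[OF assms(1,2)]
      by (auto simp: ebox_def mem_topspace_Euclidean dist_real_def)
    then show ?thesis using e by blast
  qed
  then show ?thesis unfolding eventually_nhds_metric using e(1) by blast
qed

lemma partial_cong:
  assumes "openin (Euclidean_space n) U" "x \<in> U" "i < n" "\<And>y. y \<in> U \<Longrightarrow> F y = H y"
  shows "partial i F x = partial i H x"
  unfolding partial_def
  by (rule deriv_cong_ev) (use eventually_upd_in[OF assms(1-3)] assms(4) in \<open>auto elim: eventually_mono\<close>)

lemma differentiable_upd_cong: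
  fixes F H :: "(nat \<Rightarrow> real) \<Rightarrow> real"
  assumes "openin (Euclidean_space n) U" "x \<in> U" "i < n" "\<And>y. y \<in> U \<Longrightarrow> F y = H y"
    and "(\<lambda>t. F (x(i := t))) differentiable (at (x i))"
  shows "(\<lambda>t. H (x(i := t))) differentiable (at (x i))"
proof -
  have ev: "\<forall>\<^sub>F t in nhds (x i). F (x(i := t)) = H (x(i := t))"
    using eventually_upd_in[OF assms(1-3)] assms(4) by (auto elim: eventually_mono)
  obtain D where "((\<lambda>t. F (x(i := t))) has_real_derivative D) (at (x i))"
    using assms(5) real_differentiable_def by blast
  then have "((\<lambda>t. H (x(i := t))) has_real_derivative D) (at (x i))"
    using DERIV_cong_ev[OF refl ev refl] by blast
  then show ?thesis using real_differentiable_def by blast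
qed

section \<open>Differentiability classes and their closure under algebraic operations\<close>

declare Ck_on.simps(2) [simp del]

lemma Ck_on_continuous: "Ck_on n U k F \<Longrightarrow> continuous_map (subtopology (Euclidean_space n) U) euclideanreal F"
  by (cases k) (blast dest: Ck_on.simps(1)[THEN iffD1] Ck_on.simps(2)[THEN iffD1])+

lemma Ck_on_differentiable:
  "Ck_on n U (Suc k) F \<Longrightarrow> i < n \<Longrightarrow> x \<in> U \<Longrightarrow> (\<lambda>t. F (x(i := t))) differentiable (at (x i))"
  unfolding Ck_on.simps by blast

lemma Ck_on_partial: "Ck_on n U (Suc k) F \<Longrightarrow> i < n \<Longrightarrow> Ck_on n U k (partial i F)"
  unfolding Ck_on.simps by blast

lemma Ck_on_SucI:
  assumes "continuous_map (subtopology (Euclidean_space n) U) euclideanreal F"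
    and "\<And>i x. i < n \<Longrightarrow> x \<in> U \<Longrightarrow> (\<lambda>t. F (x(i := t))) differentiable (at (x i))"
    and "\<And>i. i < n \<Longrightarrow> Ck_on n U k (partial i F)"
  shows "Ck_on n U (Suc k) F"
  unfolding Ck_on.simps using assms by blast

text \<open>\<open>partial\<close> sees values of the functions off \<open>U\<close> as well;
  openness of \<open>U\<close> makes the relevant difference quotients depend on values in
  \<open>U\<close> only.\<close>

lemma Ck_on_cong:
  assumes "openin (Euclidean_space n) U" "\<And>y. y \<in> U \<Longrightarrow> F y = H y" "Ck_on n U k F"
  shows "Ck_on n U k H"
  using assms(2,3)
proof (induction k arbitrary: F H)
  case 0
  then show ?case by (auto intro: continuous_map_eq)
next
  case (Suc k)
  show ?case
  proof (rule Ck_on_SucI)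
    show "continuous_map (subtopology (Euclidean_space n) U) euclideanreal H"
      by (rule continuous_map_eq[OF Ck_on_continuous[OF Suc.prems(2)]]) (use Suc.prems(1) in simp)
    show "(\<lambda>t. H (x(i := t))) differentiable (at (x i))" if "i < n" "x \<in> U" for i x
      by (rule differentiable_upd_cong[OF assms(1) that(2,1) Suc.prems(1) Ck_on_differentiable[OF Suc.prems(2) that]])
    show "Ck_on n U k (partial i H)" if i: "i < n" for i
      by (rule Suc.IH[OF _ Ck_on_partial[OF Suc.prems(2) i]])
        (rule partial_cong[OF assms(1) _ i Suc.prems(1)])
  qed
qed

lemma Ck_on_SucD: "Ck_on n U (Suc k) F \<Longrightarrow> Ck_on n U k F"
proof (induction k arbitrary: F)
  case 0
  then show ?case using Ck_on_continuous by simp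
next
  case (Suc k)
  show ?case
    by (rule Ck_on_SucI[OF Ck_on_continuous[OF Suc.prems] Ck_on_differentiable[OF Suc.prems] Suc.IH[OF Ck_on_partial[OF Suc.prems]]])
qed

lemma continuous_map_open_subset:
  assumes "continuous_map (subtopology X U) Y F" "W \<subseteq> U"
  shows "continuous_map (subtopology X W) Y F"
  using assms continuous_map_from_subtopology_mono by blast

lemma Ck_on_subset: "Ck_on n U k F \<Longrightarrow> W \<subseteq> U \<Longrightarrow> Ck_on n W k F"
proof (induction k arbitrary: F)
  case 0
  then show ?case using continuous_map_open_subset[OF _ 0(2)] by simp
next
  case (Suc k)
  show ?case
    by (rule Ck_on_SucI[OF continuous_map_open_subset[OF Ck_on_continuous[OF Suc.prems(1)] Suc.prems(2)]
        Ck_on_differentiable[OF Suc.prems(1) _ subsetD[OF Suc.prems(2)]]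
        Suc.IH[OF Ck_on_partial[OF Suc.prems(1)] Suc.prems(2)]])
qed

lemma smooth_on_continuous:
  "smooth_on n U F \<Longrightarrow> continuous_map (subtopology (Euclidean_space n) U) euclideanreal F"
  unfolding smooth_on_def using Ck_on_continuous by blast

lemma smooth_on_partial: "smooth_on n U F \<Longrightarrow> i < n \<Longrightarrow> smooth_on n U (partial i F)"
  unfolding smooth_on_def using Ck_on_partial by blast

lemma smooth_on_differentiable:
  "smooth_on n U F \<Longrightarrow> i < n \<Longrightarrow> x \<in> U \<Longrightarrow> (\<lambda>t. F (x(i := t))) differentiable (at (x i))"
  unfolding smooth_on_def using Ck_on_differentiable by blast

lemma smooth_on_cong:
  "openin (Euclidean_space n) U \<Longrightarrow> smooth_on n U F \<Longrightarrow> (\<And>y. y \<in> U \<Longrightarrow> F y = H y) \<Longrightarrow> smooth_on n U H"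
  unfolding smooth_on_def using Ck_on_cong by blast

lemma smooth_on_subset: "smooth_on n U F \<Longrightarrow> W \<subseteq> U \<Longrightarrow> smooth_on n W F"
  unfolding smooth_on_def using Ck_on_subset by blast

lemma has_partial:
  "(\<lambda>t. F (x(i := t))) differentiable (at (x i)) \<Longrightarrow>
    ((\<lambda>t. F (x(i := t))) has_real_derivative partial i F x) (at (x i))"
  unfolding partial_def by (simp add: DERIV_deriv_iff_real_differentiable)

lemma smooth_on_has_partial:
  "smooth_on n U F \<Longrightarrow> i < n \<Longrightarrow> x \<in> U \<Longrightarrow>
    ((\<lambda>t. F (x(i := t))) has_real_derivative partial i F x) (at (x i))"
  by (rule has_partial) (rule smooth_on_differentiable)

lemma smooth_on_has_partial_upd:
  assumes "smooth_on n U F" "i < n" "x(i := s) \<in> U"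
  shows "((\<lambda>t. F (x(i := t))) has_real_derivative partial i F (x(i := s))) (at s)"
  using smooth_on_has_partial[OF assms] by simp

lemma partialI: "((\<lambda>t. F (x(i := t))) has_real_derivative D) (at (x i)) \<Longrightarrow> partial i F x = D"
  unfolding partial_def by (rule DERIV_imp_deriv)

lemma partial_const [simp]: "partial i (\<lambda>_. c) = (\<lambda>_. 0)"
  by (simp add: partial_def fun_eq_iff)

lemma Ck_on_const [simp]: "Ck_on n U k (\<lambda>_. c)"
  by (induction k arbitrary: c) (auto intro!: Ck_on_SucI)

lemma partial_coord: "partial i (\<lambda>x. x j) x = (if i = j then 1 else 0)"
  by (rule partialI) auto

lemma Ck_on_coord:
  assumes "openin (Euclidean_space n) U"
  shows "Ck_on n U k (\<lambda>x. x j)"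
proof -
  have c: "continuous_map (subtopology (Euclidean_space n) U) euclideanreal (\<lambda>x. x j)"
    unfolding Euclidean_space_def
    by (intro continuous_map_from_subtopology continuous_map_product_projection) auto
  show ?thesis
  proof (cases k)
    case 0
    then show ?thesis using c by simp
  next
    case (Suc k')
    have "partial i (\<lambda>x. x j) = (\<lambda>_. if i = j then 1 else 0)" for i
      by (simp add: fun_eq_iff partial_coord)
    moreover have "(\<lambda>t. (x(i := t)) j) differentiable (at (x i))" for i and x :: "nat \<Rightarrow> real"
      by (cases "i = j") auto
    ultimately show ?thesis using Suc c by (auto intro!: Ck_on_SucI)
  qed
qed

lemma partial_add:
  assumes "(\<lambda>t. F (x(i := t))) differentiable (at (x i))" "(\<lambda>t. H (x(i := t))) differentiable (at (x i))"
  shows "partial i (\<lambda>x. F x + H x) x = partial i F x + partial i H x"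
  using DERIV_add[OF assms[THEN has_partial]] by (intro partialI)

lemma partial_mult:
  assumes "(\<lambda>t. F (x(i := t))) differentiable (at (x i))" "(\<lambda>t. H (x(i := t))) differentiable (at (x i))"
  shows "partial i (\<lambda>x. F x * H x) x = partial i F x * H x + F x * partial i H x"
  using DERIV_mult[OF assms[THEN has_partial]] by (intro partialI) (simp del: fun_upd_apply add: mult_ac)

lemma partial_inverse:
  assumes "(\<lambda>t. F (x(i := t))) differentiable (at (x i))" "F x \<noteq> 0"
  shows "partial i (\<lambda>x. inverse (F x)) x = - (partial i F x * (inverse (F x) * inverse (F x)))"
  using DERIV_inverse'[OF has_partial[OF assms(1)]] assms(2) by (intro partialI) (simp del: fun_upd_apply add: mult_ac)

lemma partial_ln:
  assumes "(\<lambda>t. F (x(i := t))) differentiable (at (x i))" "F x > 0"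
  shows "partial i (\<lambda>x. ln (F x)) x = partial i F x * inverse (F x)"
  using DERIV_chain2[OF DERIV_ln_divide has_partial[OF assms(1)]] assms(2)
  by (intro partialI) (simp del: fun_upd_apply add: field_simps)

lemma Ck_on_add:
  assumes U: "openin (Euclidean_space n) U"
  shows "Ck_on n U k F \<Longrightarrow> Ck_on n U k H \<Longrightarrow> Ck_on n U k (\<lambda>x. F x + H x)"
proof (induction k arbitrary: F H)
  case 0
  then show ?case unfolding Ck_on.simps(1) by (intro continuous_map_add)
next
  case (Suc k)
  note d = Ck_on_differentiable[OF Suc.prems(1)] Ck_on_differentiable[OF Suc.prems(2)]
  show ?case
  proof (rule Ck_on_SucI)
    show "Ck_on n U k (partial i (\<lambda>x. F x + H x))" if i: "i < n" for i
      by (rule Ck_on_cong[OF U _ Suc.IH[OF Ck_on_partial[OF Suc.prems(1) i] Ck_on_partial[OF Suc.prems(2) i]]])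
        (rule partial_add[OF d(1)[OF i] d(2)[OF i], symmetric])
  next
    show "continuous_map (subtopology (Euclidean_space n) U) euclideanreal (\<lambda>x. F x + H x)"
      by (rule continuous_map_add[OF Ck_on_continuous[OF Suc.prems(1)] Ck_on_continuous[OF Suc.prems(2)]])
    show "(\<lambda>t. F (x(i := t)) + H (x(i := t))) differentiable (at (x i))" if "i < n" "x \<in> U" for i x
      by (rule differentiable_add[OF d(1)[OF that] d(2)[OF that]])
  qed
qed

lemma Ck_on_mult:
  assumes U: "openin (Euclidean_space n) U"
  shows "Ck_on n U k F \<Longrightarrow> Ck_on n U k H \<Longrightarrow> Ck_on n U k (\<lambda>x. F x * H x)"
proof (induction k arbitrary: F H)
  case 0
  then show ?case unfolding Ck_on.simps(1) by (intro continuous_map_real_mult)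
next
  case (Suc k)
  note d = Ck_on_differentiable[OF Suc.prems(1)] Ck_on_differentiable[OF Suc.prems(2)]
  show ?case
  proof (rule Ck_on_SucI)
    fix i assume i: "i < n"
    \<comment> \<open>The product rule also contains the undifferentiated factors, whose order is
      lowered by \<open>Ck_on_SucD\<close> to meet the induction hypothesis.\<close>
    have "Ck_on n U k (\<lambda>x. partial i F x * H x + F x * partial i H x)"
      using Suc.prems i by (intro Ck_on_add[OF U] Suc.IH Ck_on_partial Ck_on_SucD[OF Suc.prems(1)] Ck_on_SucD[OF Suc.prems(2)])
    then show "Ck_on n U k (partial i (\<lambda>x. F x * H x))"
      by (rule Ck_on_cong[OF U, rotated]) (rule partial_mult[OF d(1)[OF i] d(2)[OF i], symmetric])
  next
    show "continuous_map (subtopology (Euclidean_space n) U) euclideanreal (\<lambda>x. F x * H x)"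
      by (rule continuous_map_real_mult[OF Ck_on_continuous[OF Suc.prems(1)] Ck_on_continuous[OF Suc.prems(2)]])
    show "(\<lambda>t. F (x(i := t)) * H (x(i := t))) differentiable (at (x i))" if "i < n" "x \<in> U" for i x
      by (rule differentiable_mult[OF d(1)[OF that] d(2)[OF that]])
  qed
qed

text \<open>The derivative of 1/F is - F' (1/F)^2, so the induction runs with \<open>F\<close>
  fixed: the only reciprocal that occurs is 1/F itself, one order lower.\<close>

lemma Ck_on_inverse:
  assumes U: "openin (Euclidean_space n) U" and nz: "\<And>x. x \<in> U \<Longrightarrow> F x \<noteq> 0"
  shows "Ck_on n U k F \<Longrightarrow> Ck_on n U k (\<lambda>x. inverse (F x))"
proof (induction k)
  have c: "continuous_map (subtopology (Euclidean_space n) U) euclideanreal (\<lambda>x. inverse (F x))"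
    if "Ck_on n U k F" for k
    by (rule continuous_map_real_inverse[OF Ck_on_continuous[OF that]]) (use nz in simp)
  {
    case 0
    then show ?case using c[of 0] by simp
  next
    case (Suc k)
    show ?case
    proof (rule Ck_on_SucI[OF c[OF Suc.prems]])
      fix i assume i: "i < n"
      have "Ck_on n U k (\<lambda>x. -1 * (partial i F x * (inverse (F x) * inverse (F x))))"
        by (intro Ck_on_mult[OF U] Ck_on_const Suc.IH Ck_on_partial[OF Suc.prems i] Ck_on_SucD[OF Suc.prems])
      then show "Ck_on n U k (partial i (\<lambda>x. inverse (F x)))"
        by (rule Ck_on_cong[OF U, rotated])
          (subst partial_inverse[OF Ck_on_differentiable[OF Suc.prems i] nz], simp_all)
    next
      fix i x assume "i < n" "x \<in> U"
      then show "(\<lambda>t. inverse (F (x(i := t)))) differentiable (at (x i))"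
        using nz by (intro differentiable_inverse Ck_on_differentiable[OF Suc.prems]) simp_all
    qed
  }
qed

text \<open>The derivative F'/F contains no logarithm, so a case distinction on \<open>k\<close>
  replaces induction.\<close>

lemma Ck_on_ln:
  assumes U: "openin (Euclidean_space n) U" and pos: "\<And>x. x \<in> U \<Longrightarrow> F x > 0" and F: "Ck_on n U k F"
  shows "Ck_on n U k (\<lambda>x. ln (F x))"
proof -
  have "continuous_map (subtopology (Euclidean_space n) U) (top_of_set {0<..}) F"
    using Ck_on_continuous[OF F] pos by (simp add: continuous_map_in_subtopology image_subset_iff)
  moreover have "continuous_map (top_of_set {0<..}) euclideanreal (ln :: real \<Rightarrow> real)"
    unfolding continuous_map_iff_continuous by (intro continuous_intros) auto
  ultimately have "continuous_map (subtopology (Euclidean_space n) U) euclideanreal (ln \<circ> F)"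
    by (rule continuous_map_compose)
  then have c: "continuous_map (subtopology (Euclidean_space n) U) euclideanreal (\<lambda>x. ln (F x))"
    unfolding o_def .
  show ?thesis
  proof (cases k)
    case 0
    then show ?thesis using c by simp
  next
    case (Suc k')
    note F' = F[unfolded Suc]
    show ?thesis unfolding Suc
    proof (rule Ck_on_SucI[OF c])
      fix i assume i: "i < n"
      have "F x \<noteq> 0" if "x \<in> U" for x using pos[OF that] by simp
      then have "Ck_on n U k' (\<lambda>x. partial i F x * inverse (F x))"
        by (intro Ck_on_mult[OF U] Ck_on_inverse[OF U] Ck_on_partial[OF F' i] Ck_on_SucD[OF F'])
      then show "Ck_on n U k' (partial i (\<lambda>x. ln (F x)))"
        by (rule Ck_on_cong[OF U, rotated]) (subst partial_ln[OF Ck_on_differentiable[OF F' i] pos], simp_all)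
    next
      fix i x assume ix: "i < n" "x \<in> U"
      have "((\<lambda>t. ln (F (x(i := t)))) has_real_derivative (1 / F (x(i := x i)) * partial i F x)) (at (x i))"
        by (rule DERIV_chain2[OF DERIV_ln_divide has_partial[OF Ck_on_differentiable[OF F' ix]]])
          (use pos ix in simp)
      then show "(\<lambda>t. ln (F (x(i := t)))) differentiable (at (x i))"
        using real_differentiable_def by blast
    qed
  qed
qed

context
  fixes n U assumes U: "openin (Euclidean_space n) U"
begin

lemma smooth_on_const: "smooth_on n U (\<lambda>_. c)"
  by (simp add: smooth_on_def)

lemma smooth_on_coord: "smooth_on n U (\<lambda>x. x j)"
  using U by (simp add: smooth_on_def Ck_on_coord)

lemma smooth_on_add: "smooth_on n U F \<Longrightarrow> smooth_on n U H \<Longrightarrow> smooth_on n U (\<lambda>x. F x + H x)"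
  using U by (simp add: smooth_on_def Ck_on_add)

lemma smooth_on_mult: "smooth_on n U F \<Longrightarrow> smooth_on n U H \<Longrightarrow> smooth_on n U (\<lambda>x. F x * H x)"
  using U by (simp add: smooth_on_def Ck_on_mult)

lemma smooth_on_minus: "smooth_on n U F \<Longrightarrow> smooth_on n U (\<lambda>x. - F x)"
  using smooth_on_mult[OF smooth_on_const[of "-1"], of F] by simp

lemma smooth_on_diff: "smooth_on n U F \<Longrightarrow> smooth_on n U H \<Longrightarrow> smooth_on n U (\<lambda>x. F x - H x)"
  using smooth_on_add[OF _ smooth_on_minus, of F H] by simp

lemma smooth_on_sum:
  "(\<And>i. i \<in> I \<Longrightarrow> smooth_on n U (F i)) \<Longrightarrow> smooth_on n U (\<lambda>x. \<Sum>i\<in>I. F i x)"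
  by (induction I rule: infinite_finite_induct) (auto intro: smooth_on_add smooth_on_const)

lemma smooth_on_prod:
  "(\<And>i. i \<in> I \<Longrightarrow> smooth_on n U (F i)) \<Longrightarrow> smooth_on n U (\<lambda>x. \<Prod>i\<in>I. F i x)"
  by (induction I rule: infinite_finite_induct) (auto intro: smooth_on_mult smooth_on_const)

lemma smooth_on_inverse:
  "smooth_on n U F \<Longrightarrow> (\<And>x. x \<in> U \<Longrightarrow> F x \<noteq> 0) \<Longrightarrow> smooth_on n U (\<lambda>x. inverse (F x))"
  using U by (simp add: smooth_on_def Ck_on_inverse)

lemma smooth_on_ln:
  "smooth_on n U F \<Longrightarrow> (\<And>x. x \<in> U \<Longrightarrow> F x > 0) \<Longrightarrow> smooth_on n U (\<lambda>x. ln (F x))"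
  using U by (simp add: smooth_on_def Ck_on_ln)

context
  fixes i x assumes ix: "i < n" "x \<in> U"
begin

lemma partial_add_on: "smooth_on n U F \<Longrightarrow> smooth_on n U H \<Longrightarrow>
    partial i (\<lambda>x. F x + H x) x = partial i F x + partial i H x"
  using ix by (intro partial_add) (auto intro: smooth_on_differentiable)

lemma partial_mult_on: "smooth_on n U F \<Longrightarrow> smooth_on n U H \<Longrightarrow>
    partial i (\<lambda>x. F x * H x) x = partial i F x * H x + F x * partial i H x"
  using ix by (intro partial_mult) (auto intro: smooth_on_differentiable)

lemma partial_sum_on: "finite I \<Longrightarrow> (\<And>j. j \<in> I \<Longrightarrow> smooth_on n U (F j)) \<Longrightarrow>
    partial i (\<lambda>x. \<Sum>j\<in>I. F j x) x = (\<Sum>j\<in>I. partial i (F j) x)"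
  by (induction I rule: finite_induct) (auto simp: partial_add_on smooth_on_sum)

end
end

section \<open>Mean values, the chain rule and the symmetry of second derivatives\<close>

lemma MVT_segment:
  fixes \<phi> :: "real \<Rightarrow> real"
  assumes "\<And>t. t \<in> closed_segment a b \<Longrightarrow> (\<phi> has_real_derivative \<phi>' t) (at t)"
  shows "\<exists>z\<in>closed_segment a b. \<phi> b - \<phi> a = (b - a) * \<phi>' z"
proof -
  consider "a < b" | "b < a" | "a = b" by linarith
  then show ?thesis
  proof cases
    case 1
    then obtain z where "z > a" "z < b" "\<phi> b - \<phi> a = (b - a) * \<phi>' z"
      using MVT2[of a b \<phi> \<phi>'] assms by (auto simp: closed_segment_eq_real_ivl)
    then show ?thesis by (intro bexI[of _ z]) (auto simp: closed_segment_eq_real_ivl)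
  next
    case 2
    then obtain z where "z > b" "z < a" "\<phi> a - \<phi> b = (a - b) * \<phi>' z"
      using MVT2[of b a \<phi> \<phi>'] assms by (auto simp: closed_segment_eq_real_ivl)
    then show ?thesis by (intro bexI[of _ z]) (auto simp: closed_segment_eq_real_ivl algebra_simps)
  qed auto
qed

text \<open>Changing the coordinates of \<open>x\<close> into those of \<open>y\<close> one at a time writes the increment of a
  \<open>C\<^sup>1\<close> function as \<open>\<Sum>k. Q k y * (y k - x k)\<close> with \<open>Q k\<close> continuous at \<open>x\<close>.\<close>

lemma smooth_on_increment:
  assumes U: "openin (Euclidean_space n) U" and F: "smooth_on n U F" and x: "x \<in> U"
  obtains Q where
    "\<And>y. y \<in> topspace (Euclidean_space n) \<Longrightarrow> F y - F x = (\<Sum>k<n. Q k y * (y k - x k))"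
    "\<And>k e. k < n \<Longrightarrow> e > 0 \<Longrightarrow> \<exists>d>0. \<forall>y\<in>ebox n x d. \<bar>Q k y - partial k F x\<bar> < e"
proof -
  have xE: "\<And>j. j \<ge> n \<Longrightarrow> x j = 0"
    using openin_Euclidean_subset[OF U x] by (simp add: mem_topspace_Euclidean)
  \<comment> \<open>A staircase from \<open>x\<close> to \<open>y\<close>: the first
    \<open>k\<close> coordinates have already been changed.\<close>
  define h where "h y k = (\<lambda>j. if j < k then y j else x j)" for y :: "nat \<Rightarrow> real" and k
  \<comment> \<open>Where \<open>y k = x k\<close> the increment identity admits any value; the
    partial derivative is the one that makes \<open>Q k\<close> continuous at
    \<open>x\<close>.\<close>
  define Q where "Q k y = (if y k = x k then partial k F x else (F (h y (Suc k)) - F (h y k)) / (y k - x k))" for k y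
  have step: "F (h y (Suc k)) - F (h y k) = Q k y * (y k - x k)" for y k
  proof (cases "y k = x k")
    case True
    then have "h y (Suc k) = h y k" by (auto simp: h_def fun_eq_iff less_Suc_eq)
    then show ?thesis using True by simp
  qed (simp add: Q_def)
  have tele: "(\<Sum>k<m. Q k y * (y k - x k)) = F (h y m) - F (h y 0)" for y m
    using sum_lessThan_telescope[of "\<lambda>k. F (h y k)" m] by (simp add: step)
  show thesis
  proof (rule that)
    fix y assume y: "y \<in> topspace (Euclidean_space n)"
    have "h y n = y" using y xE by (auto simp: h_def fun_eq_iff mem_topspace_Euclidean)
    moreover have "h y 0 = x" by (simp add: h_def)
    ultimately show "F y - F x = (\<Sum>k<n. Q k y * (y k - x k))" using tele[of y n] by simp
  next
    fix k :: nat and e :: real assume k: "k < n" and e: "e > 0"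
    obtain d where d: "d > 0" "ebox n x d \<subseteq> U"
        and *: "\<And>y. y \<in> ebox n x d \<Longrightarrow> \<bar>partial k F y - partial k F x\<bar> < e"
      using continuous_Euclidean_ebox[OF U smooth_on_continuous[OF smooth_on_partial[OF F k]] x e] by blast
    have "\<bar>Q k y - partial k F x\<bar> < e" if y: "y \<in> ebox n x d" for y
    proof (cases "y k = x k")
      case True
      then show ?thesis using e by (simp add: Q_def)
    next
      case False
      have box: "(h y k)(k := t) \<in> ebox n x d" if "t \<in> closed_segment (x k) (y k)" for t
      proof -
        have "\<bar>t - x k\<bar> \<le> \<bar>y k - x k\<bar>" using that by (auto simp: closed_segment_eq_real_ivl split: if_splits)
        then show ?thesis using y d(1) xE k
          by (auto simp: ebox_def h_def mem_topspace_Euclidean intro: le_less_trans)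
      qed
      have "\<exists>z\<in>closed_segment (x k) (y k). F ((h y k)(k := y k)) - F ((h y k)(k := x k)) = (y k - x k) * partial k F ((h y k)(k := z))"
        by (rule MVT_segment) (use box d(2) smooth_on_has_partial_upd[OF F k] in blast)
      moreover have "(h y k)(k := y k) = h y (Suc k)" "(h y k)(k := x k) = h y k"
        by (auto simp: h_def fun_eq_iff less_Suc_eq)
      ultimately obtain z where z: "z \<in> closed_segment (x k) (y k)"
          "F (h y (Suc k)) - F (h y k) = (y k - x k) * partial k F ((h y k)(k := z))" by auto
      then have "Q k y = partial k F ((h y k)(k := z))" using False by (simp add: Q_def)
      then show ?thesis using *[OF box[OF z(1)]] by simp
    qed
    then show "\<exists>d>0. \<forall>y\<in>ebox n x d. \<bar>Q k y - partial k F x\<bar> < e" using d(1) by blast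
  qed
qed

text \<open>Dividing the increment formula by t - s reduces the claim to limits of finitely many
  products. Assumption \<open>E\<close> is there because the formula holds only at points whose
  coordinates from \<open>n\<close> on vanish.\<close>

lemma chain_rule:
  assumes U: "openin (Euclidean_space n) U" and F: "smooth_on n U F" and x: "\<gamma> s \<in> U"
    and d: "\<And>i. i < n \<Longrightarrow> ((\<lambda>t. \<gamma> t i) has_real_derivative d i) (at s)"
    and E: "\<forall>\<^sub>F t in at s. \<gamma> t \<in> topspace (Euclidean_space n)"
  shows "((\<lambda>t. F (\<gamma> t)) has_real_derivative (\<Sum>i<n. partial i F (\<gamma> s) * d i)) (at s)"
proof -
  obtain Q where Q: "\<And>y. y \<in> topspace (Euclidean_space n) \<Longrightarrow> F y - F (\<gamma> s) = (\<Sum>k<n. Q k y * (y k - \<gamma> s k))"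
    "\<And>k e. k < n \<Longrightarrow> e > 0 \<Longrightarrow> \<exists>d>0. \<forall>y\<in>ebox n (\<gamma> s) d. \<bar>Q k y - partial k F (\<gamma> s)\<bar> < e"
    using smooth_on_increment[OF U F x] by blast
  have ev: "\<forall>\<^sub>F t in at s. \<gamma> t \<in> ebox n (\<gamma> s) e" if "e > 0" for e
  proof -
    have "\<forall>\<^sub>F t in at s. \<bar>\<gamma> t i - \<gamma> s i\<bar> < e" if "i < n" for i
      using DERIV_isCont[OF d[OF that]] \<open>e > 0\<close>
      by (auto simp: isCont_def tendsto_iff dist_real_def)
    then have "\<forall>\<^sub>F t in at s. \<forall>i\<in>{..<n}. \<bar>\<gamma> t i - \<gamma> s i\<bar> < e"
      by (intro eventually_ball_finite) auto
    with E show ?thesis by eventually_elim (auto simp: ebox_def)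
  qed
  have "((\<lambda>t. Q k (\<gamma> t)) \<longlongrightarrow> partial k F (\<gamma> s)) (at s)" if "k < n" for k
    unfolding tendsto_iff
  proof (intro allI impI)
    fix e :: real assume "e > 0"
    then obtain r where "r > 0" "\<forall>y\<in>ebox n (\<gamma> s) r. \<bar>Q k y - partial k F (\<gamma> s)\<bar> < e"
      using Q(2) \<open>k < n\<close> by blast
    then show "\<forall>\<^sub>F t in at s. dist (Q k (\<gamma> t)) (partial k F (\<gamma> s)) < e"
      unfolding dist_real_def by (intro eventually_mono[OF ev]) auto
  qed
  then have "((\<lambda>t. \<Sum>k<n. Q k (\<gamma> t) * ((\<gamma> t k - \<gamma> s k) / (t - s))) \<longlongrightarrow> (\<Sum>i<n. partial i F (\<gamma> s) * d i)) (at s)"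
    using d by (intro tendsto_sum tendsto_mult) (auto simp: has_field_derivative_iff)
  moreover have "\<forall>\<^sub>F t in at s. (\<Sum>k<n. Q k (\<gamma> t) * ((\<gamma> t k - \<gamma> s k) / (t - s))) = (F (\<gamma> t) - F (\<gamma> s)) / (t - s)"
    using E by eventually_elim (simp add: Q(1) sum_divide_distrib)
  ultimately show ?thesis
    unfolding has_field_derivative_iff using Lim_transform_eventually by fast
qed

text \<open>The second difference of \<open>F\<close> over a small square is symmetric in the two
  directions, while the mean value theorem evaluates it as a mixed derivative in either order.
  Continuity of both mixed derivatives at \<open>x\<close> then forces equality.\<close>

lemma partial_commute:
  assumes U: "openin (Euclidean_space n) U" and F: "smooth_on n U F" and x: "x \<in> U" and ij: "i < n" "j < n"
  shows "partial i (partial j F) x = partial j (partial i F) x"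
proof (cases "i = j")
  case False
  have xE: "x \<in> topspace (Euclidean_space n)" using openin_Euclidean_subset[OF U x] .
  \<comment> \<open>Side length r/2 keeps the far corner of the square inside the open cube of
    radius r.\<close>
  have key: "\<exists>y\<in>ebox n x r. F (x(i := x i + r/2, j := x j + r/2)) - F (x(i := x i + r/2)) - F (x(j := x j + r/2)) + F x
      = (r/2)^2 * partial j (partial i F) y"
    if r: "r > 0" "ebox n x r \<subseteq> U" and ij: "i < n" "j < n" "i \<noteq> j" for i j r
  proof -
    have box: "x(i := a, j := b) \<in> ebox n x r"
      if "a \<in> closed_segment (x i) (x i + r/2)" "b \<in> closed_segment (x j) (x j + r/2)" for a b
      using that r(1) ij xE by (auto simp: ebox_def mem_topspace_Euclidean closed_segment_eq_real_ivl)
    have box': "x(j := b, i := a) \<in> ebox n x r"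
      if "a \<in> closed_segment (x i) (x i + r/2)" "b \<in> closed_segment (x j) (x j + r/2)" for a b
      using box[OF that] ij(3) by (simp add: fun_upd_twist)
    let ?\<phi> = "\<lambda>a. F (x(j := x j + r/2, i := a)) - F (x(j := x j, i := a))"
    have "\<exists>a\<in>closed_segment (x i) (x i + r/2). ?\<phi> (x i + r/2) - ?\<phi> (x i) =
      (x i + r/2 - x i) * (partial i F (x(j := x j + r/2, i := a)) - partial i F (x(j := x j, i := a)))"
    proof (rule MVT_segment)
      fix t assume t: "t \<in> closed_segment (x i) (x i + r/2)"
      have "x(j := b, i := t) \<in> U" if "b \<in> closed_segment (x j) (x j + r/2)" for b
        using box'[OF t that] r(2) by blast
      then have "x(j := x j + r/2, i := t) \<in> U" "x(j := x j, i := t) \<in> U" by (metis ends_in_segment)+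
      then show "(?\<phi> has_real_derivative
          partial i F (x(j := x j + r/2, i := t)) - partial i F (x(j := x j, i := t))) (at t)"
        using F ij by (intro DERIV_diff smooth_on_has_partial_upd)
    qed
    then obtain a where a: "a \<in> closed_segment (x i) (x i + r/2)" and 1: "?\<phi> (x i + r/2) - ?\<phi> (x i) =
      r/2 * (partial i F (x(j := x j + r/2, i := a)) - partial i F (x(j := x j, i := a)))" by auto
    have "\<exists>b\<in>closed_segment (x j) (x j + r/2). partial i F (x(i := a, j := x j + r/2)) - partial i F (x(i := a, j := x j))
      = (x j + r/2 - x j) * partial j (partial i F) (x(i := a, j := b))"
      by (rule MVT_segment)
        (use smooth_on_has_partial_upd[OF smooth_on_partial[OF F ij(1)] ij(2)] box[OF a] r(2) in blast)
    then obtain b where b: "b \<in> closed_segment (x j) (x j + r/2)" and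
      2: "partial i F (x(i := a, j := x j + r/2)) - partial i F (x(i := a, j := x j))
      = r/2 * partial j (partial i F) (x(i := a, j := b))" by auto
    have tw: "x(j := s, i := t) = x(i := t, j := s)" for s t using ij(3) by (simp add: fun_upd_twist)
    have "F (x(i := x i + r/2, j := x j + r/2)) - F (x(i := x i + r/2)) - F (x(j := x j + r/2)) + F x
      = r/2 * (r/2 * partial j (partial i F) (x(i := a, j := b)))"
      using 1 unfolding 2[symmetric] tw using ij(3) by (simp add: fun_upd_idem)
    then show ?thesis
      by (intro bexI[OF _ box[OF a b]]) (simp add: power2_eq_square)
  qed
  show ?thesis
  proof (rule ccontr)
    assume ne: "partial i (partial j F) x \<noteq> partial j (partial i F) x"
    \<comment> \<open>Half the gap: values within \<open>e\<close> of the two mixed derivatives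
      cannot coincide.\<close>
    define e where "e = \<bar>partial i (partial j F) x - partial j (partial i F) x\<bar> / 2"
    have e: "e > 0" using ne by (simp add: e_def)
    obtain d1 where d1: "d1 > 0" "ebox n x d1 \<subseteq> U"
        "\<And>y. y \<in> ebox n x d1 \<Longrightarrow> \<bar>partial i (partial j F) y - partial i (partial j F) x\<bar> < e"
      using continuous_Euclidean_ebox[OF U smooth_on_continuous[OF smooth_on_partial[OF smooth_on_partial[OF F ij(2)] ij(1)]] x e] by blast
    obtain d2 where d2: "d2 > 0" "ebox n x d2 \<subseteq> U"
        "\<And>y. y \<in> ebox n x d2 \<Longrightarrow> \<bar>partial j (partial i F) y - partial j (partial i F) x\<bar> < e"
      using continuous_Euclidean_ebox[OF U smooth_on_continuous[OF smooth_on_partial[OF smooth_on_partial[OF F ij(1)] ij(2)]] x e] by blast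
    define r where "r = min d1 d2"
    have r: "r > 0" "r \<le> d1" "r \<le> d2" using d1 d2 by (auto simp: r_def)
    have rU: "ebox n x r \<subseteq> U" using ebox_mono[OF r(2), of n x] d1(2) by blast
    obtain y where y: "y \<in> ebox n x r" "F (x(i := x i + r/2, j := x j + r/2)) - F (x(i := x i + r/2)) - F (x(j := x j + r/2)) + F x
      = (r/2)^2 * partial j (partial i F) y" using key[OF r(1) rU ij False] by blast
    obtain z where z: "z \<in> ebox n x r" "F (x(j := x j + r/2, i := x i + r/2)) - F (x(j := x j + r/2)) - F (x(i := x i + r/2)) + F x
      = (r/2)^2 * partial i (partial j F) z" using key[OF r(1) rU ij(2,1)] False by blast
    have "(r/2)^2 * partial j (partial i F) y = (r/2)^2 * partial i (partial j F) z"
      using y(2) z(2) unfolding fun_upd_twist[OF False] by linarith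
    then have eq: "partial j (partial i F) y = partial i (partial j F) z" using r(1) by simp
    have "\<bar>partial i (partial j F) z - partial i (partial j F) x\<bar> < e"
      using d1(3) z(1) ebox_mono[OF r(2), of n x] by blast
    moreover have "\<bar>partial j (partial i F) y - partial j (partial i F) x\<bar> < e"
      using d2(3) y(1) ebox_mono[OF r(3), of n x] by blast
    ultimately have "\<bar>partial i (partial j F) x - partial j (partial i F) x\<bar> < 2 * e"
      unfolding eq by linarith
    then show False by (simp add: e_def)
  qed
qed simp

section \<open>Derivatives along lines, and maxima\<close>

lemma line_in_ebox:
  assumes "x \<in> topspace (Euclidean_space n)" "\<And>i. i \<ge> n \<Longrightarrow> \<xi> i = 0" "\<And>i. i < n \<Longrightarrow> \<bar>s * \<xi> i\<bar> < e"
  shows "(\<lambda>i. x i + s * \<xi> i) \<in> ebox n x e"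
  using assms by (auto simp: ebox_def mem_topspace_Euclidean)

lemma has_derivative_along_line:
  assumes U: "openin (Euclidean_space n) U" and F: "smooth_on n U F" and \<xi>: "\<And>i. i \<ge> n \<Longrightarrow> \<xi> i = 0"
    and xE: "x \<in> topspace (Euclidean_space n)" and x: "(\<lambda>i. x i + s * \<xi> i) \<in> U"
  shows "((\<lambda>t. F (\<lambda>i. x i + t * \<xi> i)) has_real_derivative (\<Sum>i<n. partial i F (\<lambda>i. x i + s * \<xi> i) * \<xi> i)) (at s)"
  by (rule chain_rule[OF U F, where \<gamma> = "\<lambda>t i. x i + t * \<xi> i"])
    (use x xE \<xi> in \<open>auto intro!: derivative_eq_intros simp: mem_topspace_Euclidean\<close>)

text \<open>The cube is convex, so the mean value theorem applies along the segment from
  \<open>x\<close> to \<open>y\<close>.\<close>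

lemma constant_on_ebox:
  assumes U: "openin (Euclidean_space n) U" and F: "smooth_on n U F" and x: "x \<in> U"
    and box: "ebox n x e \<subseteq> U" and y: "y \<in> ebox n x e"
    and 0: "\<And>i y. i < n \<Longrightarrow> y \<in> U \<Longrightarrow> partial i F y = 0"
  shows "F y = F x"
proof -
  have xE: "x \<in> topspace (Euclidean_space n)" using openin_Euclidean_subset[OF U x] .
  define \<xi> where "\<xi> i = y i - x i" for i
  have \<xi>: "\<And>i. i \<ge> n \<Longrightarrow> \<xi> i = 0" using xE y by (auto simp: \<xi>_def ebox_def mem_topspace_Euclidean)
  have "\<exists>s\<in>closed_segment 0 (1::real). F (\<lambda>i. x i + 1 * \<xi> i) - F (\<lambda>i. x i + 0 * \<xi> i) =
      (1 - 0) * (\<Sum>i<n. partial i F (\<lambda>i. x i + s * \<xi> i) * \<xi> i)"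
  proof (rule MVT_segment[of 0 1 "\<lambda>t. F (\<lambda>i. x i + t * \<xi> i)" "\<lambda>s. \<Sum>i<n. partial i F (\<lambda>i. x i + s * \<xi> i) * \<xi> i"])
    fix s :: real assume "s \<in> closed_segment 0 1"
    then have s: "0 \<le> s" "s \<le> 1" by (auto simp: closed_segment_eq_real_ivl)
    have "\<bar>s * \<xi> i\<bar> < e" if "i < n" for i
    proof -
      have "\<bar>s * \<xi> i\<bar> \<le> \<bar>\<xi> i\<bar>" using mult_right_mono[of s 1 "\<bar>\<xi> i\<bar>"] s by (simp add: abs_mult)
      also have "\<dots> < e" using y that by (simp add: ebox_def \<xi>_def)
      finally show ?thesis .
    qed
    then have "(\<lambda>i. x i + s * \<xi> i) \<in> U" by (intro subsetD[OF box] line_in_ebox[OF xE \<xi>])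
    then show "((\<lambda>t. F (\<lambda>i. x i + t * \<xi> i)) has_real_derivative (\<Sum>i<n. partial i F (\<lambda>i. x i + s * \<xi> i) * \<xi> i)) (at s)"
      by (intro has_derivative_along_line[OF U F \<xi> xE])
  qed
  then obtain s where s: "s \<in> closed_segment 0 1"
    "F (\<lambda>i. x i + 1 * \<xi> i) - F (\<lambda>i. x i + 0 * \<xi> i) = (1 - 0) * (\<Sum>i<n. partial i F (\<lambda>i. x i + s * \<xi> i) * \<xi> i)"
    by (elim bexE)
  have "(\<lambda>i. x i + 1 * \<xi> i) = y" "(\<lambda>i. x i + 0 * \<xi> i) = x" by (simp_all add: \<xi>_def)
  note diff = s(2)[unfolded this]
  have "\<bar>s * \<xi> i\<bar> < e" if "i < n" for i
  proof -
    have "\<bar>s * \<xi> i\<bar> \<le> \<bar>\<xi> i\<bar>"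
      using mult_right_mono[of s 1 "\<bar>\<xi> i\<bar>"] s(1) by (simp add: abs_mult closed_segment_eq_real_ivl)
    also have "\<dots> < e" using y that by (simp add: ebox_def \<xi>_def)
    finally show ?thesis .
  qed
  then have U': "(\<lambda>i. x i + s * \<xi> i) \<in> U" by (intro subsetD[OF box] line_in_ebox[OF xE \<xi>])
  have "partial i F (\<lambda>i. x i + s * \<xi> i) = 0" if "i < n" for i by (rule 0[OF that U'])
  then have "(\<Sum>i<n. partial i F (\<lambda>i. x i + s * \<xi> i) * \<xi> i) = 0" by simp
  then show ?thesis using diff by simp
qed

context
  fixes n U F x
  assumes U: "openin (Euclidean_space n) U" and F: "smooth_on n U F" and x: "x \<in> U"
    and mx: "\<And>y. y \<in> U \<Longrightarrow> F y \<le> F x"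
begin

lemma partial_zero_at_max:
  assumes i: "i < n"
  shows "partial i F x = 0"
proof -
  obtain e where e: "e > 0" "ebox n x e \<subseteq> U" using openin_Euclidean_ebox[OF U x] .
  have "x(i := t) \<in> U" if "\<bar>x i - t\<bar> < e" for t
    using e that openin_Euclidean_subset[OF U x] i
    by (intro subsetD[OF e(2)]) (auto simp: ebox_def mem_topspace_Euclidean)
  then show ?thesis
    using DERIV_local_max[OF smooth_on_has_partial[OF F i x] e(1)] mx by auto
qed

text \<open>The double sum is the second derivative of \<open>F\<close> along a line through
  \<open>x\<close>. Were it positive, the first derivative, which vanishes at \<open>x\<close>,
  would be positive just after it, and \<open>F\<close> would exceed its maximum.\<close>

lemma hessian_nonpos_at_max: "(\<Sum>i<n. \<Sum>j<n. partial j (partial i F) x * \<xi> i * \<xi> j) \<le> 0"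
proof -
  have xE: "x \<in> topspace (Euclidean_space n)" using openin_Euclidean_subset[OF U x] .
  obtain e where e: "e > 0" "ebox n x e \<subseteq> U" using openin_Euclidean_ebox[OF U x] .
  \<comment> \<open>The direction is truncated so that the line stays in the n-dimensional
    space.\<close>
  define \<zeta> where "\<zeta> i = (if i < n then \<xi> i else 0)" for i
  have \<zeta>: "\<And>i. i \<ge> n \<Longrightarrow> \<zeta> i = 0" by (simp add: \<zeta>_def)
  \<comment> \<open>The element 1 keeps \<open>C\<close> positive, so that \<open>e / C\<close> is a
    valid step size even for a zero direction or \<open>n = 0\<close>.\<close>
  define C where "C = Max (insert 1 ((\<lambda>i. \<bar>\<xi> i\<bar>) ` {..<n}))"
  have C: "C \<ge> 1" "\<And>i. i < n \<Longrightarrow> \<bar>\<xi> i\<bar> \<le> C" unfolding C_def by (auto intro: Max_ge)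
  define r where "r = e / C"
  have r: "r > 0" using e C by (simp add: r_def)
  have lU: "(\<lambda>i. x i + s * \<zeta> i) \<in> U" if "\<bar>s\<bar> < r" for s
  proof -
    have "\<bar>s * \<zeta> i\<bar> < e" if "i < n" for i
    proof -
      have "\<bar>s\<bar> * \<bar>\<xi> i\<bar> \<le> \<bar>s\<bar> * C" using C(2)[OF that] by (intro mult_left_mono) auto
      also have "\<dots> < e" using \<open>\<bar>s\<bar> < r\<close> C(1) by (simp add: r_def field_simps)
      finally show ?thesis using that by (simp add: \<zeta>_def abs_mult)
    qed
    then show ?thesis by (intro subsetD[OF e(2)] line_in_ebox[OF xE \<zeta>])
  qed
  define \<phi> where "\<phi> t = F (\<lambda>i. x i + t * \<zeta> i)" for t
  define \<psi> where "\<psi> t = (\<Sum>i<n. partial i F (\<lambda>i. x i + t * \<zeta> i) * \<zeta> i)" for t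
  have d1: "(\<phi> has_real_derivative \<psi> s) (at s)" if "\<bar>s\<bar> < r" for s
    unfolding \<phi>_def \<psi>_def by (rule has_derivative_along_line[OF U F \<zeta> xE lU[OF that]])
  have "(\<psi> has_real_derivative (\<Sum>i<n. (\<Sum>j<n. partial j (partial i F) (\<lambda>i. x i + 0 * \<zeta> i) * \<zeta> j) * \<zeta> i)) (at 0)"
    unfolding \<psi>_def
    by (intro DERIV_sum DERIV_cmult_right has_derivative_along_line[OF U smooth_on_partial[OF F] \<zeta> xE lU]) (use r in auto)
  moreover have "(\<Sum>i<n. (\<Sum>j<n. partial j (partial i F) (\<lambda>i. x i + 0 * \<zeta> i) * \<zeta> j) * \<zeta> i)
      = (\<Sum>i<n. \<Sum>j<n. partial j (partial i F) x * \<xi> i * \<xi> j)"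
    by (auto simp: \<zeta>_def sum_distrib_left sum_distrib_right mult_ac intro!: sum.cong)
  ultimately have d2: "(\<psi> has_real_derivative (\<Sum>i<n. \<Sum>j<n. partial j (partial i F) x * \<xi> i * \<xi> j)) (at 0)"
    by simp
  have "\<psi> 0 = 0" unfolding \<psi>_def using partial_zero_at_max by simp
  show ?thesis
  proof (rule ccontr)
    assume "\<not> ?thesis"
    then obtain d where d: "d > 0" "\<And>h. h > 0 \<Longrightarrow> h < d \<Longrightarrow> \<psi> 0 < \<psi> (0 + h)"
      using DERIV_pos_inc_right[OF d2] by fastforce
    define b where "b = min d r / 2"
    have b: "b > 0" "b < d" "b < r" using d r by (auto simp: b_def)
    obtain z where z: "z > 0" "z < b" "\<phi> b - \<phi> 0 = (b - 0) * \<psi> z"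
      using MVT2[of 0 b \<phi> \<psi>] b d1 by auto
    have "\<psi> z > 0" using d(2)[of z] z b \<open>\<psi> 0 = 0\<close> by simp
    then have "\<phi> b > \<phi> 0" using z(3) mult_pos_pos[OF b(1), of "\<psi> z"] by simp
    moreover have "\<phi> b \<le> \<phi> 0" unfolding \<phi>_def using mx[OF lU[of b]] b by simp
    ultimately show False by simp
  qed
qed

end

section \<open>Curvature identities over a differential ring\<close>

text \<open>In the application \<open>S\<close> consists of the smooth functions in a chart and \<open>D i\<close> is the \<open>i\<close>-th
  partial derivative; \<open>G\<close> is the inverse of the metric, and \<open>D_G\<close> says that it is parallel for
  the connection with the Christoffel symbols \<open>\<Gamma>\<close>.\<close>

locale christoffel_algebra =
  fixes S :: "'r::comm_ring_1 set" and D :: "nat \<Rightarrow> 'r \<Rightarrow> 'r" and n :: nat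
    and G :: "nat \<Rightarrow> nat \<Rightarrow> 'r" and \<Gamma> :: "nat \<Rightarrow> nat \<Rightarrow> nat \<Rightarrow> 'r"
  assumes S_0 [simp]: "0 \<in> S" and S_add [simp]: "a \<in> S \<Longrightarrow> b \<in> S \<Longrightarrow> a + b \<in> S"
    and S_minus [simp]: "a \<in> S \<Longrightarrow> - a \<in> S" and S_mult [simp]: "a \<in> S \<Longrightarrow> b \<in> S \<Longrightarrow> a * b \<in> S"
    and S_D [simp]: "a \<in> S \<Longrightarrow> D i a \<in> S"
    and D_add [simp]: "a \<in> S \<Longrightarrow> b \<in> S \<Longrightarrow> D i (a + b) = D i a + D i b"
    and D_mult [simp]: "a \<in> S \<Longrightarrow> b \<in> S \<Longrightarrow> D i (a * b) = D i a * b + a * D i b"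
    and D_comm: "a \<in> S \<Longrightarrow> D i (D j a) = D j (D i a)"
    and two_regular: "(a :: 'r) + a = 0 \<Longrightarrow> a = 0"
    and S_G [simp]: "G i j \<in> S" and S_\<Gamma> [simp]: "\<Gamma> k i j \<in> S"
    and G_sym: "G i j = G j i" and \<Gamma>_sym: "\<Gamma> k i j = \<Gamma> k j i"
    and D_G: "D i (G k l) = - (\<Sum>p<n. \<Gamma> k i p * G p l) - (\<Sum>p<n. \<Gamma> l i p * G k p)"
begin

lemma S_diff [simp]: "a \<in> S \<Longrightarrow> b \<in> S \<Longrightarrow> a - b \<in> S"
  using S_add[of a "- b"] by simp

lemma S_sum [simp]: "(\<And>i. i \<in> I \<Longrightarrow> h i \<in> S) \<Longrightarrow> sum h I \<in> S"
  by (induction I rule: infinite_finite_induct) auto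

lemma D_0 [simp]: "D i 0 = 0"
  using D_add[of 0 0 i] by simp

lemma D_minus [simp]: "a \<in> S \<Longrightarrow> D i (- a) = - D i a"
  using D_add[of a "- a" i] by (simp add: eq_neg_iff_add_eq_0 add.commute)

lemma D_diff [simp]: "a \<in> S \<Longrightarrow> b \<in> S \<Longrightarrow> D i (a - b) = D i a - D i b"
  using D_add[of a "- b" i] by simp

lemma D_sum [simp]: "(\<And>j. j \<in> I \<Longrightarrow> h j \<in> S) \<Longrightarrow> D i (sum h I) = (\<Sum>j\<in>I. D i (h j))"
  by (induction I rule: infinite_finite_induct) auto

text \<open>Exchanging the names of the two indices turns the contraction into its own negative;
  \<open>two_regular\<close> replaces division by 2.\<close>

lemma sum_skew_sym:
  assumes "\<And>l p. T l p = - T p l" "\<And>l p. K l p = K p l"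
  shows "(\<Sum>l<n. \<Sum>p<n. K l p * T l p) = (0 :: 'r)"
proof (rule two_regular)
  have "(\<Sum>l<n. \<Sum>p<n. K l p * T l p) = (\<Sum>p<n. \<Sum>l<n. K l p * T l p)" by (rule sum.swap)
  also have "\<dots> = (\<Sum>p<n. \<Sum>l<n. - (K p l * T p l))"
    by (intro sum.cong refl) (subst assms(1), subst assms(2), simp)
  also have "\<dots> = - (\<Sum>l<n. \<Sum>p<n. K l p * T l p)" by (simp add: sum_negf)
  finally show "(\<Sum>l<n. \<Sum>p<n. K l p * T l p) + (\<Sum>l<n. \<Sum>p<n. K l p * T l p) = 0"
    by (simp only: eq_neg_iff_add_eq_0)
qed

section \<open>Curvature and the Bianchi identities\<close>

definition Rm :: "nat \<Rightarrow> nat \<Rightarrow> nat \<Rightarrow> nat \<Rightarrow> 'r" where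
  "Rm l i j k = D i (\<Gamma> l j k) - D j (\<Gamma> l i k) + (\<Sum>m<n. \<Gamma> m j k * \<Gamma> l i m - \<Gamma> m i k * \<Gamma> l j m)"

text \<open>The curvature with its last index raised. Raising that index instead of lowering
  \<open>l\<close> expresses metric compatibility through \<open>G\<close> alone, as skew-symmetry
  in \<open>l\<close> and \<open>m\<close>.\<close>

definition Q :: "nat \<Rightarrow> nat \<Rightarrow> nat \<Rightarrow> nat \<Rightarrow> 'r" where
  "Q i j l m = (\<Sum>k<n. Rm l i j k * G k m)"

lemma S_Rm [simp]: "Rm l i j k \<in> S"
  by (simp add: Rm_def)

lemma S_Q [simp]: "Q i j l m \<in> S"
  by (simp add: Q_def)

lemma Rm_skew: "Rm l i j k = - Rm l j i k"
  by (simp add: Rm_def sum_subtractf)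

lemma Q_skew1: "Q i j l m = - Q j i l m"
  unfolding Q_def by (subst Rm_skew) (simp add: sum_negf)

text \<open>The six sums are kept apart for the commutator in \<open>i\<close> and \<open>j\<close>:
  exchanging \<open>i\<close> and \<open>j\<close> permutes the last two, which cancel, and the
  others assemble into curvature.\<close>

lemma D_D_G:
  "D i (D j (G l m)) = - (\<Sum>p<n. D i (\<Gamma> l j p) * G p m) - (\<Sum>p<n. D i (\<Gamma> m j p) * G p l)
    + (\<Sum>p<n. \<Sum>q<n. \<Gamma> l j p * \<Gamma> p i q * G q m) + (\<Sum>p<n. \<Sum>q<n. \<Gamma> m j p * \<Gamma> p i q * G q l)
    + (\<Sum>p<n. \<Sum>q<n. \<Gamma> l j p * \<Gamma> m i q * G p q) + (\<Sum>p<n. \<Sum>q<n. \<Gamma> m j p * \<Gamma> l i q * G p q)"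
proof -
  have 1: "D i (\<Sum>p<n. \<Gamma> l j p * G p m) = (\<Sum>p<n. D i (\<Gamma> l j p) * G p m)
      - (\<Sum>p<n. \<Sum>q<n. \<Gamma> l j p * \<Gamma> p i q * G q m) - (\<Sum>p<n. \<Sum>q<n. \<Gamma> l j p * \<Gamma> m i q * G p q)" for l m
    by (simp add: D_G sum.distrib right_diff_distrib sum_subtractf sum_negf sum_distrib_left mult.assoc)
  have "D j (G l m) = - (\<Sum>p<n. \<Gamma> l j p * G p m) - (\<Sum>p<n. \<Gamma> m j p * G p l)"
    by (subst D_G) (simp add: G_sym[of l])
  then show ?thesis by (simp add: 1 del: D_sum)
qed

lemma Q_expand:
  "Q i j l m = (\<Sum>p<n. D i (\<Gamma> l j p) * G p m) - (\<Sum>p<n. D j (\<Gamma> l i p) * G p m)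
    + (\<Sum>p<n. \<Sum>q<n. \<Gamma> l i p * \<Gamma> p j q * G q m) - (\<Sum>p<n. \<Sum>q<n. \<Gamma> l j p * \<Gamma> p i q * G q m)"
proof -
  have *: "(\<Sum>k<n. (\<Sum>p<n. \<Gamma> p j k * \<Gamma> l i p) * G k m) = (\<Sum>p<n. \<Sum>q<n. \<Gamma> l i p * \<Gamma> p j q * G q m)" for i j
    unfolding sum_distrib_right by (subst sum.swap) (simp add: mult_ac)
  show ?thesis
    unfolding Q_def Rm_def sum_subtractf left_diff_distrib distrib_right sum.distrib * by simp
qed

text \<open>Metric compatibility: commuting second derivatives of \<open>G\<close>.\<close>

lemma Q_skew2: "Q i j l m = - Q i j m l"
proof -
  have z: "(\<Sum>p<n. \<Sum>q<n. \<Gamma> m j p * \<Gamma> l i q * G p q) = (\<Sum>p<n. \<Sum>q<n. \<Gamma> l i p * \<Gamma> m j q * G p q)" for i j l m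
    by (subst sum.swap) (simp add: mult_ac G_sym)
  have "D i (D j (G l m)) = D j (D i (G l m))" by (rule D_comm) simp
  then have "Q i j l m + Q i j m l = 0"
    unfolding D_D_G Q_expand z[of l j m i] z[of l i m j] by (simp add: algebra_simps)
  then show ?thesis by (simp add: eq_neg_iff_add_eq_0)
qed

text \<open>The covariant derivative of the endomorphism \<open>R(\<partial>\<^sub>i, \<partial>\<^sub>j)\<close> without the Christoffel terms for \<open>i\<close> and \<open>j\<close>,
  which cancel in cyclic sums as \<open>\<Gamma>\<close> is symmetric.\<close>

definition DR :: "nat \<Rightarrow> nat \<Rightarrow> nat \<Rightarrow> nat \<Rightarrow> nat \<Rightarrow> 'r" where
  "DR k i j l m = D k (Rm l i j m) + (\<Sum>p<n. \<Gamma> l k p * Rm p i j m) - (\<Sum>p<n. Rm l i j p * \<Gamma> p k m)"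

lemma DR_expand:
  "DR k i j l m = D k (D i (\<Gamma> l j m)) - D k (D j (\<Gamma> l i m))
   + (\<Sum>p<n. D k (\<Gamma> l i p) * \<Gamma> p j m) + (\<Sum>p<n. \<Gamma> l i p * D k (\<Gamma> p j m))
   - (\<Sum>p<n. D k (\<Gamma> l j p) * \<Gamma> p i m) - (\<Sum>p<n. \<Gamma> l j p * D k (\<Gamma> p i m))
   + (\<Sum>p<n. \<Gamma> l k p * D i (\<Gamma> p j m)) - (\<Sum>p<n. \<Gamma> l k p * D j (\<Gamma> p i m))
   + (\<Sum>p<n. \<Sum>q<n. \<Gamma> l k p * \<Gamma> p i q * \<Gamma> q j m) - (\<Sum>p<n. \<Sum>q<n. \<Gamma> l k p * \<Gamma> p j q * \<Gamma> q i m)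
   - (\<Sum>p<n. D i (\<Gamma> l j p) * \<Gamma> p k m) + (\<Sum>p<n. D j (\<Gamma> l i p) * \<Gamma> p k m)
   - (\<Sum>p<n. \<Sum>q<n. \<Gamma> l i p * \<Gamma> p j q * \<Gamma> q k m) + (\<Sum>p<n. \<Sum>q<n. \<Gamma> l j p * \<Gamma> p i q * \<Gamma> q k m)"
proof -
  have 1: "D k (Rm l i j m) = D k (D i (\<Gamma> l j m)) - D k (D j (\<Gamma> l i m))
    + (\<Sum>p<n. D k (\<Gamma> l i p) * \<Gamma> p j m) + (\<Sum>p<n. \<Gamma> l i p * D k (\<Gamma> p j m))
    - (\<Sum>p<n. D k (\<Gamma> l j p) * \<Gamma> p i m) - (\<Sum>p<n. \<Gamma> l j p * D k (\<Gamma> p i m))"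
    unfolding Rm_def by (simp add: sum.distrib sum_subtractf mult.commute algebra_simps)
  have 2: "(\<Sum>p<n. \<Gamma> l k p * Rm p i j m) = (\<Sum>p<n. \<Gamma> l k p * D i (\<Gamma> p j m)) - (\<Sum>p<n. \<Gamma> l k p * D j (\<Gamma> p i m))
    + (\<Sum>p<n. \<Sum>q<n. \<Gamma> l k p * \<Gamma> p i q * \<Gamma> q j m) - (\<Sum>p<n. \<Sum>q<n. \<Gamma> l k p * \<Gamma> p j q * \<Gamma> q i m)"
    unfolding Rm_def by (simp add: sum.distrib sum_subtractf sum_distrib_left distrib_left right_diff_distrib mult_ac)
  have swp: "(\<Sum>p<n. \<Sum>q<n. \<Gamma> q j p * \<Gamma> l i q * \<Gamma> p k m) = (\<Sum>p<n. \<Sum>q<n. \<Gamma> l i p * \<Gamma> p j q * \<Gamma> q k m)" for i j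
    by (subst sum.swap) (simp add: mult_ac)
  have 3: "(\<Sum>p<n. Rm l i j p * \<Gamma> p k m) = (\<Sum>p<n. D i (\<Gamma> l j p) * \<Gamma> p k m) - (\<Sum>p<n. D j (\<Gamma> l i p) * \<Gamma> p k m)
    + (\<Sum>p<n. \<Sum>q<n. \<Gamma> l i p * \<Gamma> p j q * \<Gamma> q k m) - (\<Sum>p<n. \<Sum>q<n. \<Gamma> l j p * \<Gamma> p i q * \<Gamma> q k m)"
    unfolding Rm_def swp[symmetric]
    by (simp add: sum.distrib sum_subtractf sum_distrib_right distrib_right left_diff_distrib)
  show ?thesis unfolding DR_def 1 2 3 by (simp add: algebra_simps)
qed

lemma second_Bianchi: "DR k i j l m + DR i j k l m + DR j k i l m = 0"
proof -
  have "D k (D i (\<Gamma> l j m)) = D i (D k (\<Gamma> l j m))" "D k (D j (\<Gamma> l i m)) = D j (D k (\<Gamma> l i m))"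
    "D j (D i (\<Gamma> l k m)) = D i (D j (\<Gamma> l k m))"
    by (simp_all add: D_comm)
  then show ?thesis unfolding DR_expand by (simp add: algebra_simps)
qed

definition DQ :: "nat \<Rightarrow> nat \<Rightarrow> nat \<Rightarrow> nat \<Rightarrow> nat \<Rightarrow> 'r" where
  "DQ k i j l m = D k (Q i j l m) + (\<Sum>p<n. \<Gamma> l k p * Q i j p m) + (\<Sum>p<n. \<Gamma> m k p * Q i j l p)"

text \<open>Raising an index commutes with covariant differentiation because \<open>G\<close> is
  parallel.\<close>

lemma DQ_eq: "DQ k i j l m = (\<Sum>q<n. DR k i j l q * G q m)"
proof -
  have a: "(\<Sum>q<n. (\<Sum>p<n. Rm l i j p * \<Gamma> p k q) * G q m) = (\<Sum>q<n. \<Sum>p<n. Rm l i j q * (\<Gamma> q k p * G p m))"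
    unfolding sum_distrib_right by (subst sum.swap) (simp add: mult_ac)
  have b: "(\<Sum>q<n. (\<Sum>p<n. \<Gamma> l k p * Rm p i j q) * G q m) = (\<Sum>p<n. \<Gamma> l k p * Q i j p m)"
    unfolding sum_distrib_right sum_distrib_left Q_def by (subst sum.swap) (simp add: mult_ac)
  have c: "(\<Sum>q<n. \<Sum>p<n. Rm l i j q * (\<Gamma> m k p * G q p)) = (\<Sum>p<n. \<Gamma> m k p * Q i j l p)"
    unfolding sum_distrib_left Q_def by (subst sum.swap) (simp add: mult_ac)
  have "D k (Q i j l m) = (\<Sum>q<n. D k (Rm l i j q) * G q m)
      - (\<Sum>q<n. \<Sum>p<n. Rm l i j q * (\<Gamma> q k p * G p m)) - (\<Sum>q<n. \<Sum>p<n. Rm l i j q * (\<Gamma> m k p * G q p))"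
    unfolding Q_def by (simp add: D_G sum.distrib right_diff_distrib sum_subtractf sum_negf sum_distrib_left)
  then show ?thesis
    unfolding DQ_def c DR_def left_diff_distrib distrib_right sum.distrib sum_subtractf a b by simp
qed

text \<open>The Ricci tensor with its second index raised.\<close>

definition P :: "nat \<Rightarrow> nat \<Rightarrow> 'r" where
  "P i m = (\<Sum>l<n. Q l i l m)"

text \<open>The divergence of a tensor whose first index is upper and second lower. The arguments of
  \<open>P\<close> come in the opposite order, hence the exchange of indices wherever
  \<open>div1\<close> is applied to it.\<close>

definition div1 :: "(nat \<Rightarrow> nat \<Rightarrow> 'r) \<Rightarrow> nat \<Rightarrow> 'r" where
  "div1 X i = (\<Sum>l<n. D l (X l i)) + (\<Sum>l<n. \<Sum>p<n. \<Gamma> l l p * X p i) - (\<Sum>l<n. \<Sum>p<n. \<Gamma> p l i * X l p)"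

lemma S_P [simp]: "P i m \<in> S"
  by (simp add: P_def)

text \<open>Contract the second Bianchi identity over two pairs of indices. The outer summands each
  give the leading part of a divergence of \<open>P\<close>; the middle one gives minus the
  derivative of the scalar curvature together with the remaining Christoffel terms of both
  divergences. The doubled form avoids dividing by 2.\<close>

lemma contracted_Bianchi: "div1 (\<lambda>l i. P i l) i + div1 (\<lambda>l i. P i l) i = D i (\<Sum>j<n. P j j)"
proof -
  have "0 = (\<Sum>l<n. \<Sum>j<n. DQ l i j l j + DQ i j l l j + DQ j l i l j)"
    unfolding DQ_eq sum.distrib[symmetric] distrib_right[symmetric] second_Bianchi by simp
  also have "\<dots> = (\<Sum>l<n. \<Sum>j<n. DQ l i j l j) + (\<Sum>l<n. \<Sum>j<n. DQ i j l l j) + (\<Sum>l<n. \<Sum>j<n. DQ j l i l j)"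
    by (simp add: sum.distrib)
  also have "(\<Sum>l<n. \<Sum>j<n. DQ l i j l j) = (\<Sum>l<n. D l (P i l)) + (\<Sum>l<n. \<Sum>p<n. \<Gamma> l l p * P i p)"
  proof -
    have PQ: "P i l = (\<Sum>j<n. Q i j l j)" for l
      unfolding P_def by (intro sum.cong refl) (metis Q_skew1 Q_skew2 minus_minus)
    have "(\<Sum>l<n. \<Sum>j<n. \<Sum>p<n. \<Gamma> j l p * Q i j l p) = (\<Sum>j<n. \<Sum>l<n. \<Sum>p<n. \<Gamma> j l p * Q i j l p)"
      by (rule sum.swap)
    also have "\<dots> = 0"
      by (intro sum.neutral ballI sum_skew_sym) (rule Q_skew2, rule \<Gamma>_sym)
    finally have 0: "(\<Sum>l<n. \<Sum>j<n. \<Sum>p<n. \<Gamma> j l p * Q i j l p) = 0" .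
    have 1: "(\<Sum>j<n. \<Sum>p<n. \<Gamma> l l p * Q i j p j) = (\<Sum>p<n. \<Gamma> l l p * P i p)" for l
      unfolding PQ sum_distrib_left by (rule sum.swap)
    show ?thesis unfolding DQ_def sum.distrib 0 1 by (simp add: PQ)
  qed
  also have "(\<Sum>l<n. \<Sum>j<n. DQ i j l l j) = - D i (\<Sum>j<n. P j j) - (\<Sum>l<n. \<Sum>p<n. \<Gamma> p l i * P p l) - (\<Sum>l<n. \<Sum>p<n. \<Gamma> p l i * P p l)"
  proof -
    have q1: "(\<Sum>j<n. Q j l p j) = - P l p" for l p
      unfolding P_def sum_negf[symmetric] by (intro sum.cong refl Q_skew2)
    have q2: "(\<Sum>l<n. Q j l l p) = - P j p" for j p
      unfolding P_def sum_negf[symmetric] by (intro sum.cong refl Q_skew1)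
    have 1: "(\<Sum>l<n. \<Sum>j<n. D i (Q j l l j)) = - D i (\<Sum>j<n. P j j)"
    proof -
      have "(\<Sum>l<n. \<Sum>j<n. D i (Q j l l j)) = D i (\<Sum>l<n. \<Sum>j<n. Q j l l j)" by simp
      also have "(\<Sum>l<n. \<Sum>j<n. Q j l l j) = - (\<Sum>j<n. P j j)" unfolding q1 by (simp add: sum_negf)
      finally show ?thesis by simp
    qed
    have "(\<Sum>l<n. \<Sum>j<n. \<Sum>p<n. \<Gamma> l i p * Q j l p j) = (\<Sum>l<n. \<Sum>p<n. \<Gamma> l i p * (\<Sum>j<n. Q j l p j))"
      unfolding sum_distrib_left by (intro sum.cong refl sum.swap)
    also have "\<dots> = - (\<Sum>l<n. \<Sum>p<n. \<Gamma> l i p * P l p)" unfolding q1 by (simp add: sum_negf)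
    also have "(\<Sum>l<n. \<Sum>p<n. \<Gamma> l i p * P l p) = (\<Sum>l<n. \<Sum>p<n. \<Gamma> p l i * P p l)"
      by (subst sum.swap) (simp add: \<Gamma>_sym[of _ i])
    finally have 2: "(\<Sum>l<n. \<Sum>j<n. \<Sum>p<n. \<Gamma> l i p * Q j l p j) = - (\<Sum>l<n. \<Sum>p<n. \<Gamma> p l i * P p l)" .
    have "(\<Sum>l<n. \<Sum>j<n. \<Sum>p<n. \<Gamma> j i p * Q j l l p) = (\<Sum>j<n. \<Sum>l<n. \<Sum>p<n. \<Gamma> j i p * Q j l l p)"
      by (rule sum.swap)
    also have "\<dots> = (\<Sum>j<n. \<Sum>p<n. \<Gamma> j i p * (\<Sum>l<n. Q j l l p))"
      unfolding sum_distrib_left by (intro sum.cong refl sum.swap)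
    also have "\<dots> = - (\<Sum>l<n. \<Sum>p<n. \<Gamma> l i p * P l p)" unfolding q2 by (simp add: sum_negf)
    also have "(\<Sum>l<n. \<Sum>p<n. \<Gamma> l i p * P l p) = (\<Sum>l<n. \<Sum>p<n. \<Gamma> p l i * P p l)"
      by (subst sum.swap) (simp add: \<Gamma>_sym[of _ i])
    finally have 3: "(\<Sum>l<n. \<Sum>j<n. \<Sum>p<n. \<Gamma> j i p * Q j l l p) = - (\<Sum>l<n. \<Sum>p<n. \<Gamma> p l i * P p l)" .
    show ?thesis unfolding DQ_def sum.distrib 1 2 3 by simp
  qed
  also have "(\<Sum>l<n. \<Sum>j<n. DQ j l i l j) = (\<Sum>l<n. D l (P i l)) + (\<Sum>l<n. \<Sum>p<n. \<Gamma> l l p * P i p)"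
  proof -
    have 0: "(\<Sum>l<n. \<Sum>j<n. \<Sum>p<n. \<Gamma> l j p * Q l i p j) = 0"
      by (intro sum.neutral ballI sum_skew_sym) (rule Q_skew2, rule \<Gamma>_sym)
    have 1: "(\<Sum>l<n. \<Sum>j<n. D j (Q l i l j)) = (\<Sum>l<n. D l (P i l))"
      by (subst sum.swap) (simp add: P_def)
    have "(\<Sum>l<n. \<Sum>j<n. \<Sum>p<n. \<Gamma> j j p * Q l i l p) = (\<Sum>j<n. \<Sum>l<n. \<Sum>p<n. \<Gamma> j j p * Q l i l p)"
      by (rule sum.swap)
    also have "\<dots> = (\<Sum>l<n. \<Sum>p<n. \<Gamma> l l p * P i p)"
      unfolding P_def sum_distrib_left by (intro sum.cong refl sum.swap)
    finally have 2: "(\<Sum>l<n. \<Sum>j<n. \<Sum>p<n. \<Gamma> j j p * Q l i l p) = (\<Sum>l<n. \<Sum>p<n. \<Gamma> l l p * P i p)" .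
    show ?thesis unfolding DQ_def sum.distrib 0 1 2 by simp
  qed
  finally show ?thesis unfolding div1_def by (simp add: algebra_simps eq_neg_iff_add_eq_0)
qed

section \<open>Hessian, gradient and Laplacian\<close>

definition Hess :: "'r \<Rightarrow> nat \<Rightarrow> nat \<Rightarrow> 'r" where
  "Hess \<phi> i j = D i (D j \<phi>) - (\<Sum>k<n. \<Gamma> k i j * D k \<phi>)"

definition grad :: "'r \<Rightarrow> nat \<Rightarrow> 'r" where
  "grad \<phi> a = (\<Sum>b<n. G a b * D b \<phi>)"

text \<open>The Hessian as an endomorphism: \<open>a\<close> is the upper index. By
  \<open>D_grad\<close> it is the covariant derivative of the gradient.\<close>

definition A :: "'r \<Rightarrow> nat \<Rightarrow> nat \<Rightarrow> 'r" where
  "A \<phi> a j = (\<Sum>b<n. G a b * Hess \<phi> b j)"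

definition lap :: "'r \<Rightarrow> 'r" where
  "lap \<phi> = (\<Sum>i<n. A \<phi> i i)"

definition ip :: "'r \<Rightarrow> 'r \<Rightarrow> 'r" where
  "ip \<phi> \<psi> = (\<Sum>a<n. grad \<phi> a * D a \<psi>)"

lemma S_Hess [simp]: "\<phi> \<in> S \<Longrightarrow> Hess \<phi> i j \<in> S" by (simp add: Hess_def)
lemma S_grad [simp]: "\<phi> \<in> S \<Longrightarrow> grad \<phi> i \<in> S" by (simp add: grad_def)
lemma S_A [simp]: "\<phi> \<in> S \<Longrightarrow> A \<phi> i j \<in> S" by (simp add: A_def)
lemma S_lap [simp]: "\<phi> \<in> S \<Longrightarrow> lap \<phi> \<in> S" by (simp add: lap_def)
lemma S_ip [simp]: "\<phi> \<in> S \<Longrightarrow> \<psi> \<in> S \<Longrightarrow> ip \<phi> \<psi> \<in> S" by (simp add: ip_def)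

lemma Hess_sym: "\<phi> \<in> S \<Longrightarrow> Hess \<phi> i j = Hess \<phi> j i"
  unfolding Hess_def by (subst D_comm) (simp_all add: \<Gamma>_sym)

text \<open>The derivative of \<open>G\<close> contributes two Christoffel sums: one is the
  correction of a vector field, the other completes the second derivative to the Hessian.\<close>

lemma D_grad: "\<phi> \<in> S \<Longrightarrow> D k (grad \<phi> a) = A \<phi> a k - (\<Sum>p<n. \<Gamma> a k p * grad \<phi> p)"
proof -
  assume \<phi>: "\<phi> \<in> S"
  have 1: "(\<Sum>b<n. (\<Sum>p<n. \<Gamma> a k p * G p b) * D b \<phi>) = (\<Sum>p<n. \<Gamma> a k p * grad \<phi> p)"
    unfolding grad_def sum_distrib_left sum_distrib_right by (subst sum.swap) (simp add: mult_ac)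
  have 2: "(\<Sum>b<n. (\<Sum>p<n. \<Gamma> b k p * G a p) * D b \<phi>) = (\<Sum>b<n. G a b * (\<Sum>p<n. \<Gamma> p b k * D p \<phi>))"
    unfolding sum_distrib_left sum_distrib_right by (subst sum.swap) (simp add: mult_ac \<Gamma>_sym[of _ k])
  have "D k (grad \<phi> a) = - (\<Sum>b<n. (\<Sum>p<n. \<Gamma> a k p * G p b) * D b \<phi>) - (\<Sum>b<n. (\<Sum>p<n. \<Gamma> b k p * G a p) * D b \<phi>)
      + (\<Sum>b<n. G a b * D k (D b \<phi>))"
    unfolding grad_def using \<phi> by (simp add: D_G sum.distrib left_diff_distrib sum_subtractf sum_negf)
  also have "(\<Sum>b<n. G a b * D k (D b \<phi>)) = (\<Sum>b<n. G a b * D b (D k \<phi>))" using \<phi> by (simp add: D_comm[of \<phi> k])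
  finally show ?thesis unfolding 1 2 A_def Hess_def
    by (simp add: right_diff_distrib sum_subtractf)
qed

lemma A_contract: "(\<Sum>b<n. A \<phi> b k * D b \<psi>) = (\<Sum>b<n. grad \<psi> b * Hess \<phi> b k)"
  unfolding A_def grad_def sum_distrib_right by (subst sum.swap) (simp add: mult_ac G_sym)

lemma D_ip:
  assumes "\<phi> \<in> S" "\<psi> \<in> S"
  shows "D k (ip \<phi> \<psi>) = (\<Sum>b<n. A \<phi> b k * D b \<psi>) + (\<Sum>b<n. A \<psi> b k * D b \<phi>)"
proof -
  have 1: "(\<Sum>a<n. (\<Sum>p<n. \<Gamma> a k p * grad \<phi> p) * D a \<psi>) = (\<Sum>b<n. grad \<phi> b * (\<Sum>p<n. \<Gamma> p k b * D p \<psi>))"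
    unfolding sum_distrib_left sum_distrib_right by (subst sum.swap) (simp add: mult_ac)
  have "D k (ip \<phi> \<psi>) = (\<Sum>b<n. A \<phi> b k * D b \<psi>) - (\<Sum>a<n. (\<Sum>p<n. \<Gamma> a k p * grad \<phi> p) * D a \<psi>)
      + (\<Sum>b<n. grad \<phi> b * D k (D b \<psi>))"
    unfolding ip_def using assms by (simp add: D_grad sum.distrib left_diff_distrib sum_subtractf)
  also have "\<dots> = (\<Sum>b<n. A \<phi> b k * D b \<psi>) + (\<Sum>b<n. grad \<phi> b * Hess \<psi> b k)"
    unfolding 1 using assms by (simp add: Hess_sym[of \<psi> _ k]) (simp add: Hess_def right_diff_distrib sum_subtractf)
  finally show ?thesis unfolding A_contract .
qed

text \<open>Second derivatives of the components of the gradient commute. The Christoffel correction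
  for the lower index of \<open>A\<close> is symmetric in \<open>i\<close> and \<open>j\<close> and
  drops out of the difference.\<close>

lemma Ricci_identity:
  assumes \<phi>: "\<phi> \<in> S"
  shows "D i (A \<phi> a j) + (\<Sum>p<n. \<Gamma> a i p * A \<phi> p j) - D j (A \<phi> a i) - (\<Sum>p<n. \<Gamma> a j p * A \<phi> p i)
    = (\<Sum>k<n. Rm a i j k * grad \<phi> k)"
proof -
  have DD: "D i (D j (grad \<phi> a)) = D i (A \<phi> a j) - (\<Sum>p<n. D i (\<Gamma> a j p) * grad \<phi> p)
      - (\<Sum>p<n. \<Gamma> a j p * A \<phi> p i) + (\<Sum>k<n. (\<Sum>p<n. \<Gamma> p i k * \<Gamma> a j p) * grad \<phi> k)" for i j
  proof -
    have "(\<Sum>p<n. \<Sum>k<n. \<Gamma> a j p * (\<Gamma> p i k * grad \<phi> k)) = (\<Sum>k<n. (\<Sum>p<n. \<Gamma> p i k * \<Gamma> a j p) * grad \<phi> k)"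
      unfolding sum_distrib_right by (subst sum.swap) (simp add: mult_ac)
    then show ?thesis using \<phi>
      by (simp add: D_grad sum.distrib right_diff_distrib sum_subtractf sum_distrib_left)
  qed
  have "D i (D j (grad \<phi> a)) = D j (D i (grad \<phi> a))" using \<phi> by (intro D_comm) simp
  then show ?thesis
    unfolding DD Rm_def by (simp add: algebra_simps sum.distrib sum_subtractf)
qed

text \<open>The Ricci identity contracted over \<open>a = i\<close>: the divergence of the Hessian
  is the differential of the Laplacian plus Ricci applied to the gradient.\<close>

lemma div_A:
  assumes \<phi>: "\<phi> \<in> S"
  shows "div1 (A \<phi>) j = D j (lap \<phi>) + (\<Sum>b<n. P j b * D b \<phi>)"
proof -
  have P: "(\<Sum>i<n. \<Sum>k<n. Rm i i j k * grad \<phi> k) = (\<Sum>b<n. P j b * D b \<phi>)"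
  proof -
    have "(\<Sum>k<n. Rm i i j k * grad \<phi> k) = (\<Sum>b<n. Q i j i b * D b \<phi>)" for i
      unfolding grad_def Q_def sum_distrib_left sum_distrib_right by (subst sum.swap) (simp add: mult_ac)
    then show ?thesis unfolding P_def sum_distrib_right by (simp only:) (rule sum.swap)
  qed
  have G: "(\<Sum>i<n. \<Sum>p<n. \<Gamma> i j p * A \<phi> p i) = (\<Sum>l<n. \<Sum>p<n. \<Gamma> p l j * A \<phi> l p)"
    by (subst sum.swap) (simp add: \<Gamma>_sym[of _ j])
  have "(\<Sum>i<n. D i (A \<phi> i j) + (\<Sum>p<n. \<Gamma> i i p * A \<phi> p j) - D j (A \<phi> i i) - (\<Sum>p<n. \<Gamma> i j p * A \<phi> p i))
    = (\<Sum>b<n. P j b * D b \<phi>)" unfolding P[symmetric] Ricci_identity[OF \<phi>] by (rule refl)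
  then show ?thesis
    unfolding sum.distrib sum_subtractf G div1_def lap_def using \<phi> by (simp add: algebra_simps)
qed

lemma lap_vector:
  assumes \<phi>: "\<phi> \<in> S"
  shows "lap \<phi> = (\<Sum>i<n. D i (grad \<phi> i)) + (\<Sum>i<n. \<Sum>p<n. \<Gamma> i i p * grad \<phi> p)"
  using \<phi> by (simp add: D_grad lap_def sum_subtractf)

end

text \<open>\<open>lam\<close> is a ring element annihilated by all derivations, because constants
  will be functions. The soliton equation appears with one index raised, which puts the upper index
  \<open>m\<close> first in \<open>A\<close> but second in \<open>P\<close>.\<close>

locale soliton_algebra = christoffel_algebra S D n G \<Gamma>
  for S :: "'r::comm_ring_1 set" and D n G \<Gamma> +
  fixes f lam :: 'r
  assumes f_S [simp]: "f \<in> S" and lam_S [simp]: "lam \<in> S" and D_lam [simp]: "D i lam = 0"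
    and soliton: "i < n \<Longrightarrow> m < n \<Longrightarrow> P i m = (if i = m then lam else 0) - A f m i"
begin

text \<open>\<open>P\<close> and \<open>- A f\<close> differ by \<open>lam\<close> times the
  identity, which is parallel: its two Christoffel contributions to the divergence cancel.\<close>

lemma div_P: "i < n \<Longrightarrow> div1 (\<lambda>l i. P i l) i = - div1 (A f) i"
proof -
  assume i: "i < n"
  have 1: "(\<Sum>l<n. D l (P i l)) = - (\<Sum>l<n. D l (A f l i))"
    unfolding sum_negf[symmetric] by (rule sum.cong) (auto simp: soliton i)
  have d: "(\<Sum>p<n. K p * (if q = p then lam else 0)) = K q * lam" if "q < n" for q and K :: "nat \<Rightarrow> 'r"
    using that by (simp add: if_distrib sum.delta cong: if_cong)
  have 2: "(\<Sum>l<n. \<Sum>p<n. \<Gamma> l l p * P i p) = (\<Sum>l<n. \<Gamma> l l i * lam) - (\<Sum>l<n. \<Sum>p<n. \<Gamma> l l p * A f p i)"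
    unfolding sum_subtractf[symmetric] d[OF i, symmetric]
    by (intro sum.cong refl) (simp add: soliton i right_diff_distrib)
  have "(\<Sum>p<n. \<Gamma> p l i * P p l) = \<Gamma> l l i * lam - (\<Sum>p<n. \<Gamma> p l i * A f l p)" if l: "l < n" for l
    unfolding sum_subtractf[symmetric] d[OF l, of "\<lambda>p. \<Gamma> p l i", symmetric]
    by (intro sum.cong refl) (auto simp: soliton l right_diff_distrib)
  then have 3: "(\<Sum>l<n. \<Sum>p<n. \<Gamma> p l i * P p l) = (\<Sum>l<n. \<Gamma> l l i * lam) - (\<Sum>l<n. \<Sum>p<n. \<Gamma> p l i * A f l p)"
    unfolding sum_subtractf[symmetric] by (intro sum.cong refl) auto
  show ?thesis unfolding div1_def 1 2 3 by simp
qed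

text \<open>The scalar curvature is n lam - \<Delta>f, so the contracted Bianchi identity becomes a
  statement about the Hessian.\<close>

lemma two_div_A: "j < n \<Longrightarrow> div1 (A f) j + div1 (A f) j = D j (lap f)"
proof -
  assume j: "j < n"
  have "(\<Sum>i<n. P i i) = (\<Sum>i<n. lam) - lap f"
    unfolding lap_def sum_subtractf[symmetric] by (intro sum.cong refl) (simp add: soliton)
  then have "D j (\<Sum>i<n. P i i) = D j (\<Sum>i<n. lam) - D j (lap f)" by (simp del: sum_constant)
  also have "D j (\<Sum>i<n. lam) = 0" by (simp del: sum_constant)
  finally have "D j (\<Sum>i<n. P i i) = - D j (lap f)" by simp
  then have "- (div1 (A f) j) + - (div1 (A f) j) = - D j (lap f)"
    using contracted_Bianchi[of j] unfolding div_P[OF j] by simp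
  then show ?thesis by (metis add.inverse_distrib_swap neg_equal_iff_equal)
qed

text \<open>Eliminate the divergence of the Hessian between \<open>div_A\<close>, with Ricci
  replaced by the soliton equation, and \<open>two_div_A\<close>.\<close>

lemma D_lap: "j < n \<Longrightarrow> D j (lap f) = (\<Sum>b<n. A f b j * D b f) + (\<Sum>b<n. A f b j * D b f) - (lam * D j f + lam * D j f)"
proof -
  assume j: "j < n"
  have "(\<Sum>b<n. P j b * D b f) = (\<Sum>b<n. (if j = b then lam else 0) * D b f) - (\<Sum>b<n. A f b j * D b f)"
    unfolding sum_subtractf[symmetric] by (intro sum.cong refl) (simp add: soliton j left_diff_distrib)
  also have "(\<Sum>b<n. (if j = b then lam else 0) * D b f) = lam * D j f"
    using j by (simp add: if_distrib if_distribR sum.delta cong: if_cong)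
  finally have *: "(\<Sum>b<n. A f b j * D b f) - lam * D j f = D j (lap f) - div1 (A f) j"
    using div_A[OF f_S, of j] by simp
  have "(\<Sum>b<n. A f b j * D b f) + (\<Sum>b<n. A f b j * D b f) - (lam * D j f + lam * D j f)
      = D j (lap f) + D j (lap f) - (div1 (A f) j + div1 (A f) j)"
  proof -
    have "a + a - (b + b) = (a - b) + (a - b)" for a b :: 'r by (simp add: algebra_simps)
    then show ?thesis by (simp only: *)
  qed
  then show ?thesis using two_div_A[OF j] by simp
qed

lemma conservation: "k < n \<Longrightarrow> D k (ip f f - lap f - (lam * f + lam * f)) = 0"
proof -
  assume "k < n"
  then have "D k (ip f f) - D k (lap f) = D k (lam * f) + D k (lam * f)" by (simp add: D_ip D_lap)
  then show ?thesis by (simp only: D_diff D_add S_ip S_lap S_mult S_diff S_add f_S lam_S diff_self)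
qed

text \<open>Take the divergence of \<nabla>\<Delta>f = 2 X - 2 lam \<nabla>f, where X is the Hessian
  applied to \<nabla>f. The divergence of X is the trace of the squared Hessian plus the divergence
  of the Hessian paired with \<nabla>f; twice the latter is \<langle>\<nabla>f,
  \<nabla>\<Delta>f\<rangle> by \<open>two_div_A\<close>.\<close>

lemma lap_lap: "lap (lap f) = (\<Sum>i<n. \<Sum>c<n. A f i c * A f c i) + (\<Sum>i<n. \<Sum>c<n. A f i c * A f c i)
    - (lam * lap f + lam * lap f) + ip f (lap f)"
proof -
  define X where "X a = (\<Sum>c<n. A f a c * grad f c)" for a
  have X_S [simp]: "X a \<in> S" for a by (simp add: X_def)
  have gr: "grad (lap f) a = X a + X a - (lam * grad f a + lam * grad f a)" for a
  proof -
    have 1: "(\<Sum>j<n. G a j * (\<Sum>b<n. A f b j * D b f)) = X a"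
    proof -
      have "(\<Sum>b<n. A f b j * D b f) = (\<Sum>b<n. Hess f j b * grad f b)" for j
        unfolding A_contract by (simp add: Hess_sym[of f j] mult.commute)
      then have "(\<Sum>j<n. G a j * (\<Sum>b<n. A f b j * D b f)) = (\<Sum>j<n. \<Sum>b<n. G a j * Hess f j b * grad f b)"
        by (simp add: sum_distrib_left mult_ac)
      also have "\<dots> = X a" unfolding X_def A_def sum_distrib_right by (rule sum.swap)
      finally show ?thesis .
    qed
    have "grad (lap f) a = (\<Sum>j<n. G a j * ((\<Sum>b<n. A f b j * D b f) + (\<Sum>b<n. A f b j * D b f) - (lam * D j f + lam * D j f)))"
      unfolding grad_def by (intro sum.cong refl) (simp add: D_lap)
    also have "\<dots> = X a + X a - (lam * grad f a + lam * grad f a)"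
      unfolding right_diff_distrib distrib_left sum_subtractf sum.distrib 1
      by (simp add: grad_def sum_distrib_left mult_ac)
    finally show ?thesis .
  qed
  define trA2 where "trA2 = (\<Sum>i<n. \<Sum>c<n. A f i c * A f c i)"
  have DX: "(\<Sum>i<n. D i (X i)) + (\<Sum>i<n. \<Sum>p<n. \<Gamma> i i p * X p) = (\<Sum>c<n. div1 (A f) c * grad f c) + trA2"
  proof -
    have 1: "(\<Sum>i<n. \<Sum>p<n. \<Gamma> i i p * X p) = (\<Sum>c<n. (\<Sum>i<n. \<Sum>p<n. \<Gamma> i i p * A f p c) * grad f c)"
      (is "?l = ?r")
    proof -
      have "?l = (\<Sum>i<n. \<Sum>p<n. \<Sum>c<n. \<Gamma> i i p * A f p c * grad f c)"
        unfolding X_def by (simp add: sum_distrib_left mult_ac)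
      also have "\<dots> = (\<Sum>i<n. \<Sum>c<n. \<Sum>p<n. \<Gamma> i i p * A f p c * grad f c)"
        by (intro sum.cong refl sum.swap)
      also have "\<dots> = (\<Sum>c<n. \<Sum>i<n. \<Sum>p<n. \<Gamma> i i p * A f p c * grad f c)" by (rule sum.swap)
      also have "\<dots> = ?r" by (simp add: sum_distrib_right)
      finally show ?thesis .
    qed
    have 2: "(\<Sum>i<n. \<Sum>c<n. A f i c * (\<Sum>p<n. \<Gamma> c i p * grad f p)) = (\<Sum>c<n. (\<Sum>l<n. \<Sum>p<n. \<Gamma> p l c * A f l p) * grad f c)"
      (is "?l = ?r")
    proof -
      have "?l = (\<Sum>i<n. \<Sum>c<n. \<Sum>p<n. \<Gamma> c i p * A f i c * grad f p)"
        by (simp add: sum_distrib_left mult_ac)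
      also have "\<dots> = (\<Sum>i<n. \<Sum>p<n. \<Sum>c<n. \<Gamma> c i p * A f i c * grad f p)"
        by (intro sum.cong refl sum.swap)
      also have "\<dots> = (\<Sum>p<n. \<Sum>i<n. \<Sum>c<n. \<Gamma> c i p * A f i c * grad f p)" by (rule sum.swap)
      also have "\<dots> = ?r" by (simp add: sum_distrib_right)
      finally show ?thesis .
    qed
    have 3: "(\<Sum>i<n. \<Sum>c<n. D i (A f i c) * grad f c) = (\<Sum>c<n. (\<Sum>l<n. D l (A f l c)) * grad f c)"
      unfolding sum_distrib_right by (rule sum.swap)
    have "(\<Sum>i<n. D i (X i)) = (\<Sum>i<n. \<Sum>c<n. D i (A f i c) * grad f c) + trA2
        - (\<Sum>i<n. \<Sum>c<n. A f i c * (\<Sum>p<n. \<Gamma> c i p * grad f p))"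
      unfolding X_def trA2_def by (simp add: D_grad right_diff_distrib sum_subtractf sum.distrib)
    then show ?thesis
      unfolding 1 2 3 div1_def left_diff_distrib distrib_right sum_subtractf sum.distrib by simp
  qed
  have "(\<Sum>c<n. div1 (A f) c * grad f c) + (\<Sum>c<n. div1 (A f) c * grad f c) = ip f (lap f)"
    unfolding ip_def sum.distrib[symmetric] distrib_right[symmetric]
    by (intro sum.cong refl) (simp add: two_div_A mult.commute)
  moreover have "lap (lap f) = ((\<Sum>i<n. D i (X i)) + (\<Sum>i<n. \<Sum>p<n. \<Gamma> i i p * X p)) +
      ((\<Sum>i<n. D i (X i)) + (\<Sum>i<n. \<Sum>p<n. \<Gamma> i i p * X p)) - (lam * lap f + lam * lap f)"
  proof -
    have "D i (grad (lap f) i) = D i (X i) + D i (X i) - (lam * D i (grad f i) + lam * D i (grad f i))" for i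
    proof -
      have "D i (grad (lap f) i) = D i (X i) + D i (X i) - (D i (lam * grad f i) + D i (lam * grad f i))"
        unfolding gr by (simp only: D_diff D_add S_grad S_mult X_S S_add f_S lam_S)
      then show ?thesis by simp
    qed
    then have "lap (lap f) = (\<Sum>i<n. D i (X i) + D i (X i) - (lam * D i (grad f i) + lam * D i (grad f i)))
        + (\<Sum>i<n. \<Sum>p<n. \<Gamma> i i p * (X p + X p - (lam * grad f p + lam * grad f p)))"
      unfolding lap_vector[OF S_lap[OF f_S]] gr by simp
    also have "\<dots> = ((\<Sum>i<n. D i (X i)) + (\<Sum>i<n. \<Sum>p<n. \<Gamma> i i p * X p)) +
      ((\<Sum>i<n. D i (X i)) + (\<Sum>i<n. \<Sum>p<n. \<Gamma> i i p * X p))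
      - (lam * ((\<Sum>i<n. D i (grad f i)) + (\<Sum>i<n. \<Sum>p<n. \<Gamma> i i p * grad f p)) + lam * ((\<Sum>i<n. D i (grad f i)) + (\<Sum>i<n. \<Sum>p<n. \<Gamma> i i p * grad f p)))"
      by (simp add: algebra_simps sum.distrib sum_subtractf sum_distrib_left)
    finally show ?thesis unfolding lap_vector[OF f_S] .
  qed
  ultimately show ?thesis unfolding DX trA2_def[symmetric] by (simp add: algebra_simps)
qed

end

lemma chain_partial:
  assumes V: "openin (Euclidean_space m) V" and U: "openin (Euclidean_space n) U" and F: "smooth_on n U F"
    and \<tau>: "\<And>i. i < n \<Longrightarrow> smooth_on m V (\<lambda>x. \<tau> x i)" and im: "\<And>x. x \<in> V \<Longrightarrow> \<tau> x \<in> U"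
    and x: "x \<in> V" and a: "a < m"
  shows "((\<lambda>t. F (\<tau> (x(a := t)))) has_real_derivative
      (\<Sum>i<n. partial i F (\<tau> x) * partial a (\<lambda>x. \<tau> x i) x)) (at (x a))"
    and "partial a (\<lambda>x. F (\<tau> x)) x = (\<Sum>i<n. partial i F (\<tau> x) * partial a (\<lambda>x. \<tau> x i) x)"
proof -
  have "((\<lambda>t. F (\<tau> (x(a := t)))) has_real_derivative
      (\<Sum>i<n. partial i F (\<tau> (x(a := x a))) * partial a (\<lambda>x. \<tau> x i) x)) (at (x a))"
  proof (rule chain_rule[OF U F, where \<gamma> = "\<lambda>t. \<tau> (x(a := t))" and s = "x a"])
    show "\<tau> (x(a := x a)) \<in> U" using im[OF x] by simp
    show "((\<lambda>t. \<tau> (x(a := t)) i) has_real_derivative partial a (\<lambda>x. \<tau> x i) x) (at (x a))" if "i < n" for i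
      by (rule smooth_on_has_partial[OF \<tau>[OF that] a x])
    have "\<forall>\<^sub>F t in nhds (x a). \<tau> (x(a := t)) \<in> topspace (Euclidean_space n)"
      by (rule eventually_mono[OF eventually_upd_in[OF V x a]]) (rule openin_Euclidean_subset[OF U im])
    then show "\<forall>\<^sub>F t in at (x a). \<tau> (x(a := t)) \<in> topspace (Euclidean_space n)"
      unfolding eventually_at_filter by (rule eventually_mono) simp
  qed
  then show d: "((\<lambda>t. F (\<tau> (x(a := t)))) has_real_derivative
      (\<Sum>i<n. partial i F (\<tau> x) * partial a (\<lambda>x. \<tau> x i) x)) (at (x a))"
    by (simp only: fun_upd_triv)
  show "partial a (\<lambda>x. F (\<tau> x)) x = (\<Sum>i<n. partial i F (\<tau> x) * partial a (\<lambda>x. \<tau> x i) x)"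
    by (rule partialI[OF d])
qed

section \<open>Charts and tangent vectors\<close>

lemma is_chart_facts:
  assumes "is_chart T n c"
  shows "openin T (fst c)" "openin (Euclidean_space n) (snd c ` fst c)" "inj_on (snd c) (fst c)"
    "fst c \<subseteq> topspace T"
    "homeomorphic_map (subtopology T (fst c)) (subtopology (Euclidean_space n) (snd c ` fst c)) (snd c)"
proof -
  have o: "openin T (fst c)" and h: "homeomorphic_map (subtopology T (fst c)) (subtopology (Euclidean_space n) (snd c ` fst c)) (snd c)"
    using assms by (auto simp: is_chart_def)
  show "openin T (fst c)" by (rule o)
  show s: "fst c \<subseteq> topspace T" by (rule openin_subset[OF o])
  show "openin (Euclidean_space n) (snd c ` fst c)" using assms by (simp add: is_chart_def)
  have "topspace (subtopology T (fst c)) = fst c" using s by auto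
  then show "inj_on (snd c) (fst c)" using homeomorphic_imp_injective_map[OF h] by simp
qed (use assms in \<open>simp add: is_chart_def\<close>)

lemma chart_inv_left: "is_chart T n c \<Longrightarrow> p \<in> fst c \<Longrightarrow> chart_inv c (snd c p) = p"
  unfolding chart_inv_def by (rule inv_into_f_f[OF is_chart_facts(3)])

lemma chart_inv_right: "x \<in> snd c ` fst c \<Longrightarrow> snd c (chart_inv c x) = x"
  unfolding chart_inv_def by (rule f_inv_into_f)

lemma chart_inv_in: "x \<in> snd c ` fst c \<Longrightarrow> chart_inv c x \<in> fst c"
  unfolding chart_inv_def by (rule inv_into_into)

lemma chart_image_open:
  assumes "is_chart T n c" "openin T W"
  shows "openin (Euclidean_space n) (snd c ` (fst c \<inter> W))"
proof -
  note f = is_chart_facts[OF assms(1)]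
  have "openin (subtopology T (fst c)) (fst c \<inter> W)" using assms(2) by (rule openin_subtopology_Int2)
  then have "openin (subtopology (Euclidean_space n) (snd c ` fst c)) (snd c ` (fst c \<inter> W))"
    using homeomorphic_imp_open_map[OF f(5)] by (simp add: open_map_def)
  then show ?thesis using f(2) openin_trans_full by blast
qed

lemma chart_continuous_map:
  assumes "is_chart T n c" "continuous_map (subtopology (Euclidean_space n) (snd c ` fst c)) euclideanreal F"
  shows "continuous_map (subtopology T (fst c)) euclideanreal (\<lambda>p. F (snd c p))"
  using continuous_map_compose[OF homeomorphic_imp_continuous_map[OF is_chart_facts(5)[OF assms(1)]] assms(2)]
  by (simp add: o_def)

locale riemannian =
  fixes M :: "'a riem"
  assumes rm: "riemannian_manifold M"
begin

abbreviation "n \<equiv> rdim M"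

lemma chart: "c \<in> ratlas M \<Longrightarrow> is_chart (rtop M) n c"
  using rm by (simp add: riemannian_manifold_def smooth_manifold_def smooth_atlas_def)

lemma transition_smooth:
  "c \<in> ratlas M \<Longrightarrow> d \<in> ratlas M \<Longrightarrow> i < n \<Longrightarrow> smooth_on n (snd c ` (fst c \<inter> fst d)) (transition c d i)"
  using rm by (simp add: riemannian_manifold_def smooth_manifold_def smooth_atlas_def)

lemma atlas_cover: "p \<in> topspace (rtop M) \<Longrightarrow> \<exists>c\<in>ratlas M. p \<in> fst c"
proof -
  have "(\<Union>c\<in>ratlas M. fst c) = topspace (rtop M)"
    using rm by (simp add: riemannian_manifold_def smooth_manifold_def smooth_atlas_def)
  then show "p \<in> topspace (rtop M) \<Longrightarrow> \<exists>c\<in>ratlas M. p \<in> fst c" by blast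
qed

lemma chart_subset: "c \<in> ratlas M \<Longrightarrow> p \<in> fst c \<Longrightarrow> p \<in> topspace (rtop M)"
  using is_chart_facts(4)[OF chart] by blast

lemma chart_open: "c \<in> ratlas M \<Longrightarrow> openin (rtop M) (fst c)"
  by (rule is_chart_facts(1)[OF chart])

lemma smooth_nearE:
  assumes "smooth_near M p h" "c \<in> ratlas M" "p \<in> fst c"
  obtains W where "openin (rtop M) W" "p \<in> W" "openin (Euclidean_space n) (snd c ` (fst c \<inter> W))"
    "snd c p \<in> snd c ` (fst c \<inter> W)" "smooth_on n (snd c ` (fst c \<inter> W)) (h \<circ> chart_inv c)"
proof -
  obtain W where W: "openin (rtop M) W" "p \<in> W" "smooth_fun_on M W h"
    using assms(1) by (auto simp: smooth_near_def)
  show thesis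
    by (rule that[OF W(1,2) chart_image_open[OF chart[OF assms(2)] W(1)]])
      (use W assms in \<open>auto simp: smooth_fun_on_def\<close>)
qed

lemma smooth_fun_on_subset: "smooth_fun_on M W h \<Longrightarrow> W' \<subseteq> W \<Longrightarrow> smooth_fun_on M W' h"
  unfolding smooth_fun_on_def by (meson Int_mono image_mono order_refl smooth_on_subset)

lemma smooth_near_2:
  assumes "smooth_near M p h" "smooth_near M p k"
  obtains W where "openin (rtop M) W" "p \<in> W" "smooth_fun_on M W h" "smooth_fun_on M W k"
proof -
  obtain W1 W2 where W: "openin (rtop M) W1" "p \<in> W1" "smooth_fun_on M W1 h"
      "openin (rtop M) W2" "p \<in> W2" "smooth_fun_on M W2 k"
    using assms by (auto simp: smooth_near_def)
  show thesis
    by (rule that[of "W1 \<inter> W2"]) (use W smooth_fun_on_subset in \<open>auto intro: openin_Int\<close>)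
qed

lemma smooth_near_lin: "smooth_near M p h \<Longrightarrow> smooth_near M p k \<Longrightarrow> smooth_near M p (\<lambda>q. a * h q + b * k q)"
proof -
  assume "smooth_near M p h" "smooth_near M p k"
  then obtain W where W: "openin (rtop M) W" "p \<in> W" "smooth_fun_on M W h" "smooth_fun_on M W k"
    by (rule smooth_near_2)
  have "smooth_on n (snd c ` (fst c \<inter> W)) (\<lambda>x. a * (h \<circ> chart_inv c) x + b * (k \<circ> chart_inv c) x)" if "c \<in> ratlas M" for c
  proof -
    note U = chart_image_open[OF chart[OF that] W(1)]
    show ?thesis
      by (intro smooth_on_add[OF U] smooth_on_mult[OF U] smooth_on_const[OF U])
        (use W(3,4) that in \<open>simp_all add: smooth_fun_on_def o_def\<close>)
  qed
  then have "smooth_fun_on M W (\<lambda>q. a * h q + b * k q)" by (simp add: smooth_fun_on_def o_def)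
  then show ?thesis using W by (auto simp: smooth_near_def)
qed

lemma smooth_near_mult: "smooth_near M p h \<Longrightarrow> smooth_near M p k \<Longrightarrow> smooth_near M p (\<lambda>q. h q * k q)"
proof -
  assume "smooth_near M p h" "smooth_near M p k"
  then obtain W where W: "openin (rtop M) W" "p \<in> W" "smooth_fun_on M W h" "smooth_fun_on M W k"
    by (rule smooth_near_2)
  have "smooth_on n (snd c ` (fst c \<inter> W)) (\<lambda>x. (h \<circ> chart_inv c) x * (k \<circ> chart_inv c) x)" if "c \<in> ratlas M" for c
    by (rule smooth_on_mult[OF chart_image_open[OF chart[OF that] W(1)]])
      (use W(3,4) that in \<open>simp_all add: smooth_fun_on_def o_def\<close>)
  then have "smooth_fun_on M W (\<lambda>q. h q * k q)" by (simp add: smooth_fun_on_def o_def)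
  then show ?thesis using W by (auto simp: smooth_near_def)
qed

section \<open>Coordinate vectors and metric components\<close>

lemma coord_vec_tangent:
  assumes c: "c \<in> ratlas M" and p: "p \<in> fst c" and i: "i < n"
  shows "coord_vec M c i p \<in> tangent_space M p"
proof -
  have diff: "(\<lambda>t. (h \<circ> chart_inv c) ((snd c p)(i := t))) differentiable (at (snd c p i))" if h: "smooth_near M p h" for h
  proof -
    obtain W where W: "snd c p \<in> snd c ` (fst c \<inter> W)" "smooth_on n (snd c ` (fst c \<inter> W)) (h \<circ> chart_inv c)"
      by (rule smooth_nearE[OF h c p]) blast
    show ?thesis by (rule smooth_on_differentiable[OF W(2) i W(1)])
  qed
  have inv: "chart_inv c (snd c p) = p" by (rule chart_inv_left[OF chart[OF c] p])
  have lin: "coord_vec M c i p (\<lambda>q. a * h q + b * k q) = a * coord_vec M c i p h + b * coord_vec M c i p k"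
    if h: "smooth_near M p h" and k: "smooth_near M p k" for a b h k
  proof -
    have d: "((\<lambda>t. a * (h \<circ> chart_inv c) ((snd c p)(i := t)) + b * (k \<circ> chart_inv c) ((snd c p)(i := t))) has_real_derivative
       a * partial i (h \<circ> chart_inv c) (snd c p) + b * partial i (k \<circ> chart_inv c) (snd c p)) (at (snd c p i))"
      by (intro DERIV_add DERIV_cmult has_partial diff h k)
    have "partial i ((\<lambda>q. a * h q + b * k q) \<circ> chart_inv c) (snd c p) =
      a * partial i (h \<circ> chart_inv c) (snd c p) + b * partial i (k \<circ> chart_inv c) (snd c p)"
      by (rule partialI) (use d in \<open>simp only: o_def\<close>)
    then show ?thesis using h k smooth_near_lin[OF h k, of a b] by (simp add: coord_vec_def)
  qed
  have prod: "coord_vec M c i p (\<lambda>q. h q * k q) = h p * coord_vec M c i p k + k p * coord_vec M c i p h"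
    if h: "smooth_near M p h" and k: "smooth_near M p k" for h k
  proof -
    have d: "((\<lambda>t. (h \<circ> chart_inv c) ((snd c p)(i := t)) * (k \<circ> chart_inv c) ((snd c p)(i := t))) has_real_derivative
       partial i (h \<circ> chart_inv c) (snd c p) * (k \<circ> chart_inv c) ((snd c p)(i := snd c p i)) +
       partial i (k \<circ> chart_inv c) (snd c p) * (h \<circ> chart_inv c) ((snd c p)(i := snd c p i))) (at (snd c p i))"
      by (intro DERIV_mult has_partial diff h k)
    have "partial i ((\<lambda>q. h q * k q) \<circ> chart_inv c) (snd c p) =
      partial i (h \<circ> chart_inv c) (snd c p) * k p + partial i (k \<circ> chart_inv c) (snd c p) * h p"
      by (rule partialI) (use d in \<open>simp only: o_def fun_upd_triv inv\<close>)
    then show ?thesis using h k smooth_near_mult[OF h k] by (simp add: coord_vec_def mult.commute)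
  qed
  have loc: "coord_vec M c i p h = coord_vec M c i p k"
    if h: "smooth_near M p h" and k: "smooth_near M p k" and W: "openin (rtop M) W" "p \<in> W" "\<forall>q\<in>W. h q = k q" for h k W
  proof -
    have "partial i (h \<circ> chart_inv c) (snd c p) = partial i (k \<circ> chart_inv c) (snd c p)"
    proof (rule partial_cong[OF chart_image_open[OF chart[OF c] W(1)] _ i])
      show "snd c p \<in> snd c ` (fst c \<inter> W)" using p W by blast
      show "(h \<circ> chart_inv c) y = (k \<circ> chart_inv c) y" if "y \<in> snd c ` (fst c \<inter> W)" for y
        using that W(3) chart_inv_left[OF chart[OF c]] by auto
    qed
    then show ?thesis using h k by (simp add: coord_vec_def)
  qed
  show ?thesis
    unfolding tangent_space_def mem_Collect_eq
    by (intro conjI allI impI lin prod loc) (assumption | simp add: coord_vec_def)+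
qed

lemma coord_smooth_near:
  assumes c: "c \<in> ratlas M" and p: "p \<in> fst c" and j: "j < n"
  shows "smooth_near M p (\<lambda>q. snd c q j)"
proof -
  have "smooth_fun_on M (fst c) (\<lambda>q. snd c q j)"
    unfolding smooth_fun_on_def
  proof
    fix d assume d: "d \<in> ratlas M"
    have "(\<lambda>q. snd c q j) \<circ> chart_inv d = transition d c j" by (simp add: fun_eq_iff transition_def)
    then show "smooth_on n (snd d ` (fst d \<inter> fst c)) ((\<lambda>q. snd c q j) \<circ> chart_inv d)"
      using transition_smooth[OF d c j] by simp
  qed
  then show ?thesis using chart_open[OF c] p by (auto simp: smooth_near_def)
qed

text \<open>Duality with the coordinate functions is what shows the coordinate vectors to be
  linearly independent.\<close>

lemma coord_vec_coord:
  assumes c: "c \<in> ratlas M" and p: "p \<in> fst c" and i: "i < n" and j: "j < n"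
  shows "coord_vec M c i p (\<lambda>q. snd c q j) = (if i = j then 1 else 0)"
proof -
  have "partial i ((\<lambda>q. snd c q j) \<circ> chart_inv c) (snd c p) = partial i (\<lambda>x. x j) (snd c p)"
    by (rule partial_cong[OF is_chart_facts(2)[OF chart[OF c]] imageI[OF p] i])
      (simp add: chart_inv_right)
  then show ?thesis using coord_smooth_near[OF c p j] by (simp add: coord_vec_def partial_coord)
qed

lemma tangent_lin:
  assumes "u \<in> tangent_space M p" "v \<in> tangent_space M p"
  shows "(\<lambda>h. a * u h + b * v h) \<in> tangent_space M p"
proof -
  note A = assms(1)[unfolded tangent_space_def mem_Collect_eq] and B = assms(2)[unfolded tangent_space_def mem_Collect_eq]
  show ?thesis
    unfolding tangent_space_def mem_Collect_eq
  proof (intro conjI allI impI)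
    fix f h a' b' assume s: "smooth_near M p f" "smooth_near M p h"
    have "u (\<lambda>q. a' * f q + b' * h q) = a' * u f + b' * u h" "v (\<lambda>q. a' * f q + b' * h q) = a' * v f + b' * v h"
      by (rule A[THEN conjunct1, rule_format, OF s] B[THEN conjunct1, rule_format, OF s])+
    then show "a * u (\<lambda>q. a' * f q + b' * h q) + b * v (\<lambda>q. a' * f q + b' * h q) = a' * (a * u f + b * v f) + b' * (a * u h + b * v h)"
      by (simp add: algebra_simps)
  next
    fix f h assume s: "smooth_near M p f" "smooth_near M p h"
    have "u (\<lambda>q. f q * h q) = f p * u h + h p * u f" "v (\<lambda>q. f q * h q) = f p * v h + h p * v f"
      by (rule A[THEN conjunct2, THEN conjunct1, rule_format, OF s] B[THEN conjunct2, THEN conjunct1, rule_format, OF s])+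
    then show "a * u (\<lambda>q. f q * h q) + b * v (\<lambda>q. f q * h q) = f p * (a * u h + b * v h) + h p * (a * u f + b * v f)"
      by (simp add: algebra_simps)
  next
    fix f h W assume s: "smooth_near M p f" "smooth_near M p h" "openin (rtop M) W" "p \<in> W" "\<forall>q\<in>W. f q = h q"
    then have W: "\<And>q. q \<in> W \<Longrightarrow> f q = h q" by blast
    have "u f = u h" "v f = v h"
      by (rule A[THEN conjunct2, THEN conjunct2, THEN conjunct1, rule_format, OF s(1-4) W]
          B[THEN conjunct2, THEN conjunct2, THEN conjunct1, rule_format, OF s(1-4) W], assumption)+
    then show "a * u f + b * v f = a * u h + b * v h" by simp
  next
    fix f assume s: "\<not> smooth_near M p f"
    have "u f = 0" "v f = 0"
      by (rule A[THEN conjunct2, THEN conjunct2, THEN conjunct2, rule_format, OF s]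
          B[THEN conjunct2, THEN conjunct2, THEN conjunct2, rule_format, OF s])+
    then show "a * u f + b * v f = 0" by simp
  qed
qed

lemma tangent_zero: "(\<lambda>h. 0) \<in> tangent_space M p"
  by (simp add: tangent_space_def)

lemma tangent_sum:
  fixes m :: nat
  shows "(\<And>i. i < m \<Longrightarrow> u i \<in> tangent_space M p) \<Longrightarrow> (\<lambda>h. \<Sum>i<m. \<alpha> i * u i h) \<in> tangent_space M p"
proof (induction m)
  case 0
  then show ?case by (simp add: tangent_zero)
next
  case (Suc m)
  have "(\<lambda>h. 1 * (\<Sum>i<m. \<alpha> i * u i h) + \<alpha> m * u m h) \<in> tangent_space M p"
    by (rule tangent_lin) (use Suc in auto)
  then show ?case by simp
qed

lemma inner_at: "p \<in> topspace (rtop M) \<Longrightarrow> inner_product_at M p"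
  using rm by (simp add: riemannian_manifold_def)

lemma rmetric_lin:
  assumes p: "p \<in> topspace (rtop M)" and u: "u \<in> tangent_space M p" and v: "v \<in> tangent_space M p" and w: "w \<in> tangent_space M p"
  shows "rmetric M p (\<lambda>f. a * u f + b * v f) w = a * rmetric M p u w + b * rmetric M p v w"
  by (rule inner_at[OF p, unfolded inner_product_at_def, THEN conjunct1, THEN bspec, OF u, THEN bspec, OF v,
        THEN bspec, OF w, THEN spec, THEN spec])

lemma rmetric_sym:
  assumes p: "p \<in> topspace (rtop M)" and u: "u \<in> tangent_space M p" and v: "v \<in> tangent_space M p"
  shows "rmetric M p u v = rmetric M p v u"
  by (rule inner_at[OF p, unfolded inner_product_at_def, THEN conjunct2, THEN conjunct1, THEN bspec, OF u, THEN bspec, OF v])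

lemma rmetric_pos:
  assumes p: "p \<in> topspace (rtop M)" and v: "v \<in> tangent_space M p" and nz: "v \<noteq> (\<lambda>_. 0)"
  shows "rmetric M p v v > 0"
  by (rule inner_at[OF p, unfolded inner_product_at_def, THEN conjunct2, THEN conjunct2, THEN bspec, OF v, THEN mp, OF nz])

lemma rmetric_sum:
  fixes m :: nat
  assumes p: "p \<in> topspace (rtop M)" and w: "w \<in> tangent_space M p"
  shows "(\<And>i. i < m \<Longrightarrow> u i \<in> tangent_space M p) \<Longrightarrow>
    rmetric M p (\<lambda>h. \<Sum>i<m. \<alpha> i * u i h) w = (\<Sum>i<m. \<alpha> i * rmetric M p (u i) w)"
proof (induction m)
  case 0
  \<comment> \<open>The zero vector arises by taking both coefficients equal to 0.\<close>
  show ?case using rmetric_lin[OF p w w w, of 0 0] by simp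
next
  case (Suc m)
  have u: "u i \<in> tangent_space M p" if "i < Suc m" for i by (rule Suc.prems[OF that])
  have T: "(\<lambda>h. \<Sum>i<m. \<alpha> i * u i h) \<in> tangent_space M p" by (rule tangent_sum) (rule u, simp)
  have "rmetric M p (\<lambda>h. 1 * (\<Sum>i<m. \<alpha> i * u i h) + \<alpha> m * u m h) w
      = 1 * rmetric M p (\<lambda>h. \<Sum>i<m. \<alpha> i * u i h) w + \<alpha> m * rmetric M p (u m) w"
    by (rule rmetric_lin[OF p T u[OF lessI] w])
  moreover have "rmetric M p (\<lambda>h. \<Sum>i<m. \<alpha> i * u i h) w = (\<Sum>i<m. \<alpha> i * rmetric M p (u i) w)"
    by (rule Suc.IH) (rule u, simp)
  ultimately show ?case by (simp only: mult_1 sum.lessThan_Suc)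
qed

lemma rmetric_sum2:
  fixes m :: nat
  assumes p: "p \<in> topspace (rtop M)" and u: "\<And>i. i < m \<Longrightarrow> u i \<in> tangent_space M p"
  shows "rmetric M p (\<lambda>h. \<Sum>i<m. \<alpha> i * u i h) (\<lambda>h. \<Sum>j<m. \<beta> j * u j h)
    = (\<Sum>i<m. \<Sum>j<m. \<alpha> i * \<beta> j * rmetric M p (u i) (u j))"
proof -
  have T: "(\<lambda>h. \<Sum>j<m. \<beta> j * u j h) \<in> tangent_space M p" by (rule tangent_sum[OF u])
  have *: "rmetric M p (u i) (\<lambda>h. \<Sum>j<m. \<beta> j * u j h) = (\<Sum>j<m. \<beta> j * rmetric M p (u i) (u j))" if i: "i < m" for i
  proof -
    have "rmetric M p (u i) (\<lambda>h. \<Sum>j<m. \<beta> j * u j h) = rmetric M p (\<lambda>h. \<Sum>j<m. \<beta> j * u j h) (u i)"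
      by (rule rmetric_sym[OF p u[OF i] T])
    also have "\<dots> = (\<Sum>j<m. \<beta> j * rmetric M p (u j) (u i))" by (rule rmetric_sum[OF p u[OF i] u])
    also have "\<dots> = (\<Sum>j<m. \<beta> j * rmetric M p (u i) (u j))"
    proof (rule sum.cong[OF refl])
      fix j assume "j \<in> {..<m}"
      then have j: "j < m" by simp
      show "\<beta> j * rmetric M p (u j) (u i) = \<beta> j * rmetric M p (u i) (u j)"
        by (simp only: rmetric_sym[OF p u[OF j] u[OF i]])
    qed
    finally show ?thesis .
  qed
  have "rmetric M p (\<lambda>h. \<Sum>i<m. \<alpha> i * u i h) (\<lambda>h. \<Sum>j<m. \<beta> j * u j h)
      = (\<Sum>i<m. \<alpha> i * rmetric M p (u i) (\<lambda>h. \<Sum>j<m. \<beta> j * u j h))" by (rule rmetric_sum[OF p T u])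
  also have "\<dots> = (\<Sum>i<m. \<alpha> i * (\<Sum>j<m. \<beta> j * rmetric M p (u i) (u j)))"
    by (intro sum.cong refl) (simp only: * lessThan_iff)
  finally show ?thesis by (simp add: sum_distrib_left mult.assoc)
qed

lemma coord_vec_transform:
  assumes c: "c \<in> ratlas M" and d: "d \<in> ratlas M" and p: "p \<in> fst c" "p \<in> fst d" and a: "a < n"
  shows "coord_vec M d a p = (\<lambda>h. \<Sum>i<n. partial a (transition d c i) (snd d p) * coord_vec M c i p h)"
proof
  fix h
  show "coord_vec M d a p h = (\<Sum>i<n. partial a (transition d c i) (snd d p) * coord_vec M c i p h)"
  proof (cases "smooth_near M p h")
    case True
    obtain W where W: "openin (rtop M) W" "p \<in> W" "openin (Euclidean_space n) (snd c ` (fst c \<inter> W))"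
        "smooth_on n (snd c ` (fst c \<inter> W)) (h \<circ> chart_inv c)"
      by (rule smooth_nearE[OF True c p(1)]) blast
    define V where "V = snd d ` (fst d \<inter> (fst c \<inter> W))"
    have V: "openin (Euclidean_space n) V"
      unfolding V_def using W chart_open[OF c] by (intro chart_image_open[OF chart[OF d]] openin_Int)
    have pV: "snd d p \<in> V" using p W by (auto simp: V_def)
    let ?\<tau> = "\<lambda>x i. transition d c i x"
    have \<tau>: "?\<tau> x = snd c (chart_inv d x)" for x by (simp add: transition_def fun_eq_iff)
    have dinv: "chart_inv d (snd d q) = q" if "q \<in> fst d" for q by (rule chart_inv_left[OF chart[OF d] that])
    have cinv: "chart_inv c (snd c q) = q" if "q \<in> fst c" for q by (rule chart_inv_left[OF chart[OF c] that])
    have "partial a (\<lambda>x. (h \<circ> chart_inv c) (?\<tau> x)) (snd d p)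
        = (\<Sum>i<n. partial i (h \<circ> chart_inv c) (?\<tau> (snd d p)) * partial a (\<lambda>x. ?\<tau> x i) (snd d p))"
    proof (rule chain_partial(2)[OF V W(3,4) _ _ pV a])
      show "smooth_on n V (\<lambda>x. ?\<tau> x i)" if "i < n" for i
        by (rule smooth_on_subset[OF transition_smooth[OF d c that]]) (auto simp: V_def)
      show "?\<tau> x \<in> snd c ` (fst c \<inter> W)" if "x \<in> V" for x
        using that dinv unfolding \<tau> V_def by auto
    qed
    moreover have "partial a (h \<circ> chart_inv d) (snd d p) = partial a (\<lambda>x. (h \<circ> chart_inv c) (?\<tau> x)) (snd d p)"
      by (rule partial_cong[OF V pV a]) (auto simp: \<tau> V_def dinv cinv)
    moreover have "?\<tau> (snd d p) = snd c p" using p(2) by (simp only: \<tau> dinv)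
    ultimately show ?thesis using True by (simp add: coord_vec_def mult.commute)
  qed (simp add: coord_vec_def)
qed

lemma gcomp_sym:
  assumes c: "c \<in> ratlas M" and x: "x \<in> snd c ` fst c" and "i < n" "j < n"
  shows "gcomp M c i j x = gcomp M c j i x"
  unfolding gcomp_def
  by (intro rmetric_sym chart_subset[OF c] coord_vec_tangent[OF c] chart_inv_in[OF x] assms)

lemma gcomp_transform:
  assumes c: "c \<in> ratlas M" and d: "d \<in> ratlas M" and x: "x \<in> snd d ` (fst d \<inter> fst c)" and ab: "a < n" "b < n"
  shows "gcomp M d a b x = (\<Sum>i<n. \<Sum>j<n. partial a (transition d c i) x * partial b (transition d c j) x *
      gcomp M c i j (snd c (chart_inv d x)))"
proof -
  obtain p where p: "p \<in> fst d" "p \<in> fst c" "x = snd d p" using x by auto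
  have inv: "chart_inv d x = p" "chart_inv c (snd c p) = p"
    using chart_inv_left[OF chart] c d p by auto
  show ?thesis
    unfolding gcomp_def inv unfolding coord_vec_transform[OF c d p(2,1) ab(1)] coord_vec_transform[OF c d p(2,1) ab(2)] p(3)[symmetric]
    by (rule rmetric_sum2[OF chart_subset[OF c p(2)] coord_vec_tangent[OF c p(2)]])
qed

text \<open>The combination of coordinate vectors is a nonzero tangent vector, because applying it
  to the \<open>k\<close>-th coordinate function returns \<xi> k.\<close>

lemma gcomp_pos:
  assumes c: "c \<in> ratlas M" and x: "x \<in> snd c ` fst c" and ne: "\<exists>i<n. \<xi> i \<noteq> 0"
  shows "(\<Sum>i<n. \<Sum>j<n. \<xi> i * \<xi> j * gcomp M c i j x) > 0"
proof -
  let ?p = "chart_inv c x"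
  have p: "?p \<in> fst c" "?p \<in> topspace (rtop M)" using chart_inv_in[OF x] chart_subset[OF c] by auto
  have t: "coord_vec M c i ?p \<in> tangent_space M ?p" if "i < n" for i by (rule coord_vec_tangent[OF c p(1) that])
  obtain k where k: "k < n" "\<xi> k \<noteq> 0" using ne by blast
  have "(\<Sum>i<n. \<xi> i * coord_vec M c i ?p (\<lambda>q. snd c q k)) = (\<Sum>i<n. \<xi> i * (if i = k then 1 else 0))"
    by (intro sum.cong refl) (simp add: coord_vec_coord[OF c p(1) _ k(1)])
  also have "\<dots> = \<xi> k" using k by (simp add: if_distrib sum.delta cong: if_cong)
  finally have "(\<lambda>h. \<Sum>i<n. \<xi> i * coord_vec M c i ?p h) \<noteq> (\<lambda>_. 0)" using k by metis
  then have "rmetric M ?p (\<lambda>h. \<Sum>i<n. \<xi> i * coord_vec M c i ?p h) (\<lambda>h. \<Sum>i<n. \<xi> i * coord_vec M c i ?p h) > 0"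
    by (intro rmetric_pos[OF p(2)] tangent_sum t)
  moreover have "rmetric M ?p (\<lambda>h. \<Sum>i<n. \<xi> i * coord_vec M c i ?p h) (\<lambda>h. \<Sum>i<n. \<xi> i * coord_vec M c i ?p h)
      = (\<Sum>i<n. \<Sum>j<n. \<xi> i * \<xi> j * rmetric M ?p (coord_vec M c i ?p) (coord_vec M c j ?p))"
    by (rule rmetric_sum2[OF p(2) t])
  ultimately show ?thesis by (simp only: gcomp_def)
qed

lemma gcomp_smooth: "c \<in> ratlas M \<Longrightarrow> i < n \<Longrightarrow> j < n \<Longrightarrow> smooth_on n (snd c ` fst c) (gcomp M c i j)"
  using rm by (simp add: riemannian_manifold_def)

definition gmat :: "'a chart \<Rightarrow> (nat \<Rightarrow> real) \<Rightarrow> real mat" where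
  "gmat c x = mat n n (\<lambda>(i, j). gcomp M c i j x)"

lemma gmat_carrier [simp]: "gmat c x \<in> carrier_mat n n"
  by (simp add: gmat_def)

text \<open>A kernel vector of the Gram matrix would have length 0, against
  \<open>gcomp_pos\<close>.\<close>

lemma det_gmat:
  assumes c: "c \<in> ratlas M" and x: "x \<in> snd c ` fst c"
  shows "Determinant.det (gmat c x) \<noteq> 0"
proof
  assume "Determinant.det (gmat c x) = 0"
  then obtain v where v: "v \<in> carrier_vec n" "v \<noteq> 0\<^sub>v n" "gmat c x *\<^sub>v v = 0\<^sub>v n"
    using det_0_iff_vec_prod_zero_field[OF gmat_carrier] by blast
  have ne: "\<exists>i<n. vec_index v i \<noteq> 0"
  proof (rule ccontr)
    assume "\<not> ?thesis"
    then have "v = 0\<^sub>v n" using v(1) by (intro eq_vecI) auto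
    then show False using v(2) by blast
  qed
  have "(\<Sum>j<n. gcomp M c i j x * vec_index v j) = 0" if "i < n" for i
  proof -
    have "vec_index (gmat c x *\<^sub>v v) i = (\<Sum>j<n. gcomp M c i j x * vec_index v j)"
      using that v(1) by (auto simp: gmat_def scalar_prod_def lessThan_atLeast0 intro!: sum.cong)
    then show ?thesis using v(3) that by simp
  qed
  then have "(\<Sum>i<n. vec_index v i * (\<Sum>j<n. gcomp M c i j x * vec_index v j)) = 0" by simp
  moreover have "(\<Sum>i<n. vec_index v i * (\<Sum>j<n. gcomp M c i j x * vec_index v j)) = (\<Sum>i<n. \<Sum>j<n. vec_index v i * vec_index v j * gcomp M c i j x)"
    by (simp add: sum_distrib_left mult_ac)
  ultimately show False using gcomp_pos[OF c x ne] by simp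
qed

lemma ginv_mat:
  assumes c: "c \<in> ratlas M" and x: "x \<in> snd c ` fst c"
  shows "ginv_mat M c x \<in> carrier_mat n n" "ginv_mat M c x * gmat c x = 1\<^sub>m n" "gmat c x * ginv_mat M c x = 1\<^sub>m n"
proof -
  have "mat_inverse (gmat c x) \<noteq> None"
    \<comment> \<open>\<open>()\<close> is an arbitrary choice for the extension field of the matrix
      ring record.\<close>
    using mat_inverse(1)[OF gmat_carrier, of c x "()"] det_non_zero_imp_unit[OF gmat_carrier det_gmat[OF c x], of "()"] by blast
  then obtain B where B: "mat_inverse (gmat c x) = Some B" by blast
  have "ginv_mat M c x = B" using B by (simp add: ginv_mat_def gmat_def)
  then show "ginv_mat M c x \<in> carrier_mat n n" "ginv_mat M c x * gmat c x = 1\<^sub>m n" "gmat c x * ginv_mat M c x = 1\<^sub>m n"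
    using mat_inverse(2)[OF gmat_carrier B] by auto
qed

lemma ginv_g:
  assumes c: "c \<in> ratlas M" and x: "x \<in> snd c ` fst c" and ik: "i < n" "k < n"
  shows "(\<Sum>j<n. ginv_mat M c x $$ (i, j) * gcomp M c j k x) = (if i = k then 1 else 0)"
    and "(\<Sum>j<n. gcomp M c i j x * ginv_mat M c x $$ (j, k)) = (if i = k then 1 else 0)"
proof -
  note g = ginv_mat[OF c x]
  have "(ginv_mat M c x * gmat c x) $$ (i, k) = (\<Sum>j<n. ginv_mat M c x $$ (i, j) * gcomp M c j k x)"
    using g(1) ik by (auto simp: times_mat_def scalar_prod_def gmat_def lessThan_atLeast0 intro!: sum.cong)
  then show "(\<Sum>j<n. ginv_mat M c x $$ (i, j) * gcomp M c j k x) = (if i = k then 1 else 0)"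
    using g(2) ik by simp
  have "(gmat c x * ginv_mat M c x) $$ (i, k) = (\<Sum>j<n. gcomp M c i j x * ginv_mat M c x $$ (j, k))"
    using g(1) ik by (auto simp: times_mat_def scalar_prod_def gmat_def lessThan_atLeast0 intro!: sum.cong)
  then show "(\<Sum>j<n. gcomp M c i j x * ginv_mat M c x $$ (j, k)) = (if i = k then 1 else 0)"
    using g(3) ik by simp
qed

end

text \<open>a = a (g b) = (a g) b = b. It gives both the symmetry of the inverse metric and its
  transformation law.\<close>

lemma inverse_unique_index:
  fixes a b g :: "nat \<Rightarrow> nat \<Rightarrow> real"
  assumes "\<And>i k. i < n \<Longrightarrow> k < n \<Longrightarrow> (\<Sum>j<n. a i j * g j k) = (if i = k then 1 else 0)"
    and "\<And>i k. i < n \<Longrightarrow> k < n \<Longrightarrow> (\<Sum>j<n. g i j * b j k) = (if i = k then 1 else 0)"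
    and "i < n" "k < n"
  shows "a i k = b i k"
proof -
  have "a i k = (\<Sum>j<n. a i j * (if j = k then 1 else 0))"
    using assms(4) by (simp add: if_distrib sum.delta cong: if_cong)
  also have "\<dots> = (\<Sum>j<n. a i j * (\<Sum>l<n. g j l * b l k))"
    using assms(2,4) by (intro sum.cong refl) simp
  also have "\<dots> = (\<Sum>l<n. (\<Sum>j<n. a i j * g j l) * b l k)"
    unfolding sum_distrib_left sum_distrib_right by (subst sum.swap) (simp add: mult.assoc)
  also have "\<dots> = (\<Sum>l<n. (if i = l then 1 else 0) * b l k)"
    using assms(1,3) by (intro sum.cong refl) simp
  also have "\<dots> = b i k" using assms(3) by (simp add: if_distribR if_distrib sum.delta cong: if_cong)
  finally show ?thesis .
qed

context riemannian
begin

lemma ginv_sym: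
  assumes c: "c \<in> ratlas M" and x: "x \<in> snd c ` fst c" and ij: "i < n" "j < n"
  shows "ginv_mat M c x $$ (i, j) = ginv_mat M c x $$ (j, i)"
proof (rule inverse_unique_index[where a = "\<lambda>i j. ginv_mat M c x $$ (i, j)" and b = "\<lambda>i j. ginv_mat M c x $$ (j, i)"
      and g = "\<lambda>i j. gcomp M c i j x" and n = n])
  show "(\<Sum>j<n. gcomp M c i j x * ginv_mat M c x $$ (k, j)) = (if i = k then 1 else 0)" if "i < n" "k < n" for i k
  proof -
    have "(\<Sum>j<n. gcomp M c i j x * ginv_mat M c x $$ (k, j)) = (\<Sum>j<n. ginv_mat M c x $$ (k, j) * gcomp M c j i x)"
      using gcomp_sym[OF c x] that by (intro sum.cong refl) simp
    then show ?thesis using ginv_g(1)[OF c x that(2,1)] by auto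
  qed
qed (use ij ginv_g(1)[OF c x] in auto)

end

lemma smooth_on_det:
  assumes U: "openin (Euclidean_space n) U" and a: "\<And>i j. i < m \<Longrightarrow> j < m \<Longrightarrow> smooth_on n U (a i j)"
  shows "smooth_on n U (\<lambda>x. Determinant.det (mat m m (\<lambda>(i, j). a i j x)))"
proof -
  have "smooth_on n U (\<lambda>x. \<Sum>p\<in>{p. p permutes {0..<m}}. signof p * (\<Prod>i = 0..<m. a i (p i) x))"
    using a by (intro smooth_on_sum[OF U] smooth_on_mult[OF U] smooth_on_const[OF U] smooth_on_prod[OF U])
      (auto dest: permutes_in_image)
  moreover have "(\<Sum>p\<in>{p. p permutes {0..<m}}. signof p * (\<Prod>i = 0..<m. a i (p i) x))
      = Determinant.det (mat m m (\<lambda>(i, j). a i j x))" for x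
    by (subst det_def'[of _ m]) (auto intro!: sum.cong prod.cong dest: permutes_in_image)
  ultimately show ?thesis by simp
qed

context riemannian
begin

text \<open>By Cramer's rule the entries are cofactors divided by the determinant, and determinants
  are polynomial in the entries.\<close>

lemma ginv_smooth:
  assumes c: "c \<in> ratlas M" and ij: "i < n" "j < n"
  shows "smooth_on n (snd c ` fst c) (\<lambda>x. ginv_mat M c x $$ (i, j))"
proof -
  have U: "openin (Euclidean_space n) (snd c ` fst c)" by (rule is_chart_facts(2)[OF chart[OF c]])
  have adj: "ginv_mat M c x $$ (i, j) = cofactor (gmat c x) j i * inverse (Determinant.det (gmat c x))"
    if x: "x \<in> snd c ` fst c" for x
  proof -
    have "ginv_mat M c x * (gmat c x * adj_mat (gmat c x)) = ginv_mat M c x * (Determinant.det (gmat c x) \<cdot>\<^sub>m 1\<^sub>m n)"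
      using adj_mat(2)[OF gmat_carrier, of c x] by simp
    moreover have "ginv_mat M c x * (gmat c x * adj_mat (gmat c x)) = adj_mat (gmat c x)"
      using ginv_mat[OF c x] adj_mat(1)[OF gmat_carrier, of c x]
      by (subst assoc_mult_mat[symmetric, of _ n n _ n _ n]) auto
    moreover have "ginv_mat M c x * (Determinant.det (gmat c x) \<cdot>\<^sub>m 1\<^sub>m n) = Determinant.det (gmat c x) \<cdot>\<^sub>m ginv_mat M c x"
      using ginv_mat(1)[OF c x] by (subst mult_smult_distrib[of _ n n _ n]) auto
    ultimately have "adj_mat (gmat c x) $$ (i, j) = (Determinant.det (gmat c x) \<cdot>\<^sub>m ginv_mat M c x) $$ (i, j)" by simp
    then show ?thesis
      using ij ginv_mat(1)[OF c x] det_gmat[OF c x] by (simp add: adj_mat_def gmat_def[of c x] field_simps)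
  qed
  have d1: "smooth_on n (snd c ` fst c) (\<lambda>x. Determinant.det (gmat c x))"
    unfolding gmat_def by (rule smooth_on_det[OF U gcomp_smooth[OF c]])
  let ?s = "\<lambda>k k'. if k' < k then k' else Suc k'"
  have "mat_delete (gmat c x) j i = mat (n - 1) (n - 1) (\<lambda>(i', j'). gcomp M c (?s j i') (?s i j') x)" for x
    unfolding mat_delete_def gmat_def by (rule eq_matI) auto
  moreover have "smooth_on n (snd c ` fst c) (\<lambda>x. Determinant.det (mat (n - 1) (n - 1) (\<lambda>(i', j'). gcomp M c (?s j i') (?s i j') x)))"
    by (rule smooth_on_det[OF U gcomp_smooth[OF c]]) auto
  ultimately have "smooth_on n (snd c ` fst c) (\<lambda>x. cofactor (gmat c x) j i)"
    unfolding cofactor_def by (intro smooth_on_mult[OF U] smooth_on_const[OF U]) simp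
  then have "smooth_on n (snd c ` fst c) (\<lambda>x. cofactor (gmat c x) j i * inverse (Determinant.det (gmat c x)))"
    by (intro smooth_on_mult[OF U] smooth_on_inverse[OF U] d1 det_gmat[OF c])
  then show ?thesis by (rule smooth_on_cong[OF U]) (simp add: adj)
qed

end

section \<open>Quadratic forms and traces\<close>

text \<open>Induction by Schur complements: splitting off the last column of \<open>G\<close> writes
  it as a positive semidefinite matrix of smaller size plus a rank-one matrix divided by the corner
  entry. The rank-one part contributes a value of the form \<open>H\<close>.\<close>

lemma trace_psd_nsd_nonpos:
  fixes G H :: "nat \<Rightarrow> nat \<Rightarrow> real"
  assumes "\<And>i j. i < n \<Longrightarrow> j < n \<Longrightarrow> G i j = G j i"
    and "\<And>\<xi>. (\<Sum>i<n. \<Sum>j<n. \<xi> i * \<xi> j * G i j) \<ge> 0"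
    and "\<And>\<xi>. (\<Sum>i<n. \<Sum>j<n. \<xi> i * \<xi> j * H i j) \<le> 0"
  shows "(\<Sum>i<n. \<Sum>j<n. G i j * H i j) \<le> 0"
  using assms
proof (induction n arbitrary: G)
  case (Suc m)
  have split: "(\<Sum>i<Suc m. \<Sum>j<Suc m. F i j) = (\<Sum>i<m. \<Sum>j<m. F i j) + (\<Sum>i<m. F i m) + (\<Sum>j<m. F m j) + F m m"
    for F :: "nat \<Rightarrow> nat \<Rightarrow> real"
    by (simp add: sum.distrib)
  define a where "a = G m m"
  have Gm: "G m j = G j m" if "j < m" for j using Suc.prems(1)[of m j] that by simp
  have form: "(\<Sum>i<Suc m. \<Sum>j<Suc m. \<xi> i * \<xi> j * G i j) = (\<Sum>i<m. \<Sum>j<m. \<xi> i * \<xi> j * G i j)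
      + 2 * \<xi> m * (\<Sum>i<m. \<xi> i * G i m) + \<xi> m * \<xi> m * a" for \<xi>
  proof -
    have "(\<Sum>j<m. \<xi> m * \<xi> j * G m j) = \<xi> m * (\<Sum>i<m. \<xi> i * G i m)"
      "(\<Sum>i<m. \<xi> i * \<xi> m * G i m) = \<xi> m * (\<Sum>i<m. \<xi> i * G i m)"
      by (simp_all add: sum_distrib_left Gm mult_ac)
    then show ?thesis unfolding split a_def by simp
  qed
  have Hm: "(\<Sum>i<m. \<Sum>j<m. \<xi> i * \<xi> j * H i j) \<le> 0" for \<xi>
    using Suc.prems(3)[of "\<lambda>i. if i < m then \<xi> i else 0"] unfolding split by simp
  have a0: "a \<ge> 0"
    using Suc.prems(2)[of "\<lambda>i. if i = m then 1 else 0"] unfolding form by simp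
  \<comment> \<open>For \<open>a = 0\<close> division returns 0, so \<open>G' = G\<close> on the
    smaller block; positivity then forces the last column to vanish, which is shown below.\<close>
  define G' where "G' i j = G i j - G i m * G j m / a" for i j
  have "(\<Sum>i<m. \<Sum>j<m. G' i j * H i j) \<le> 0"
  proof (rule Suc.IH)
    show "G' i j = G' j i" if "i < m" "j < m" for i j
      using Suc.prems(1)[of i j] that by (simp add: G'_def)
    show "(\<Sum>i<m. \<Sum>j<m. \<xi> i * \<xi> j * G' i j) \<ge> 0" for \<xi>
    proof -
      define s where "s = (\<Sum>i<m. \<xi> i * G i m)"
      have "(\<Sum>i<m. \<Sum>j<m. \<xi> i * \<xi> j * (G i m * G j m)) = s * s"
        unfolding s_def sum_product by (simp add: mult_ac)
      then have 1: "(\<Sum>i<m. \<Sum>j<m. \<xi> i * \<xi> j * G' i j) = (\<Sum>i<m. \<Sum>j<m. \<xi> i * \<xi> j * G i j) - s * s / a"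
        unfolding G'_def by (simp add: right_diff_distrib sum_subtractf sum_divide_distrib[symmetric])
      \<comment> \<open>The last coordinate minimises the form, so that completing the square gives
        the value of \<open>G'\<close>.\<close>
      define \<eta> where "\<eta> i = (if i < m then \<xi> i else - s / a)" for i
      have "(\<Sum>i<m. \<Sum>j<m. \<eta> i * \<eta> j * G i j) = (\<Sum>i<m. \<Sum>j<m. \<xi> i * \<xi> j * G i j)" "(\<Sum>i<m. \<eta> i * G i m) = s" "\<eta> m = - s / a"
        by (simp_all add: \<eta>_def s_def)
      then have "0 \<le> (\<Sum>i<m. \<Sum>j<m. \<xi> i * \<xi> j * G i j) + 2 * (- s / a) * s + (- s / a) * (- s / a) * a"
        using Suc.prems(2)[of \<eta>] unfolding form by simp
      also have "\<dots> = (\<Sum>i<m. \<Sum>j<m. \<xi> i * \<xi> j * G' i j)"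
        unfolding 1 by (cases "a = 0") (simp_all add: field_simps)
      finally show ?thesis .
    qed
  qed (rule Hm)
  moreover have "(\<Sum>i<Suc m. \<Sum>j<Suc m. G i j * H i j) = (\<Sum>i<m. \<Sum>j<m. G' i j * H i j)
      + (\<Sum>i<Suc m. \<Sum>j<Suc m. G i m * G j m * H i j) / a"
  proof (cases "a = 0")
    case True
    have "G i m = 0" if i: "i < m" for i
    proof (rule ccontr)
      assume nz: "G i m \<noteq> 0"
      \<comment> \<open>Chosen so that the form takes the value -1, which contradicts its
        nonnegativity.\<close>
      define t where "t = - (G i i + 1) / (2 * G i m)"
      define \<xi> where "\<xi> k = (if k = i then 1 else if k = m then t else 0)" for k
      have d: "(\<Sum>k<m. (if k = i then 1 else if k = m then t else 0) * F k) = F i" for F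
      proof -
        have "(\<Sum>k<m. (if k = i then 1 else if k = m then t else 0) * F k) = (\<Sum>k<m. if k = i then F k else 0)"
          by (intro sum.cong refl) auto
        then show ?thesis using i by (simp add: sum.delta)
      qed
      have "(\<Sum>k<m. \<Sum>j<m. \<xi> k * \<xi> j * G k j) = (\<Sum>k<m. \<xi> k * (\<Sum>j<m. \<xi> j * G k j))"
        by (simp add: sum_distrib_left mult.assoc)
      also have "\<dots> = G i i" unfolding \<xi>_def d ..
      finally have "0 \<le> G i i + 2 * t * G i m"
        using Suc.prems(2)[of \<xi>] i True unfolding form by (simp add: \<xi>_def d)
      moreover have "2 * t * G i m = - (G i i + 1)" using nz by (simp add: t_def)
      ultimately show False by simp
    qed
    then show ?thesis using True Gm unfolding split by (simp add: G'_def a_def)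
  next
    case False
    have "(\<Sum>i<m. \<Sum>j<m. G i j * H i j) = (\<Sum>i<m. \<Sum>j<m. G' i j * H i j) + (\<Sum>i<m. \<Sum>j<m. G i m * G j m * H i j) / a"
      unfolding sum_divide_distrib sum.distrib[symmetric] by (simp add: G'_def left_diff_distrib)
    moreover have "(\<Sum>i<m. G i m * G m m * H i m) / a = (\<Sum>i<m. G i m * H i m)"
      "(\<Sum>j<m. G m m * G j m * H m j) / a = (\<Sum>j<m. G m j * H m j)"
      using False by (simp_all add: sum_divide_distrib a_def Gm)
    moreover have "G m m * G m m * H m m / a = G m m * H m m" using False by (simp add: a_def)
    ultimately show ?thesis unfolding split add_divide_distrib by simp
  qed
  moreover have "(\<Sum>i<Suc m. \<Sum>j<Suc m. G i m * G j m * H i j) / a \<le> 0"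
    using Suc.prems(3)[of "\<lambda>i. G i m"] a0 by (intro divide_nonpos_nonneg)
  ultimately show ?case by simp
qed simp

text \<open>The trace of G H G H is the pairing of \<open>G\<close> with H G H, which is positive
  semidefinite as its form at \<xi> is that of \<open>G\<close> at H \<xi>.\<close>

lemma trace_square_nonneg:
  fixes G H :: "nat \<Rightarrow> nat \<Rightarrow> real"
  assumes Gs: "\<And>i j. i < n \<Longrightarrow> j < n \<Longrightarrow> G i j = G j i" and Hs: "\<And>i j. i < n \<Longrightarrow> j < n \<Longrightarrow> H i j = H j i"
    and G: "\<And>\<xi>. (\<Sum>i<n. \<Sum>j<n. \<xi> i * \<xi> j * G i j) \<ge> 0"
  shows "(\<Sum>i<n. \<Sum>k<n. (\<Sum>b<n. G i b * H b k) * (\<Sum>d<n. G k d * H d i)) \<ge> 0"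
proof -
  define K where "K i b = (\<Sum>k<n. \<Sum>d<n. H b k * G k d * H d i)" for i b
  have "(\<Sum>i<n. \<Sum>b<n. G i b * - K i b) \<le> 0"
  proof (rule trace_psd_nsd_nonpos[OF Gs G])
    fix \<xi> :: "nat \<Rightarrow> real"
    define \<eta> where "\<eta> k = (\<Sum>b<n. H k b * \<xi> b)" for k
    have \<eta>': "\<eta> k = (\<Sum>b<n. \<xi> b * H b k)" if "k < n" for k
      unfolding \<eta>_def using Hs that by (intro sum.cong refl) (simp add: mult.commute)
    have "(\<Sum>i<n. \<Sum>b<n. \<xi> i * \<xi> b * K i b) = (\<Sum>i<n. \<Sum>b<n. \<Sum>k<n. \<Sum>d<n. \<xi> b * H b k * G k d * (H d i * \<xi> i))"
      unfolding K_def by (simp add: sum_distrib_left mult_ac)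
    also have "\<dots> = (\<Sum>i<n. \<Sum>k<n. \<Sum>b<n. \<Sum>d<n. \<xi> b * H b k * G k d * (H d i * \<xi> i))"
      by (intro sum.cong refl sum.swap)
    also have "\<dots> = (\<Sum>k<n. \<Sum>i<n. \<Sum>b<n. \<Sum>d<n. \<xi> b * H b k * G k d * (H d i * \<xi> i))"
      by (rule sum.swap)
    also have "\<dots> = (\<Sum>k<n. \<Sum>i<n. \<Sum>d<n. \<Sum>b<n. \<xi> b * H b k * G k d * (H d i * \<xi> i))"
      by (intro sum.cong refl sum.swap)
    also have "\<dots> = (\<Sum>k<n. \<Sum>d<n. \<Sum>i<n. \<Sum>b<n. \<xi> b * H b k * G k d * (H d i * \<xi> i))"
      by (intro sum.cong refl sum.swap)
    also have "\<dots> = (\<Sum>k<n. \<Sum>d<n. (\<Sum>b<n. \<xi> b * H b k) * \<eta> d * G k d)"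
      unfolding \<eta>_def sum_distrib_left sum_distrib_right by (simp add: mult_ac)
    also have "\<dots> = (\<Sum>k<n. \<Sum>d<n. \<eta> k * \<eta> d * G k d)"
      by (intro sum.cong refl) (simp add: \<eta>')
    finally have "(\<Sum>i<n. \<Sum>b<n. \<xi> i * \<xi> b * K i b) \<ge> 0" using G[of \<eta>] by simp
    then show "(\<Sum>i<n. \<Sum>j<n. \<xi> i * \<xi> j * - K i j) \<le> 0" by (simp add: sum_negf)
  qed
  moreover have "(\<Sum>i<n. \<Sum>k<n. (\<Sum>b<n. G i b * H b k) * (\<Sum>d<n. G k d * H d i)) = (\<Sum>i<n. \<Sum>b<n. G i b * K i b)"
  proof (rule sum.cong[OF refl])
    fix i
    show "(\<Sum>k<n. (\<Sum>b<n. G i b * H b k) * (\<Sum>d<n. G k d * H d i)) = (\<Sum>b<n. G i b * K i b)"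
    proof -
      have "(\<Sum>k<n. (\<Sum>b<n. G i b * H b k) * (\<Sum>d<n. G k d * H d i))
          = (\<Sum>k<n. \<Sum>b<n. \<Sum>d<n. G i b * (H b k * G k d * H d i))"
        unfolding sum_product by (simp add: mult.assoc)
      also have "\<dots> = (\<Sum>b<n. \<Sum>k<n. \<Sum>d<n. G i b * (H b k * G k d * H d i))" by (rule sum.swap)
      finally show ?thesis unfolding K_def by (simp add: sum_distrib_left)
    qed
  qed
  ultimately show ?thesis by (simp add: sum_negf)
qed

section \<open>The coefficients of \<open>det (I + \<alpha> A)\<close>\<close>

text \<open>With \<open>i\<close> also its image is moved, by injectivity. Hence a nontrivial
  permutation meets at least two off-diagonal entries.\<close>

lemma permutes_two_moved:
  assumes p: "p permutes S" and "p \<noteq> id"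
  obtains i j where "i \<in> S" "j \<in> S" "i \<noteq> j" "p i \<noteq> i" "p j \<noteq> j"
proof -
  obtain i where i: "p i \<noteq> i" using assms(2) by (auto simp: fun_eq_iff)
  have "i \<in> S" using p i by (meson permutes_not_in)
  moreover have "p i \<in> S" using \<open>i \<in> S\<close> p by (simp add: permutes_in_image)
  moreover have "p (p i) \<noteq> p i" using i permutes_inj[OF p] by (auto dest: injD)
  ultimately show thesis using that[of i "p i"] i by metis
qed

lemma prod_one_plus_linear:
  fixes a :: "'i \<Rightarrow> real"
  assumes "finite I"
  shows "coeff (\<Prod>i\<in>I. [:1, a i:]) 0 = 1 \<and> coeff (\<Prod>i\<in>I. [:1, a i:]) 1 = (\<Sum>i\<in>I. a i)"
  using assms
proof (induction I rule: finite_induct)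
  case (insert i I)
  have "coeff ([:1, b:] * q) 0 = coeff q 0 \<and> coeff ([:1, b:] * q) 1 = coeff q 1 + b * coeff q 0" for b :: real and q
    by (simp add: coeff_pCons)
  then show ?case using insert by simp
qed simp

text \<open>In the Leibniz expansion every off-diagonal entry carries a factor of the indeterminate,
  so only the identity permutation reaches degrees 0 and 1.\<close>

lemma det_poly_coeff_01:
  assumes A: "A \<in> carrier_mat n n"
  shows "coeff (det_poly n A) 0 = 1" "coeff (det_poly n A) 1 = (\<Sum>i<n. A $$ (i, i))"
proof -
  let ?B = "1\<^sub>m n + [:0, 1:] \<cdot>\<^sub>m map_mat (\<lambda>a. [:a:]) A"
  have B: "?B \<in> carrier_mat n n" using A by simp
  have ent: "?B $$ (i, j) = (if i = j then [:1, A $$ (i, j):] else [:0, A $$ (i, j):])" if "i < n" "j < n" for i j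
    using A that by (simp add: one_pCons)
  define T where "T p = signof p * (\<Prod>i = 0..<n. ?B $$ (i, p i))" for p :: "nat \<Rightarrow> nat"
  have T0: "coeff (T p) k = 0" if p: "p permutes {0..<n}" "p \<noteq> id" and k: "k < 2" for p k
  proof -
    obtain i j where ij: "i \<in> {0..<n}" "j \<in> {0..<n}" "i \<noteq> j" "p i \<noteq> i" "p j \<noteq> j"
      using permutes_two_moved[OF p] by blast
    have pl: "p i < n" "p j < n" using ij permutes_in_image[OF p(1)] by auto
    define R where "R = (\<Prod>i\<in>{0..<n} - {i} - {j}. ?B $$ (i, p i))"
    have "(\<Prod>i = 0..<n. ?B $$ (i, p i)) = ?B $$ (i, p i) * (?B $$ (j, p j) * R)"
      unfolding R_def using ij by (subst prod.remove[of _ i], simp, simp, subst prod.remove[of _ j]) auto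
    also have "\<dots> = [:0, A $$ (i, p i):] * ([:0, A $$ (j, p j):] * R)"
      using ij ij(4,5)[symmetric] pl by (simp only: ent atLeastLessThan_iff if_False)
    finally have "T p = pCons 0 (pCons 0 (signof p * smult (A $$ (i, p i) * A $$ (j, p j)) R))"
      unfolding T_def by (simp add: mult_ac)
    then show ?thesis using k by (simp add: coeff_pCons split: nat.split)
  qed
  have det: "det_poly n A = (\<Sum>p\<in>{p. p permutes {0..<n}}. T p)"
    unfolding det_poly_def det_def'[OF B] T_def ..
  have "(\<Sum>p\<in>{p. p permutes {0..<n}}. coeff (T p) k) = coeff (T id) k" if "k < 2" for k
  proof -
    have "(\<Sum>p\<in>{p. p permutes {0..<n}}. coeff (T p) k) = (\<Sum>p\<in>{id}. coeff (T p) k)"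
      by (rule sum.mono_neutral_right) (use T0 that in \<open>auto simp: permutes_id finite_permutations\<close>)
    then show ?thesis by simp
  qed
  then have c: "coeff (det_poly n A) k = coeff (T id) k" if "k < 2" for k
    using that unfolding det coeff_sum by simp
  have "T id = (\<Prod>i = 0..<n. [:1, A $$ (i, i):])"
    unfolding T_def by (simp add: ent cong: prod.cong_simp)
  then show "coeff (det_poly n A) 0 = 1" "coeff (det_poly n A) 1 = (\<Sum>i<n. A $$ (i, i))"
    using c[of 0] c[of 1] prod_one_plus_linear[of "{0..<n}" "\<lambda>i. A $$ (i, i)"] by (simp_all add: lessThan_atLeast0)
qed

lemma poly_det_poly:
  assumes A: "A \<in> carrier_mat n n"
  shows "poly (det_poly n A) t = Determinant.det (1\<^sub>m n + t \<cdot>\<^sub>m A)"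
proof -
  interpret ev: comm_ring_hom "\<lambda>p :: real poly. poly p t"
    by unfold_locales auto
  have "map_mat (\<lambda>p. poly p t) (1\<^sub>m n + [:0, 1:] \<cdot>\<^sub>m map_mat (\<lambda>a. [:a:]) A) = 1\<^sub>m n + t \<cdot>\<^sub>m A"
    using A by (intro eq_matI) auto
  then show ?thesis unfolding det_poly_def by (metis ev.hom_det)
qed

text \<open>From \<open>det (I + t A) det (I - t A) = det (I - t\<^sup>2 A\<^sup>2)\<close>, comparing the coefficients of \<open>t\<^sup>2\<close>.\<close>

lemma det_poly_coeff_2:
  assumes A: "A \<in> carrier_mat n n"
  shows "2 * coeff (det_poly n A) 2 = (\<Sum>i<n. A $$ (i, i))\<^sup>2 - (\<Sum>i<n. \<Sum>j<n. A $$ (i, j) * A $$ (j, i))"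
proof -
  define p where "p = det_poly n A"
  define q where "q = det_poly n (- (A * A))"
  have AA: "- (A * A) \<in> carrier_mat n n" using A by simp
  have "poly (p * pcompose p [:0, -1:]) t = poly (pcompose q [:0, 0, 1:]) t" for t
  proof -
    have "(1\<^sub>m n + t \<cdot>\<^sub>m A) * (1\<^sub>m n + (- t) \<cdot>\<^sub>m A) = 1\<^sub>m n + (t * t) \<cdot>\<^sub>m (- (A * A))"
    proof -
      have "(1\<^sub>m n + t \<cdot>\<^sub>m A) * (1\<^sub>m n + (- t) \<cdot>\<^sub>m A) = 1\<^sub>m n * (1\<^sub>m n + (- t) \<cdot>\<^sub>m A) + (t \<cdot>\<^sub>m A) * (1\<^sub>m n + (- t) \<cdot>\<^sub>m A)"
        by (rule add_mult_distrib_mat[of _ n n _ _ n]) (use A in auto)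
      also have "(t \<cdot>\<^sub>m A) * (1\<^sub>m n + (- t) \<cdot>\<^sub>m A) = (t \<cdot>\<^sub>m A) * 1\<^sub>m n + (t \<cdot>\<^sub>m A) * ((- t) \<cdot>\<^sub>m A)"
        by (rule mult_add_distrib_mat[of _ n n _ n]) (use A in auto)
      also have "(t \<cdot>\<^sub>m A) * ((- t) \<cdot>\<^sub>m A) = (- (t * t)) \<cdot>\<^sub>m (A * A)"
      proof -
        have "(t \<cdot>\<^sub>m A) * ((- t) \<cdot>\<^sub>m A) = (- t) \<cdot>\<^sub>m ((t \<cdot>\<^sub>m A) * A)"
          by (rule mult_smult_distrib[of _ n n _ n]) (use A in auto)
        also have "(t \<cdot>\<^sub>m A) * A = t \<cdot>\<^sub>m (A * A)"
          by (rule mult_smult_assoc_mat[of _ n n _ n]) (use A in auto)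
        finally show ?thesis by (auto intro!: eq_matI)
      qed
      finally show ?thesis using A by (intro eq_matI) auto
    qed
    then have "Determinant.det (1\<^sub>m n + t \<cdot>\<^sub>m A) * Determinant.det (1\<^sub>m n + (- t) \<cdot>\<^sub>m A)
        = Determinant.det (1\<^sub>m n + (t * t) \<cdot>\<^sub>m (- (A * A)))"
      using det_mult[of "1\<^sub>m n + t \<cdot>\<^sub>m A" n "1\<^sub>m n + (- t) \<cdot>\<^sub>m A"] A by simp
    then show ?thesis
      unfolding p_def q_def poly_mult poly_pcompose by (simp add: poly_det_poly[OF A] poly_det_poly[OF AA])
  qed
  then have eq: "p * pcompose p [:0, -1:] = pcompose q [:0, 0, 1:]"
    using poly_eq_poly_eq_iff by (metis ext)
  \<comment> \<open>The constant coefficient of \<open>r\<close> is the coefficient sought;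
    \<open>a0\<close> and \<open>a1\<close> are known from \<open>det_poly_coeff_01\<close>.\<close>
  obtain a0 a1 r where p: "p = pCons a0 (pCons a1 r)" by (metis pCons_cases)
  obtain b0 b1 r' where q: "q = pCons b0 (pCons b1 r')" by (metis pCons_cases)
  have a: "a0 = 1" "a1 = (\<Sum>i<n. A $$ (i, i))"
    using det_poly_coeff_01[OF A] unfolding p_def[symmetric] p by (simp_all add: coeff_pCons)
  have b: "b1 = (\<Sum>i<n. (- (A * A)) $$ (i, i))"
    using det_poly_coeff_01(2)[OF AA] unfolding q_def[symmetric] q by (simp add: coeff_pCons)
  have tr: "(- (A * A)) $$ (i, i) = - (\<Sum>j<n. A $$ (i, j) * A $$ (j, i))" if "i < n" for i
    using A that by (auto simp: scalar_prod_def lessThan_atLeast0 intro!: sum.cong)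
  \<comment> \<open>The coefficient of t^2 in p(t) p(-t); in q(t^2) it is the linear coefficient of
    q, i.e. minus the trace of A^2.\<close>
  have "coeff (p * pcompose p [:0, -1:]) 2 = 2 * coeff r 0 * a0 - a1 * a1"
    unfolding p by (simp add: pcompose_pCons numeral_2_eq_2 coeff_pCons coeff_mult poly_0_coeff_0)
  moreover have "coeff (pcompose q [:0, 0, 1:]) 2 = b1"
    unfolding q by (simp add: pcompose_pCons numeral_2_eq_2 coeff_pCons coeff_mult)
  moreover have "coeff p 2 = coeff r 0" unfolding p by (simp add: numeral_2_eq_2)
  ultimately show ?thesis
    unfolding p_def[symmetric] eq a b by (simp add: tr sum_negf power2_eq_square)
qed

section \<open>The differential ring of a chart\<close>

lemma sum_delta_left: "k < n \<Longrightarrow> (\<Sum>p<n. (if k = p then 1 else 0) * F p) = (F k :: real)" for n k :: nat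
  by (simp add: if_distribR if_distrib sum.delta cong: if_cong)

lemma sum_delta_right: "k < n \<Longrightarrow> (\<Sum>p<n. F p * (if p = k then 1 else 0)) = (F k :: real)" for n k :: nat
  by (simp add: if_distribR if_distrib sum.delta cong: if_cong)

locale riem_chart = riemannian M for M :: "'a riem" +
  fixes c :: "'a chart"
  assumes c: "c \<in> ratlas M"
begin

abbreviation "U \<equiv> snd c ` fst c"

abbreviation "gi i j x \<equiv> ginv_mat M c x $$ (i, j)"

lemma U: "openin (Euclidean_space n) U"
  by (rule is_chart_facts(2)[OF chart[OF c]])

lemma christoffel_smooth: "k < n \<Longrightarrow> i < n \<Longrightarrow> j < n \<Longrightarrow> smooth_on n U (christoffel M c k i j)"
  unfolding christoffel_def
  by (intro smooth_on_mult[OF U] smooth_on_const[OF U] smooth_on_sum[OF U] smooth_on_add[OF U] smooth_on_diff[OF U]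
      smooth_on_partial ginv_smooth[OF c] gcomp_smooth[OF c]) auto

lemma partial_gcomp_sym:
  assumes "x \<in> U" "l < n" "i < n" "j < n"
  shows "partial l (gcomp M c i j) x = partial l (gcomp M c j i) x"
  by (rule partial_cong[OF U assms(1,2)]) (rule gcomp_sym[OF c _ assms(3,4)])

lemma christoffel_sym:
  assumes "x \<in> U" "i < n" "j < n"
  shows "christoffel M c k i j x = christoffel M c k j i x"
proof -
  have "partial l (gcomp M c i j) x = partial l (gcomp M c j i) x" if "l < n" for l
    by (rule partial_gcomp_sym[OF assms(1) that assms(2,3)])
  then show ?thesis unfolding christoffel_def by (intro arg_cong2[of _ _ _ _ "(*)"] refl sum.cong) auto
qed

lemma christoffel_lower:
  assumes x: "x \<in> U" and m: "m < n"
  shows "(\<Sum>k<n. gcomp M c m k x * christoffel M c k i j x) =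
    (partial i (gcomp M c j m) x + partial j (gcomp M c i m) x - partial m (gcomp M c i j) x) / 2"
proof -
  define B where "B l = partial i (gcomp M c j l) x + partial j (gcomp M c i l) x - partial l (gcomp M c i j) x" for l
  have "(\<Sum>k<n. gcomp M c m k x * christoffel M c k i j x) = (\<Sum>k<n. \<Sum>l<n. gcomp M c m k x * gi k l x * (B l / 2))"
    unfolding christoffel_def B_def[symmetric] by (simp add: sum_distrib_left mult_ac)
  also have "\<dots> = (\<Sum>l<n. (\<Sum>k<n. gcomp M c m k x * gi k l x) * (B l / 2))"
    unfolding sum_distrib_right by (rule sum.swap)
  also have "\<dots> = (\<Sum>l<n. (if m = l then 1 else 0) * (B l / 2))"
    by (intro sum.cong refl) (simp only: ginv_g(2)[OF c x m] lessThan_iff)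
  also have "\<dots> = B m / 2" by (rule sum_delta_left[OF m])
  finally show ?thesis by (simp add: B_def)
qed

text \<open>The metric is parallel: of the six derivatives produced by lowering the two Christoffel
  symbols, four cancel in pairs.\<close>

lemma partial_gcomp:
  assumes x: "x \<in> U" and i: "i < n" and l: "l < n" and m: "m < n"
  shows "partial i (gcomp M c l m) x = (\<Sum>p<n. gcomp M c m p x * christoffel M c p i l x)
    + (\<Sum>p<n. gcomp M c l p x * christoffel M c p i m x)"
  unfolding christoffel_lower[OF x m] christoffel_lower[OF x l]
  using partial_gcomp_sym[OF x i l m] partial_gcomp_sym[OF x m i l] partial_gcomp_sym[OF x l i m] by (simp add: field_simps)

text \<open>Differentiate the identity that the inverse metric times the metric is constant, solve
  for the derivative of the inverse by contracting with the inverse once more, and insert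
  \<open>partial_gcomp\<close>.\<close>

lemma partial_ginv:
  assumes x: "x \<in> U" and i: "i < n" and k: "k < n" and q: "q < n"
  shows "partial i (gi k q) x = - (\<Sum>p<n. christoffel M c k i p x * gi p q x) - (\<Sum>p<n. christoffel M c q i p x * gi k p x)"
proof -
  let ?g = "\<lambda>i j. gcomp M c i j x" and ?\<Gamma> = "\<lambda>k i j. christoffel M c k i j x"
  have 0: "(\<Sum>l<n. partial i (gi k l) x * ?g l m) = - (\<Sum>l<n. gi k l x * partial i (gcomp M c l m) x)" if m: "m < n" for m
  proof -
    have "partial i (\<lambda>x. \<Sum>l<n. gi k l x * gcomp M c l m x) x = partial i (\<lambda>x. if k = m then 1 else 0) x"
      by (rule partial_cong[OF U x i]) (rule ginv_g(1)[OF c _ k m])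
    moreover have "partial i (\<lambda>x. \<Sum>l<n. gi k l x * gcomp M c l m x) x
        = (\<Sum>l<n. partial i (\<lambda>x. gi k l x * gcomp M c l m x) x)"
      using k m by (intro partial_sum_on[OF U i x] smooth_on_mult[OF U] ginv_smooth[OF c] gcomp_smooth[OF c]) auto
    moreover have "(\<Sum>l<n. partial i (\<lambda>x. gi k l x * gcomp M c l m x) x)
        = (\<Sum>l<n. partial i (gi k l) x * ?g l m + gi k l x * partial i (gcomp M c l m) x)"
      using k m by (intro sum.cong refl partial_mult_on[OF U i x] ginv_smooth[OF c] gcomp_smooth[OF c]) auto
    ultimately show ?thesis by (simp add: sum.distrib)
  qed
  have "partial i (gi k q) x = (\<Sum>l<n. partial i (gi k l) x * (if l = q then 1 else 0))"
    by (simp only: sum_delta_right[OF q])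
  also have "\<dots> = (\<Sum>l<n. partial i (gi k l) x * (\<Sum>m<n. ?g l m * gi m q x))"
    by (intro sum.cong refl) (simp only: ginv_g(2)[OF c x _ q] lessThan_iff)
  also have "\<dots> = (\<Sum>m<n. (\<Sum>l<n. partial i (gi k l) x * ?g l m) * gi m q x)"
    unfolding sum_distrib_left sum_distrib_right by (subst sum.swap) (simp add: mult.assoc)
  also have "\<dots> = (\<Sum>m<n. - (\<Sum>l<n. gi k l x * partial i (gcomp M c l m) x) * gi m q x)"
    by (intro sum.cong refl) (simp only: 0 lessThan_iff)
  also have "\<dots> = - (\<Sum>m<n. \<Sum>l<n. gi k l x * partial i (gcomp M c l m) x * gi m q x)"
    by (simp add: sum_negf sum_distrib_right)
  also have "(\<Sum>m<n. \<Sum>l<n. gi k l x * partial i (gcomp M c l m) x * gi m q x)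
      = (\<Sum>m<n. \<Sum>l<n. gi k l x * ((\<Sum>p<n. ?g m p * ?\<Gamma> p i l) + (\<Sum>p<n. ?g l p * ?\<Gamma> p i m)) * gi m q x)"
    by (intro sum.cong refl) (simp only: partial_gcomp[OF x i] lessThan_iff)
  also have "\<dots> = (\<Sum>m<n. \<Sum>l<n. gi k l x * (\<Sum>p<n. ?g m p * ?\<Gamma> p i l) * gi m q x)
      + (\<Sum>m<n. \<Sum>l<n. gi k l x * (\<Sum>p<n. ?g l p * ?\<Gamma> p i m) * gi m q x)"
    by (simp add: distrib_left distrib_right sum.distrib)
  also have "(\<Sum>m<n. \<Sum>l<n. gi k l x * (\<Sum>p<n. ?g m p * ?\<Gamma> p i l) * gi m q x) = (\<Sum>l<n. ?\<Gamma> q i l * gi k l x)"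
  proof -
    have "(\<Sum>m<n. \<Sum>l<n. gi k l x * (\<Sum>p<n. ?g m p * ?\<Gamma> p i l) * gi m q x)
      = (\<Sum>l<n. \<Sum>m<n. \<Sum>p<n. gi k l x * ?\<Gamma> p i l * (gi m q x * ?g m p))"
      unfolding sum_distrib_left sum_distrib_right by (subst sum.swap) (simp add: mult_ac)
    also have "\<dots> = (\<Sum>l<n. \<Sum>p<n. gi k l x * ?\<Gamma> p i l * (\<Sum>m<n. gi m q x * ?g m p))"
      unfolding sum_distrib_left by (intro sum.cong refl sum.swap)
    also have "\<dots> = (\<Sum>l<n. \<Sum>p<n. gi k l x * ?\<Gamma> p i l * (if p = q then 1 else 0))"
    proof (intro sum.cong refl arg_cong2[of _ _ _ _ "(*)"])
      fix p assume "p \<in> {..<n}"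
      then have p: "p < n" by simp
      have "(\<Sum>m<n. gi m q x * ?g m p) = (\<Sum>m<n. gi q m x * ?g m p)"
        by (intro sum.cong refl) (simp only: ginv_sym[OF c x _ q] lessThan_iff)
      then show "(\<Sum>m<n. gi m q x * ?g m p) = (if p = q then 1 else 0)"
        using ginv_g(1)[OF c x q p] by auto
    qed
    also have "\<dots> = (\<Sum>l<n. gi k l x * ?\<Gamma> q i l)" by (simp only: sum_delta_right[OF q])
    finally show ?thesis by (simp only: mult.commute)
  qed
  also have "(\<Sum>m<n. \<Sum>l<n. gi k l x * (\<Sum>p<n. ?g l p * ?\<Gamma> p i m) * gi m q x) = (\<Sum>m<n. ?\<Gamma> k i m * gi m q x)"
  proof (intro sum.cong refl)
    fix m
    have "(\<Sum>l<n. gi k l x * (\<Sum>p<n. ?g l p * ?\<Gamma> p i m) * gi m q x)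
      = (\<Sum>p<n. (\<Sum>l<n. gi k l x * ?g l p) * (?\<Gamma> p i m * gi m q x))"
      unfolding sum_distrib_left sum_distrib_right by (subst sum.swap) (simp add: mult_ac)
    also have "\<dots> = (\<Sum>p<n. (if k = p then 1 else 0) * (?\<Gamma> p i m * gi m q x))"
      by (intro sum.cong refl) (simp only: ginv_g(1)[OF c x k] lessThan_iff)
    also have "\<dots> = ?\<Gamma> k i m * gi m q x" by (rule sum_delta_left[OF k])
    finally show "(\<Sum>l<n. gi k l x * (\<Sum>p<n. ?g l p * ?\<Gamma> p i m) * gi m q x) = ?\<Gamma> k i m * gi m q x" .
  qed
  finally show ?thesis by simp
qed

text \<open>Derivatives, metric and Christoffel symbols are cut off outside \<open>U\<close> (and for indices from \<open>n\<close>
  on), so that identities on \<open>U\<close> become equations in the ring of all functions.\<close>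

definition smooths :: "((nat \<Rightarrow> real) \<Rightarrow> real) set" where
  "smooths = {F. smooth_on n U F}"

definition pd :: "nat \<Rightarrow> ((nat \<Rightarrow> real) \<Rightarrow> real) \<Rightarrow> (nat \<Rightarrow> real) \<Rightarrow> real" where
  "pd i F = (\<lambda>x. if i < n \<and> x \<in> U then partial i F x else 0)"

definition G0 :: "nat \<Rightarrow> nat \<Rightarrow> (nat \<Rightarrow> real) \<Rightarrow> real" where
  "G0 i j = (\<lambda>x. if i < n \<and> j < n \<and> x \<in> U then gi i j x else 0)"

definition \<Gamma>0 :: "nat \<Rightarrow> nat \<Rightarrow> nat \<Rightarrow> (nat \<Rightarrow> real) \<Rightarrow> real" where
  "\<Gamma>0 k i j = (\<lambda>x. if k < n \<and> i < n \<and> j < n \<and> x \<in> U then christoffel M c k i j x else 0)"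

lemma pd_apply: "i < n \<Longrightarrow> x \<in> U \<Longrightarrow> pd i F x = partial i F x"
  by (simp add: pd_def)

lemma smooths_cong: "smooth_on n U F \<Longrightarrow> (\<And>x. x \<in> U \<Longrightarrow> H x = F x) \<Longrightarrow> H \<in> smooths"
  unfolding smooths_def mem_Collect_eq by (rule smooth_on_cong[OF U]) auto

lemma smoothsD: "F \<in> smooths \<Longrightarrow> smooth_on n U F"
  by (simp add: smooths_def)

lemma sum_fun_apply: "(sum h I :: 'z \<Rightarrow> real) x = (\<Sum>i\<in>I. h i x)"
  by (induction I rule: infinite_finite_induct) auto

lemma pd_cong: "(\<And>x. x \<in> U \<Longrightarrow> F x = H x) \<Longrightarrow> pd i F = pd i H"
proof
  fix x assume *: "\<And>x. x \<in> U \<Longrightarrow> F x = H x"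
  have "partial i F x = partial i H x" if "x \<in> U" "i < n"
    by (rule partial_cong[OF U that]) (rule *)
  then show "pd i F x = pd i H x" by (simp add: pd_def)
qed

lemma pd_G0: "pd i (G0 k l) = - (\<Sum>p<n. \<Gamma>0 k i p * G0 p l) - (\<Sum>p<n. \<Gamma>0 l i p * G0 k p)"
proof
  fix x
  show "pd i (G0 k l) x = (- (\<Sum>p<n. \<Gamma>0 k i p * G0 p l) - (\<Sum>p<n. \<Gamma>0 l i p * G0 k p)) x"
  proof (cases "i < n \<and> x \<in> U \<and> k < n \<and> l < n")
    case True
    have "pd i (G0 k l) x = partial i (gi k l) x"
      using True by (simp add: pd_def) (rule partial_cong[OF U], auto simp: G0_def)
    also have "\<dots> = - (\<Sum>p<n. christoffel M c k i p x * gi p l x) - (\<Sum>p<n. christoffel M c l i p x * gi k p x)"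
      using True by (intro partial_ginv) auto
    finally show ?thesis using True by (simp add: sum_fun_apply \<Gamma>0_def G0_def)
  next
    case False
    have "G0 k l = (\<lambda>_. 0)" if "\<not> (k < n \<and> l < n)" using that by (auto simp: G0_def)
    then have "pd i (G0 k l) x = 0" using False by (auto simp: pd_def)
    moreover have "\<Gamma>0 k i p x * G0 p l x = 0" "\<Gamma>0 l i p x * G0 k p x = 0" for p
      using False by (auto simp: \<Gamma>0_def G0_def)
    ultimately have z: "(\<Sum>p<n. \<Gamma>0 k i p x * G0 p l x) = 0" "(\<Sum>p<n. \<Gamma>0 l i p x * G0 k p x) = 0"
      and "pd i (G0 k l) x = 0" by (auto intro!: sum.neutral)
    then show ?thesis by (simp add: sum_fun_apply z del: mult_eq_0_iff)
  qed
qed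

lemma smooths_add: "a \<in> smooths \<Longrightarrow> b \<in> smooths \<Longrightarrow> a + b \<in> smooths"
  unfolding smooths_def plus_fun_def mem_Collect_eq by (rule smooth_on_add[OF U])

lemma smooths_minus: "a \<in> smooths \<Longrightarrow> - a \<in> smooths"
  unfolding smooths_def fun_Compl_def mem_Collect_eq by (rule smooth_on_minus[OF U])

lemma smooths_mult: "a \<in> smooths \<Longrightarrow> b \<in> smooths \<Longrightarrow> a * b \<in> smooths"
  unfolding smooths_def times_fun_def mem_Collect_eq by (rule smooth_on_mult[OF U])

lemma smooths_const: "(\<lambda>_. k) \<in> smooths"
  unfolding smooths_def mem_Collect_eq by (rule smooth_on_const[OF U])

lemma pd_smooths:
  assumes "a \<in> smooths"
  shows "pd i a \<in> smooths"
proof (cases "i < n")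
  case True
  show ?thesis
    by (rule smooths_cong[OF smooth_on_partial[OF smoothsD[OF assms] True]]) (rule pd_apply[OF True])
next
  case False
  then show ?thesis using smooths_const[of 0] by (simp add: pd_def)
qed

lemma pd_add:
  assumes "a \<in> smooths" "b \<in> smooths"
  shows "pd i (a + b) = pd i a + pd i b"
proof
  fix x
  show "pd i (a + b) x = (pd i a + pd i b) x"
  proof (cases "i < n \<and> x \<in> U")
    case True
    then have "partial i (\<lambda>x. a x + b x) x = partial i a x + partial i b x"
      by (intro partial_add_on[OF U _ _ smoothsD[OF assms(1)] smoothsD[OF assms(2)]]) auto
    then show ?thesis using True by (simp add: pd_def plus_fun_def)
  qed (auto simp: pd_def)
qed

lemma pd_mult:
  assumes "a \<in> smooths" "b \<in> smooths"
  shows "pd i (a * b) = pd i a * b + a * pd i b"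
proof
  fix x
  show "pd i (a * b) x = (pd i a * b + a * pd i b) x"
  proof (cases "i < n \<and> x \<in> U")
    case True
    then have "partial i (\<lambda>x. a x * b x) x = partial i a x * b x + a x * partial i b x"
      by (intro partial_mult_on[OF U _ _ smoothsD[OF assms(1)] smoothsD[OF assms(2)]]) auto
    then show ?thesis using True by (simp add: pd_def plus_fun_def times_fun_def)
  qed (auto simp: pd_def)
qed

lemma pd_const: "pd i (\<lambda>_. k) = (\<lambda>_. 0)"
  by (simp add: pd_def fun_eq_iff)

lemma pd_commute:
  assumes "a \<in> smooths"
  shows "pd i (pd j a) = pd j (pd i a)"
proof (cases "i < n \<and> j < n")
  case True
  have "pd i (pd j a) = pd i (partial j a)" by (rule pd_cong) (simp add: pd_apply True)
  also have "\<dots> = pd j (partial i a)"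
  proof
    fix x
    show "pd i (partial j a) x = pd j (partial i a) x"
      using True partial_commute[OF U smoothsD[OF assms], of x i j] unfolding pd_def by auto
  qed
  also have "\<dots> = pd j (pd i a)" by (rule pd_cong) (simp add: pd_apply True)
  finally show ?thesis .
next
  case False
  have z: "pd i F = (\<lambda>_. 0)" if "\<not> i < n" for i F using that by (simp add: pd_def)
  show ?thesis
  proof (cases "i < n")
    case True
    then have "\<not> j < n" using False by simp
    then show ?thesis by (simp add: z pd_const)
  qed (simp add: z pd_const)
qed

lemma G0_smooths: "G0 i j \<in> smooths"
proof (cases "i < n \<and> j < n")
  case True
  then have "smooth_on n U (gi i j)" by (intro ginv_smooth[OF c]) auto
  then show ?thesis by (rule smooths_cong) (simp add: G0_def True)
next
  case False
  then have "G0 i j = (\<lambda>_. 0)" by (auto simp: G0_def)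
  then show ?thesis using smooths_const[of 0] by simp
qed

lemma \<Gamma>0_smooths: "\<Gamma>0 k i j \<in> smooths"
proof (cases "k < n \<and> i < n \<and> j < n")
  case True
  then have "smooth_on n U (christoffel M c k i j)" by (intro christoffel_smooth) auto
  then show ?thesis by (rule smooths_cong) (simp add: \<Gamma>0_def True)
next
  case False
  then have "\<Gamma>0 k i j = (\<lambda>_. 0)" by (auto simp: \<Gamma>0_def)
  then show ?thesis using smooths_const[of 0] by simp
qed

lemma G0_sym: "G0 i j = G0 j i"
proof
  fix x
  have "gi i j x = gi j i x" if "i < n" "j < n" "x \<in> U" by (rule ginv_sym[OF c that(3,1,2)])
  then show "G0 i j x = G0 j i x" by (simp add: G0_def)
qed

lemma \<Gamma>0_sym: "\<Gamma>0 k i j = \<Gamma>0 k j i"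
proof
  fix x
  have "christoffel M c k i j x = christoffel M c k j i x" if "i < n" "j < n" "x \<in> U"
    by (rule christoffel_sym[OF that(3,1,2)])
  then show "\<Gamma>0 k i j x = \<Gamma>0 k j i x" by (simp add: \<Gamma>0_def)
qed

text \<open>The geometric input is \<open>pd_G0\<close> together with the symmetries of the inverse
  metric and the Christoffel symbols; the other axioms are calculus.\<close>

sublocale alg: christoffel_algebra smooths pd n G0 \<Gamma>0
proof (unfold_locales; (fact smooths_add smooths_minus smooths_mult pd_smooths pd_add pd_mult pd_commute G0_smooths \<Gamma>0_smooths G0_sym \<Gamma>0_sym pd_G0)?)
  show "0 \<in> smooths" using smooths_const[of 0] by (simp add: zero_fun_def)
  show "a + a = 0 \<Longrightarrow> a = 0" for a :: "(nat \<Rightarrow> real) \<Rightarrow> real" by (simp add: fun_eq_iff)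
qed

lemma alg_Rm:
  assumes "x \<in> U" "l < n" "i < n" "j < n" "k < n"
  shows "alg.Rm l i j k x = curvature M c l i j k x"
proof -
  have g: "pd i (\<Gamma>0 l j k) x = partial i (christoffel M c l j k) x" if "i < n" "l < n" "j < n" "k < n" for i l j k
    using that assms(1) partial_cong[OF U assms(1) that(1), of "\<Gamma>0 l j k" "christoffel M c l j k"]
    by (simp add: pd_def \<Gamma>0_def)
  show ?thesis
    unfolding alg.Rm_def curvature_def using assms g by (simp add: sum_fun_apply \<Gamma>0_def)
qed

lemma alg_Hess:
  assumes "x \<in> U" "i < n" "j < n"
  shows "alg.Hess (h \<circ> chart_inv c) i j x = hessian M c h i j x"
proof -
  have "pd i (pd j (h \<circ> chart_inv c)) x = partial i (partial j (h \<circ> chart_inv c)) x"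
    unfolding pd_apply[OF assms(2,1)] by (rule partial_cong[OF U assms(1,2)]) (rule pd_apply[OF assms(3)])
  then show ?thesis
    unfolding alg.Hess_def hessian_def using assms by (simp add: sum_fun_apply \<Gamma>0_def pd_def)
qed

end

section \<open>Invariance under coordinate changes\<close>

text \<open>The components of a metric \<open>g\<close> and of a function in coordinates \<open>y = \<tau> x\<close> and of their
  pullbacks in coordinates \<open>x\<close>, at one point: \<open>J i a\<close> and \<open>K i a b\<close> are the first and second
  derivatives of \<open>\<tau>\<close>, \<open>dg k i j\<close> and \<open>dg' c a b\<close> those of the metric, \<open>f1\<close>, \<open>f2\<close> those of the function.\<close>

locale coordinate_change =
  fixes n :: nat and J :: "nat \<Rightarrow> nat \<Rightarrow> real" and K :: "nat \<Rightarrow> nat \<Rightarrow> nat \<Rightarrow> real"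
    and g G g' G' :: "nat \<Rightarrow> nat \<Rightarrow> real" and dg dg' :: "nat \<Rightarrow> nat \<Rightarrow> nat \<Rightarrow> real"
    and f1 f1' :: "nat \<Rightarrow> real" and f2 f2' :: "nat \<Rightarrow> nat \<Rightarrow> real"
  assumes g_sym: "i < n \<Longrightarrow> j < n \<Longrightarrow> g i j = g j i" and G_sym: "i < n \<Longrightarrow> j < n \<Longrightarrow> G i j = G j i"
    and K_sym: "i < n \<Longrightarrow> a < n \<Longrightarrow> b < n \<Longrightarrow> K i a b = K i b a"
    and gG: "i < n \<Longrightarrow> j < n \<Longrightarrow> (\<Sum>k<n. g i k * G k j) = (if i = j then 1 else 0)"
    and G'g': "i < n \<Longrightarrow> j < n \<Longrightarrow> (\<Sum>k<n. G' i k * g' k j) = (if i = j then 1 else 0)"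
    and g': "a < n \<Longrightarrow> b < n \<Longrightarrow> g' a b = (\<Sum>i<n. \<Sum>j<n. J i a * J j b * g i j)"
    and dg': "e < n \<Longrightarrow> a < n \<Longrightarrow> b < n \<Longrightarrow> dg' e a b = (\<Sum>i<n. \<Sum>j<n. K i a e * J j b * g i j + J i a * K j b e * g i j
      + J i a * J j b * (\<Sum>k<n. dg k i j * J k e))"
    and f1': "a < n \<Longrightarrow> f1' a = (\<Sum>i<n. J i a * f1 i)"
    and f2': "a < n \<Longrightarrow> b < n \<Longrightarrow> f2' b a = (\<Sum>i<n. K i a b * f1 i) + (\<Sum>i<n. \<Sum>j<n. J i a * J j b * f2 j i)"
    and f2_sym: "i < n \<Longrightarrow> j < n \<Longrightarrow> f2 i j = f2 j i"
begin

text \<open>Let L be G' times the transpose of J times g. The law for g' gives L J = G' g' = 1; for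
  square matrices also J L = 1, which says that J G' times the transpose of J is a left inverse of
  g.\<close>

lemma JGJ: 
  assumes "i < n" "k < n"
  shows "(\<Sum>a<n. \<Sum>b<n. J i a * G' a b * J k b) = G i k"
proof -
  define L where "L a j = (\<Sum>b<n. \<Sum>k<n. G' a b * J k b * g k j)" for a j
  have LJ: "(\<Sum>j<n. L a j * J j b) = (if a = b then 1 else 0)" if "a < n" "b < n" for a b
  proof -
    have "(\<Sum>j<n. L a j * J j b) = (\<Sum>j<n. \<Sum>e<n. \<Sum>k<n. G' a e * (J k e * J j b * g k j))"
      unfolding L_def sum_distrib_right by (simp add: mult_ac)
    also have "\<dots> = (\<Sum>e<n. \<Sum>j<n. \<Sum>k<n. G' a e * (J k e * J j b * g k j))" by (rule sum.swap)
    also have "\<dots> = (\<Sum>e<n. \<Sum>k<n. \<Sum>j<n. G' a e * (J k e * J j b * g k j))"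
      by (intro sum.cong refl sum.swap)
    also have "\<dots> = (\<Sum>e<n. G' a e * g' e b)"
      using that by (intro sum.cong refl) (simp add: g' sum_distrib_left)
    finally show ?thesis using G'g' that by simp
  qed
  have JL: "(\<Sum>a<n. J i a * L a j) = (if i = j then 1 else 0)" if ij: "i < n" "j < n" for i j
  proof -
    define LM where "LM = mat n n (\<lambda>(a, j). L a j)"
    define JM where "JM = mat n n (\<lambda>(i, a). J i a)"
    have "LM * JM = 1\<^sub>m n"
    proof (rule eq_matI)
      fix a b assume "a < dim_row (1\<^sub>m n :: real mat)" "b < dim_col (1\<^sub>m n :: real mat)"
      then have ab: "a < n" "b < n" by simp_all
      then have "(LM * JM) $$ (a, b) = (\<Sum>j<n. L a j * J j b)"
        by (auto simp: LM_def JM_def scalar_prod_def lessThan_atLeast0 intro!: sum.cong)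
      then show "(LM * JM) $$ (a, b) = 1\<^sub>m n $$ (a, b)" using LJ[OF ab] ab by simp
    qed (simp_all add: LM_def JM_def)
    then have "JM * LM = 1\<^sub>m n"
      by (rule mat_mult_left_right_inverse[rotated 2]) (simp_all add: LM_def JM_def)
    then have "(JM * LM) $$ (i, j) = (if i = j then 1 else 0)" using ij by simp
    moreover have "(JM * LM) $$ (i, j) = (\<Sum>a<n. J i a * L a j)"
      using ij by (auto simp: LM_def JM_def scalar_prod_def lessThan_atLeast0 intro!: sum.cong)
    ultimately show ?thesis by simp
  qed
  show ?thesis
  proof (rule inverse_unique_index[where a = "\<lambda>i k. \<Sum>a<n. \<Sum>b<n. J i a * G' a b * J k b" and b = G and g = g and n = n])
    fix i j assume ij: "i < n" "j < n"
    have "(\<Sum>k<n. (\<Sum>a<n. \<Sum>b<n. J i a * G' a b * J k b) * g k j) = (\<Sum>k<n. \<Sum>a<n. \<Sum>b<n. J i a * (G' a b * J k b * g k j))"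
      unfolding sum_distrib_right by (simp add: mult_ac)
    also have "\<dots> = (\<Sum>a<n. \<Sum>k<n. \<Sum>b<n. J i a * (G' a b * J k b * g k j))" by (rule sum.swap)
    also have "\<dots> = (\<Sum>a<n. \<Sum>b<n. \<Sum>k<n. J i a * (G' a b * J k b * g k j))" by (intro sum.cong refl sum.swap)
    also have "\<dots> = (\<Sum>a<n. J i a * L a j)" unfolding L_def by (simp add: sum_distrib_left)
    finally show "(\<Sum>k<n. (\<Sum>a<n. \<Sum>b<n. J i a * G' a b * J k b) * g k j) = (if i = j then 1 else 0)"
      using JL[OF ij] by simp
  next
    show "(\<Sum>k<n. g i k * G k j) = (if i = j then 1 else 0)" if "i < n" "j < n" for i j by (rule gG[OF that])
  qed (rule assms)+
qed

definition "Ch k i j = (1 / 2) * (\<Sum>l<n. G k l * (dg i j l + dg j i l - dg l i j))"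
definition "Ch' k i j = (1 / 2) * (\<Sum>l<n. G' k l * (dg' i j l + dg' j i l - dg' l i j))"
definition "H i j = f2 i j - (\<Sum>k<n. Ch k i j * f1 k)"
definition "H' i j = f2' i j - (\<Sum>k<n. Ch' k i j * f1' k)"

text \<open>The transformation law of the Christoffel symbols with all indices lowered. Of the six
  second-derivative terms four cancel by the symmetry of \<open>K\<close>, and the remaining two
  coincide.\<close>

lemma lowered:
  assumes "a < n" "b < n" "e < n"
  shows "(dg' a b e + dg' b a e - dg' e a b) / 2 =
    (\<Sum>i<n. \<Sum>j<n. \<Sum>l<n. J i a * J j b * J l e * ((dg i j l + dg j i l - dg l i j) / 2)) + (\<Sum>i<n. \<Sum>j<n. K i a b * J j e * g i j)"
proof -
  define T where "T x y z = (\<Sum>i<n. \<Sum>j<n. K i x z * J j y * g i j)" for x y z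
  define L where "L e a b = (\<Sum>i<n. \<Sum>j<n. \<Sum>k<n. J i a * J j b * J k e * dg k i j)" for e a b
  have T_sym: "T x y z = T z y x" if "x < n" "z < n" for x y z
    unfolding T_def using that by (intro sum.cong refl) (simp add: K_sym)
  have d: "dg' e a b = T a b e + T b a e + L e a b" if "e < n" "a < n" "b < n" for e a b
  proof -
    have "(\<Sum>i<n. \<Sum>j<n. J i a * K j b e * g i j) = (\<Sum>j<n. \<Sum>i<n. J i a * K j b e * g i j)" by (rule sum.swap)
    also have "\<dots> = T b a e" unfolding T_def by (intro sum.cong refl) (simp add: g_sym mult_ac)
    finally show ?thesis
      unfolding dg'[OF that] sum.distrib by (simp add: T_def L_def sum_distrib_left mult_ac)
  qed
  have L1: "L a b e = (\<Sum>i<n. \<Sum>j<n. \<Sum>l<n. J i a * J j b * J l e * dg i j l)" for a b e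
  proof -
    have "L a b e = (\<Sum>i<n. \<Sum>k<n. \<Sum>j<n. J i b * J j e * J k a * dg k i j)"
      unfolding L_def by (intro sum.cong refl sum.swap)
    also have "\<dots> = (\<Sum>k<n. \<Sum>i<n. \<Sum>j<n. J i b * J j e * J k a * dg k i j)" by (rule sum.swap)
    finally show ?thesis by (simp add: mult_ac)
  qed
  have L2: "L b a e = (\<Sum>i<n. \<Sum>j<n. \<Sum>l<n. J i a * J j b * J l e * dg j i l)" for a b e
  proof -
    have "L b a e = (\<Sum>i<n. \<Sum>k<n. \<Sum>j<n. J i a * J j e * J k b * dg k i j)"
      unfolding L_def by (intro sum.cong refl sum.swap)
    then show ?thesis by (simp add: mult_ac)
  qed
  have L3: "L e a b = (\<Sum>i<n. \<Sum>j<n. \<Sum>l<n. J i a * J j b * J l e * dg l i j)" for a b e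
    unfolding L_def ..
  have "dg' a b e + dg' b a e - dg' e a b = (L a b e + L b a e - L e a b) + 2 * T a e b"
    using assms T_sym[of b a e] T_sym[of a e b] T_sym[of b e a] by (simp add: d)
  also have "L a b e + L b a e - L e a b
      = (\<Sum>i<n. \<Sum>j<n. \<Sum>l<n. J i a * J j b * J l e * (dg i j l + dg j i l - dg l i j))"
    unfolding L1[of a b e] L2[of b a e] L3[of e a b]
    by (simp add: distrib_left right_diff_distrib sum.distrib sum_subtractf)
  finally show ?thesis by (simp add: T_def sum_divide_distrib add_divide_distrib)
qed

text \<open>The gradient. Pairing the lowered symbols with it equals pairing the Christoffel symbols
  with the differential, so only the lowered symbols need a transformation law.\<close>

definition "v l = (\<Sum>k<n. G k l * f1 k)"
definition "v' e = (\<Sum>k<n. G' k e * f1' k)"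

lemma Ch_f1:
  "(\<Sum>k<n. Ch k i j * f1 k) = (\<Sum>l<n. (dg i j l + dg j i l - dg l i j) / 2 * v l)"
  "(\<Sum>k<n. Ch' k i j * f1' k) = (\<Sum>l<n. (dg' i j l + dg' j i l - dg' l i j) / 2 * v' l)"
  unfolding Ch_def Ch'_def v_def v'_def sum_distrib_left sum_distrib_right
  by (subst sum.swap, simp add: mult_ac)+

lemma J_v': "l < n \<Longrightarrow> (\<Sum>e<n. J l e * v' e) = v l"
proof -
  assume l: "l < n"
  have "(\<Sum>e<n. J l e * v' e) = (\<Sum>e<n. \<Sum>c<n. \<Sum>k<n. J k c * G' c e * J l e * f1 k)"
    unfolding v'_def by (intro sum.cong refl) (simp add: f1' sum_distrib_left mult_ac)
  also have "\<dots> = (\<Sum>e<n. \<Sum>k<n. \<Sum>c<n. J k c * G' c e * J l e * f1 k)" by (intro sum.cong refl sum.swap)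
  also have "\<dots> = (\<Sum>k<n. \<Sum>e<n. \<Sum>c<n. J k c * G' c e * J l e * f1 k)" by (rule sum.swap)
  also have "\<dots> = (\<Sum>k<n. \<Sum>c<n. \<Sum>e<n. J k c * G' c e * J l e * f1 k)" by (intro sum.cong refl sum.swap)
  also have "\<dots> = (\<Sum>k<n. G k l * f1 k)"
    using l by (intro sum.cong refl) (simp add: JGJ[symmetric] sum_distrib_right)
  finally show ?thesis unfolding v_def .
qed

lemma g_v: "i < n \<Longrightarrow> (\<Sum>j<n. g i j * v j) = f1 i"
proof -
  assume i: "i < n"
  have "(\<Sum>j<n. g i j * v j) = (\<Sum>j<n. \<Sum>k<n. g i j * G j k * f1 k)"
    unfolding v_def by (intro sum.cong refl) (simp add: sum_distrib_left mult_ac G_sym)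
  also have "\<dots> = (\<Sum>k<n. (\<Sum>j<n. g i j * G j k) * f1 k)"
    unfolding sum_distrib_right by (rule sum.swap)
  also have "\<dots> = (\<Sum>k<n. (if i = k then 1 else 0) * f1 k)" using i by (intro sum.cong refl) (simp add: gG)
  also have "\<dots> = f1 i" by (rule sum_delta_left[OF i])
  finally show ?thesis .
qed

text \<open>The second derivatives of the coordinate change enter both the second derivatives of the
  function and the Christoffel term, and cancel in the difference.\<close>

lemma Hess_transform:
  assumes ab: "a < n" "b < n"
  shows "H' a b = (\<Sum>i<n. \<Sum>j<n. J i a * J j b * H i j)"
proof -
  define C where "C i j l = (dg i j l + dg j i l - dg l i j) / 2" for i j l
  have "(\<Sum>k<n. Ch' k a b * f1' k) = (\<Sum>e<n. ((\<Sum>i<n. \<Sum>j<n. \<Sum>l<n. J i a * J j b * J l e * C i j l) + (\<Sum>i<n. \<Sum>j<n. K i a b * J j e * g i j)) * v' e)"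
    unfolding Ch_f1 C_def using ab by (intro sum.cong refl) (simp only: lowered lessThan_iff)
  also have "\<dots> = (\<Sum>e<n. \<Sum>i<n. \<Sum>j<n. \<Sum>l<n. J i a * J j b * C i j l * (J l e * v' e)) + (\<Sum>e<n. \<Sum>i<n. \<Sum>j<n. K i a b * g i j * (J j e * v' e))"
    unfolding distrib_right sum.distrib sum_distrib_right by (simp add: mult_ac)
  also have "(\<Sum>e<n. \<Sum>i<n. \<Sum>j<n. \<Sum>l<n. J i a * J j b * C i j l * (J l e * v' e)) = (\<Sum>i<n. \<Sum>j<n. \<Sum>l<n. J i a * J j b * C i j l * v l)"
  proof -
    have "(\<Sum>e<n. \<Sum>i<n. \<Sum>j<n. \<Sum>l<n. J i a * J j b * C i j l * (J l e * v' e)) = (\<Sum>i<n. \<Sum>e<n. \<Sum>j<n. \<Sum>l<n. J i a * J j b * C i j l * (J l e * v' e))"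
      by (rule sum.swap)
    also have "\<dots> = (\<Sum>i<n. \<Sum>j<n. \<Sum>e<n. \<Sum>l<n. J i a * J j b * C i j l * (J l e * v' e))"
      by (intro sum.cong refl sum.swap)
    also have "\<dots> = (\<Sum>i<n. \<Sum>j<n. \<Sum>l<n. \<Sum>e<n. J i a * J j b * C i j l * (J l e * v' e))"
      by (intro sum.cong refl sum.swap)
    also have "\<dots> = (\<Sum>i<n. \<Sum>j<n. \<Sum>l<n. J i a * J j b * C i j l * v l)"
      by (intro sum.cong refl) (simp add: sum_distrib_left[symmetric] J_v')
    finally show ?thesis .
  qed
  also have "(\<Sum>e<n. \<Sum>i<n. \<Sum>j<n. K i a b * g i j * (J j e * v' e)) = (\<Sum>i<n. K i a b * f1 i)"
  proof -
    have "(\<Sum>e<n. \<Sum>i<n. \<Sum>j<n. K i a b * g i j * (J j e * v' e)) = (\<Sum>i<n. \<Sum>e<n. \<Sum>j<n. K i a b * g i j * (J j e * v' e))"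
      by (rule sum.swap)
    also have "\<dots> = (\<Sum>i<n. \<Sum>j<n. \<Sum>e<n. K i a b * g i j * (J j e * v' e))" by (intro sum.cong refl sum.swap)
    also have "\<dots> = (\<Sum>i<n. \<Sum>j<n. K i a b * g i j * v j)" 
      by (intro sum.cong refl) (simp add: sum_distrib_left[symmetric] J_v')
    also have "\<dots> = (\<Sum>i<n. K i a b * f1 i)"
      by (intro sum.cong refl) (simp add: g_v[symmetric] sum_distrib_left mult.assoc)
    finally show ?thesis .
  qed
  finally have "(\<Sum>k<n. Ch' k a b * f1' k) = (\<Sum>i<n. \<Sum>j<n. J i a * J j b * (\<Sum>k<n. Ch k i j * f1 k)) + (\<Sum>i<n. K i a b * f1 i)"
    unfolding Ch_f1(1) C_def[symmetric] by (simp add: sum_distrib_left mult.assoc)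
  moreover have "f2' a b = (\<Sum>i<n. K i a b * f1 i) + (\<Sum>i<n. \<Sum>j<n. J i a * J j b * f2 i j)"
  proof -
    have "f2' a b = (\<Sum>i<n. K i b a * f1 i) + (\<Sum>i<n. \<Sum>j<n. J i b * J j a * f2 j i)" by (rule f2'[OF ab(2,1)])
    also have "(\<Sum>i<n. \<Sum>j<n. J i b * J j a * f2 j i) = (\<Sum>i<n. \<Sum>j<n. J i a * J j b * f2 i j)"
      by (subst sum.swap) (simp add: mult_ac)
    also have "(\<Sum>i<n. K i b a * f1 i) = (\<Sum>i<n. K i a b * f1 i)"
      using ab by (intro sum.cong refl) (simp add: K_sym)
    finally show ?thesis .
  qed
  ultimately show ?thesis unfolding H'_def H_def by (simp add: right_diff_distrib sum_subtractf)
qed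

lemma gradient_norm_invariant: "(\<Sum>a<n. \<Sum>b<n. G' a b * f1' a * f1' b) = (\<Sum>i<n. \<Sum>j<n. G i j * f1 i * f1 j)"
proof -
  have "(\<Sum>a<n. \<Sum>b<n. G' a b * f1' a * f1' b) = (\<Sum>b<n. \<Sum>a<n. G' a b * f1' a * f1' b)" by (rule sum.swap)
  also have "\<dots> = (\<Sum>b<n. v' b * f1' b)" unfolding v'_def by (simp add: sum_distrib_right)
  also have "\<dots> = (\<Sum>b<n. \<Sum>i<n. f1 i * (J i b * v' b))"
    by (intro sum.cong refl) (simp add: f1' sum_distrib_left mult_ac)
  also have "\<dots> = (\<Sum>i<n. \<Sum>b<n. f1 i * (J i b * v' b))" by (rule sum.swap)
  also have "\<dots> = (\<Sum>i<n. f1 i * v i)" by (intro sum.cong refl) (simp add: sum_distrib_left[symmetric] J_v')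
  also have "\<dots> = (\<Sum>j<n. \<Sum>i<n. G i j * f1 i * f1 j)" unfolding v_def by (simp add: sum_distrib_left mult_ac)
  also have "\<dots> = (\<Sum>i<n. \<Sum>j<n. G i j * f1 i * f1 j)" by (rule sum.swap)
  finally show ?thesis .
qed

definition "E i k = (\<Sum>b<n. G i b * H b k)"
definition "E' i k = (\<Sum>b<n. G' i b * H' b k)"
text \<open>With this factor the endomorphisms are E = J X and E' = X J, so their traces, and those
  of their squares, agree by cyclicity.\<close>

definition "X a k = (\<Sum>b<n. \<Sum>j<n. G' a b * J j b * H j k)"

lemma E_X: "i < n \<Longrightarrow> E i k = (\<Sum>a<n. J i a * X a k)"
proof -
  assume i: "i < n"
  have "(\<Sum>a<n. J i a * X a k) = (\<Sum>a<n. \<Sum>b<n. \<Sum>j<n. J i a * G' a b * J j b * H j k)"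
    unfolding X_def by (simp add: sum_distrib_left mult_ac)
  also have "\<dots> = (\<Sum>a<n. \<Sum>j<n. \<Sum>b<n. J i a * G' a b * J j b * H j k)" by (intro sum.cong refl sum.swap)
  also have "\<dots> = (\<Sum>j<n. \<Sum>a<n. \<Sum>b<n. J i a * G' a b * J j b * H j k)" by (rule sum.swap)
  also have "\<dots> = E i k" unfolding E_def
    using i by (intro sum.cong refl) (simp add: JGJ[symmetric] sum_distrib_right)
  finally show ?thesis ..
qed

lemma E'_X: "b < n \<Longrightarrow> E' a b = (\<Sum>k<n. X a k * J k b)"
proof -
  assume b: "b < n"
  have "E' a b = (\<Sum>c<n. \<Sum>j<n. \<Sum>k<n. G' a c * J j c * H j k * J k b)"
    unfolding E'_def using b by (intro sum.cong refl) (simp add: Hess_transform sum_distrib_left mult_ac)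
  also have "\<dots> = (\<Sum>c<n. \<Sum>k<n. \<Sum>j<n. G' a c * J j c * H j k * J k b)" by (intro sum.cong refl sum.swap)
  also have "\<dots> = (\<Sum>k<n. \<Sum>c<n. \<Sum>j<n. G' a c * J j c * H j k * J k b)" by (rule sum.swap)
  also have "\<dots> = (\<Sum>k<n. X a k * J k b)" unfolding X_def by (simp add: sum_distrib_right)
  finally show ?thesis .
qed

lemma trace_invariant: "(\<Sum>a<n. E' a a) = (\<Sum>i<n. E i i)"
proof -
  have "(\<Sum>a<n. E' a a) = (\<Sum>a<n. \<Sum>k<n. X a k * J k a)" by (intro sum.cong refl) (simp add: E'_X)
  also have "\<dots> = (\<Sum>k<n. \<Sum>a<n. X a k * J k a)" by (rule sum.swap)
  also have "\<dots> = (\<Sum>i<n. E i i)" by (intro sum.cong refl) (simp add: E_X mult.commute)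
  finally show ?thesis .
qed

lemma trace_square_invariant: "(\<Sum>a<n. \<Sum>b<n. E' a b * E' b a) = (\<Sum>i<n. \<Sum>j<n. E i j * E j i)"
proof -
  have "(\<Sum>a<n. \<Sum>b<n. E' a b * E' b a) = (\<Sum>a<n. \<Sum>b<n. \<Sum>k<n. \<Sum>l<n. X a k * J k b * (X b l * J l a))"
    by (intro sum.cong refl) (simp add: E'_X sum_product)
  also have "\<dots> = (\<Sum>a<n. \<Sum>k<n. \<Sum>b<n. \<Sum>l<n. X a k * J k b * (X b l * J l a))" by (intro sum.cong refl sum.swap)
  also have "\<dots> = (\<Sum>a<n. \<Sum>k<n. \<Sum>l<n. \<Sum>b<n. X a k * J k b * (X b l * J l a))" by (intro sum.cong refl sum.swap)
  also have "\<dots> = (\<Sum>k<n. \<Sum>a<n. \<Sum>l<n. \<Sum>b<n. X a k * J k b * (X b l * J l a))" by (rule sum.swap)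
  also have "\<dots> = (\<Sum>k<n. \<Sum>l<n. \<Sum>a<n. \<Sum>b<n. X a k * J k b * (X b l * J l a))" by (intro sum.cong refl sum.swap)
  also have "\<dots> = (\<Sum>k<n. \<Sum>l<n. E k l * E l k)"
  proof (intro sum.cong refl)
    fix k l assume "k \<in> {..<n}" "l \<in> {..<n}"
    then have "E k l * E l k = (\<Sum>b<n. \<Sum>a<n. J k b * X b l * (J l a * X a k))"
      by (simp add: E_X sum_product)
    also have "\<dots> = (\<Sum>a<n. \<Sum>b<n. J k b * X b l * (J l a * X a k))" by (rule sum.swap)
    finally show "(\<Sum>a<n. \<Sum>b<n. X a k * J k b * (X b l * J l a)) = E k l * E l k" by (simp add: mult_ac)
  qed
  finally show ?thesis .
qed

end

context riemannian
begin

definition "lap_at c h x = (\<Sum>i<n. \<Sum>b<n. ginv_mat M c x $$ (i, b) * hessian M c h b i x)"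

definition "hess_sq c h x = (\<Sum>i<n. \<Sum>k<n. (\<Sum>b<n. ginv_mat M c x $$ (i, b) * hessian M c h b k x) *
  (\<Sum>b<n. ginv_mat M c x $$ (k, b) * hessian M c h b i x))"

definition "grad_sq c h x = (\<Sum>i<n. \<Sum>j<n. ginv_mat M c x $$ (i, j) *
  partial i (h \<circ> chart_inv c) x * partial j (h \<circ> chart_inv c) x)"

lemma smooth_in_chart:
  assumes "smooth_fun_on M (topspace (rtop M)) h" "c \<in> ratlas M"
  shows "smooth_on n (snd c ` fst c) (h \<circ> chart_inv c)"
proof -
  have eq: "fst c \<inter> topspace (rtop M) = fst c" using is_chart_facts(4)[OF chart[OF assms(2)]] by blast
  have "smooth_on n (snd c ` (fst c \<inter> topspace (rtop M))) (h \<circ> chart_inv c)"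
    using assms unfolding smooth_fun_on_def by (rule bspec)
  then show ?thesis unfolding eq .
qed

text \<open>The map \<tau> leads from \<open>d\<close>-coordinates to \<open>c\<close>-coordinates:
  unprimed data belong to \<open>c\<close>, primed data to \<open>d\<close>. The laws for first
  derivatives hold on the whole overlap and are differentiated once more at
  \<open>p\<close>.\<close>

lemma coordinate_change_charts:
  assumes c: "c \<in> ratlas M" and d: "d \<in> ratlas M" and p: "p \<in> fst c" "p \<in> fst d"
    and h: "smooth_fun_on M (topspace (rtop M)) h"
  shows "coordinate_change n (\<lambda>i a. partial a (transition d c i) (snd d p))
    (\<lambda>i a b. partial b (partial a (transition d c i)) (snd d p))
    (\<lambda>i j. gcomp M c i j (snd c p)) (\<lambda>i j. ginv_mat M c (snd c p) $$ (i, j))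
    (\<lambda>i j. gcomp M d i j (snd d p)) (\<lambda>i j. ginv_mat M d (snd d p) $$ (i, j))
    (\<lambda>k i j. partial k (gcomp M c i j) (snd c p)) (\<lambda>k i j. partial k (gcomp M d i j) (snd d p))
    (\<lambda>i. partial i (h \<circ> chart_inv c) (snd c p)) (\<lambda>i. partial i (h \<circ> chart_inv d) (snd d p))
    (\<lambda>i j. partial i (partial j (h \<circ> chart_inv c)) (snd c p))
    (\<lambda>i j. partial i (partial j (h \<circ> chart_inv d)) (snd d p))"
proof -
  define V where "V = snd d ` (fst d \<inter> fst c)"
  define \<tau> where "\<tau> x i = transition d c i x" for x i
  define x where "x = snd d p"
  have V: "openin (Euclidean_space n) V"
    unfolding V_def by (rule chart_image_open[OF chart[OF d] chart_open[OF c]])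
  have Uc: "openin (Euclidean_space n) (snd c ` fst c)" by (rule is_chart_facts(2)[OF chart[OF c]])
  have xV: "x \<in> V" using p by (auto simp: V_def x_def)
  have Vd: "y \<in> snd d ` fst d" if "y \<in> V" for y using that by (auto simp: V_def)
  have \<tau>: "\<tau> y = snd c (chart_inv d y)" for y by (simp add: \<tau>_def transition_def fun_eq_iff)
  have \<tau>U: "\<tau> y \<in> snd c ` fst c" if "y \<in> V" for y
    using that chart_inv_left[OF chart[OF d]] unfolding \<tau> V_def by auto
  have \<tau>x: "\<tau> x = snd c p" unfolding \<tau> x_def by (simp only: chart_inv_left[OF chart[OF d] p(2)])
  have \<tau>s: "smooth_on n V (transition d c i)" if "i < n" for i
    unfolding V_def by (rule transition_smooth[OF d c that])
  have \<tau>s': "smooth_on n V (\<lambda>y. \<tau> y i)" if "i < n" for i using \<tau>s[OF that] by (simp add: \<tau>_def)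
  have px: "snd c p \<in> snd c ` fst c" "x \<in> snd d ` fst d" using p by (auto simp: x_def)
  have tr: "(\<lambda>y. \<tau> y i) = transition d c i" for i by (simp add: \<tau>_def)
  have Jd: "((\<lambda>t. partial a (transition d c i) (x(e := t))) has_real_derivative
      partial e (partial a (transition d c i)) x) (at (x e))" if "i < n" "a < n" "e < n" for i a e
    by (rule smooth_on_has_partial[OF smooth_on_partial[OF \<tau>s[OF that(1)] that(2)] that(3) xV])
  have comp: "((\<lambda>t. F (\<tau> (x(e := t)))) has_real_derivative
      (\<Sum>k<n. partial k F (snd c p) * partial e (transition d c k) x)) (at (x e))"
    if F: "smooth_on n (snd c ` fst c) F" and e: "e < n" for F e
    using chain_partial(1)[OF V Uc F \<tau>s' \<tau>U xV e] unfolding \<tau>x tr .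
  have hc: "smooth_on n (snd c ` fst c) (h \<circ> chart_inv c)" by (rule smooth_in_chart[OF h c])
  have hd: "(h \<circ> chart_inv d) y = (h \<circ> chart_inv c) (\<tau> y)" if "y \<in> V" for y
    using that chart_inv_left[OF chart[OF d]] chart_inv_left[OF chart[OF c]] unfolding \<tau> V_def by auto
  have first: "partial a (h \<circ> chart_inv d) y = (\<Sum>i<n. partial a (transition d c i) y * partial i (h \<circ> chart_inv c) (\<tau> y))"
    if y: "y \<in> V" and a: "a < n" for y a
  proof -
    have "partial a (h \<circ> chart_inv d) y = partial a (\<lambda>y. (h \<circ> chart_inv c) (\<tau> y)) y"
      by (rule partial_cong[OF V y a hd])
    also have "\<dots> = (\<Sum>i<n. partial i (h \<circ> chart_inv c) (\<tau> y) * partial a (\<lambda>y. \<tau> y i) y)"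
      by (rule chain_partial(2)[OF V Uc hc \<tau>s' \<tau>U y a])
    finally show ?thesis unfolding tr by (simp only: mult.commute)
  qed
  show ?thesis unfolding x_def[symmetric]
  proof
    fix i j assume ij: "i < n" "j < n"
    show "gcomp M c i j (snd c p) = gcomp M c j i (snd c p)" by (rule gcomp_sym[OF c px(1) ij])
    show "ginv_mat M c (snd c p) $$ (i, j) = ginv_mat M c (snd c p) $$ (j, i)" by (rule ginv_sym[OF c px(1) ij])
    show "(\<Sum>k<n. gcomp M c i k (snd c p) * ginv_mat M c (snd c p) $$ (k, j)) = (if i = j then 1 else 0)"
      by (rule ginv_g(2)[OF c px(1) ij])
    show "(\<Sum>k<n. ginv_mat M d x $$ (i, k) * gcomp M d k j x) = (if i = j then 1 else 0)"
      by (rule ginv_g(1)[OF d px(2) ij])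
    show "partial i (partial j (h \<circ> chart_inv c)) (snd c p) = partial j (partial i (h \<circ> chart_inv c)) (snd c p)"
      by (rule partial_commute[OF Uc hc px(1) ij])
  next
    fix i a b assume "i < n" "a < n" "b < n"
    then show "partial b (partial a (transition d c i)) x = partial a (partial b (transition d c i)) x"
      by (intro partial_commute[OF V \<tau>s xV])
  next
    fix a b assume ab: "a < n" "b < n"
    show "gcomp M d a b x = (\<Sum>i<n. \<Sum>j<n. partial a (transition d c i) x * partial b (transition d c j) x * gcomp M c i j (snd c p))"
      using gcomp_transform[OF c d xV[unfolded V_def] ab] unfolding \<tau>[symmetric] \<tau>x .
  next
    fix e a b assume eab: "e < n" "a < n" "b < n"
    let ?J = "\<lambda>i a y. partial a (transition d c i) y"
    have "partial e (gcomp M d a b) x = partial e (\<lambda>y. \<Sum>i<n. \<Sum>j<n. ?J i a y * ?J j b y * gcomp M c i j (\<tau> y)) x"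
      by (rule partial_cong[OF V xV eab(1)]) (use gcomp_transform[OF c d _ eab(2,3)] in \<open>simp only: \<tau> V_def\<close>)
    also have "\<dots> = (\<Sum>i<n. \<Sum>j<n. (partial e (?J i a) x * ?J j b (x(e := x e)) + partial e (?J j b) x * ?J i a (x(e := x e)))
        * gcomp M c i j (\<tau> (x(e := x e)))
        + (\<Sum>k<n. partial k (gcomp M c i j) (snd c p) * ?J k e x) * (?J i a (x(e := x e)) * ?J j b (x(e := x e))))"
      by (rule partialI, intro DERIV_sum DERIV_mult Jd comp gcomp_smooth[OF c] eab) simp_all
    also have "\<dots> = (\<Sum>i<n. \<Sum>j<n. partial e (?J i a) x * ?J j b x * gcomp M c i j (snd c p) + ?J i a x * partial e (?J j b) x * gcomp M c i j (snd c p)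
      + ?J i a x * ?J j b x * (\<Sum>k<n. partial k (gcomp M c i j) (snd c p) * ?J k e x))"
      unfolding fun_upd_triv \<tau>x by (intro sum.cong refl) (simp only: distrib_left distrib_right mult_ac)
    finally show "partial e (gcomp M d a b) x = \<dots>" .
  next
    fix a assume "a < n"
    then show "partial a (h \<circ> chart_inv d) x = (\<Sum>i<n. partial a (transition d c i) x * partial i (h \<circ> chart_inv c) (snd c p))"
      using first[OF xV] unfolding \<tau>x by simp
  next
    fix a b assume ab: "a < n" "b < n"
    let ?J = "\<lambda>i a y. partial a (transition d c i) y"
    let ?f = "\<lambda>i y. partial i (h \<circ> chart_inv c) y"
    have "partial b (partial a (h \<circ> chart_inv d)) x = partial b (\<lambda>y. \<Sum>i<n. ?J i a y * ?f i (\<tau> y)) x"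
      by (rule partial_cong[OF V xV ab(2) first[OF _ ab(1)]])
    also have "\<dots> = (\<Sum>i<n. partial b (?J i a) x * ?f i (\<tau> (x(b := x b)))
        + (\<Sum>k<n. partial k (?f i) (snd c p) * ?J k b x) * ?J i a (x(b := x b)))"
      by (rule partialI, intro DERIV_sum DERIV_mult Jd comp smooth_on_partial[OF hc] ab) simp_all
    also have "\<dots> = (\<Sum>i<n. partial b (?J i a) x * ?f i (snd c p)) + (\<Sum>i<n. \<Sum>j<n. ?J i a x * ?J j b x * partial j (?f i) (snd c p))"
      unfolding fun_upd_triv \<tau>x by (simp add: sum.distrib sum_distrib_left sum_distrib_right mult_ac)
    finally show "partial b (partial a (h \<circ> chart_inv d)) x = \<dots>" .
  qed
qed

lemma chart_invariance:
  assumes c: "c \<in> ratlas M" and d: "d \<in> ratlas M" and p: "p \<in> fst c" "p \<in> fst d"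
    and h: "smooth_fun_on M (topspace (rtop M)) h"
  shows "lap_at d h (snd d p) = lap_at c h (snd c p)" "hess_sq d h (snd d p) = hess_sq c h (snd c p)"
    "grad_sq d h (snd d p) = grad_sq c h (snd c p)"
proof -
  interpret cc: coordinate_change n "\<lambda>i a. partial a (transition d c i) (snd d p)"
    "\<lambda>i a b. partial b (partial a (transition d c i)) (snd d p)"
    "\<lambda>i j. gcomp M c i j (snd c p)" "\<lambda>i j. ginv_mat M c (snd c p) $$ (i, j)"
    "\<lambda>i j. gcomp M d i j (snd d p)" "\<lambda>i j. ginv_mat M d (snd d p) $$ (i, j)"
    "\<lambda>k i j. partial k (gcomp M c i j) (snd c p)" "\<lambda>k i j. partial k (gcomp M d i j) (snd d p)"
    "\<lambda>i. partial i (h \<circ> chart_inv c) (snd c p)" "\<lambda>i. partial i (h \<circ> chart_inv d) (snd d p)"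
    "\<lambda>i j. partial i (partial j (h \<circ> chart_inv c)) (snd c p)"
    "\<lambda>i j. partial i (partial j (h \<circ> chart_inv d)) (snd d p)"
    by (rule coordinate_change_charts[OF assms])
  have H: "cc.H i j = hessian M c h i j (snd c p)" "cc.H' i j = hessian M d h i j (snd d p)" for i j
    by (simp_all only: cc.H_def cc.H'_def cc.Ch_def cc.Ch'_def hessian_def christoffel_def)
  show "lap_at d h (snd d p) = lap_at c h (snd c p)"
    using cc.trace_invariant by (simp only: lap_at_def cc.E_def cc.E'_def H)
  show "hess_sq d h (snd d p) = hess_sq c h (snd c p)"
    using cc.trace_square_invariant by (simp only: hess_sq_def cc.E_def cc.E'_def H)
  show "grad_sq d h (snd d p) = grad_sq c h (snd c p)"
    using cc.gradient_norm_invariant by (simp only: grad_sq_def)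
qed

end

section \<open>The maximum principle in a chart\<close>

context riem_chart
begin

text \<open>With \<eta> the vector obtained from \<xi> by raising the index, the value is that of
  the metric at \<eta>.\<close>

lemma ginv_nonneg:
  assumes x: "x \<in> U"
  shows "(\<Sum>i<n. \<Sum>j<n. \<xi> i * \<xi> j * gi i j x) \<ge> 0"
proof -
  define \<eta> where "\<eta> i = (\<Sum>j<n. gi i j x * \<xi> j)" for i
  have g\<eta>: "(\<Sum>j<n. gcomp M c i j x * \<eta> j) = \<xi> i" if i: "i < n" for i
  proof -
    have "(\<Sum>j<n. gcomp M c i j x * \<eta> j) = (\<Sum>j<n. \<Sum>k<n. gcomp M c i j x * gi j k x * \<xi> k)"
      unfolding \<eta>_def by (simp add: sum_distrib_left mult_ac)
    also have "\<dots> = (\<Sum>k<n. (\<Sum>j<n. gcomp M c i j x * gi j k x) * \<xi> k)"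
      unfolding sum_distrib_right by (rule sum.swap)
    also have "\<dots> = (\<Sum>k<n. (if i = k then 1 else 0) * \<xi> k)"
      by (intro sum.cong refl) (simp only: ginv_g(2)[OF c x i] lessThan_iff)
    also have "\<dots> = \<xi> i" by (rule sum_delta_left[OF i])
    finally show ?thesis .
  qed
  have "(\<Sum>i<n. \<Sum>j<n. \<eta> i * \<eta> j * gcomp M c i j x) = (\<Sum>i<n. \<eta> i * (\<Sum>j<n. gcomp M c i j x * \<eta> j))"
    by (simp add: sum_distrib_left mult_ac)
  also have "\<dots> = (\<Sum>i<n. \<eta> i * \<xi> i)" by (intro sum.cong refl) (simp only: g\<eta> lessThan_iff)
  also have "\<dots> = (\<Sum>i<n. \<Sum>j<n. \<xi> i * \<xi> j * gi i j x)"
    unfolding \<eta>_def by (simp add: sum_distrib_left sum_distrib_right mult_ac)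
  finally have eq: "(\<Sum>i<n. \<Sum>j<n. \<eta> i * \<eta> j * gcomp M c i j x) = (\<Sum>i<n. \<Sum>j<n. \<xi> i * \<xi> j * gi i j x)" .
  show ?thesis
  proof (cases "\<exists>i<n. \<eta> i \<noteq> 0")
    case True
    then show ?thesis using gcomp_pos[OF c x True] eq by simp
  next
    case False
    then have "(\<Sum>i<n. \<Sum>j<n. \<eta> i * \<eta> j * gcomp M c i j x) = 0" by (intro sum.neutral ballI) auto
    then show ?thesis using eq by simp
  qed
qed

lemma G0_gi: "i < n \<Longrightarrow> j < n \<Longrightarrow> x \<in> U \<Longrightarrow> G0 i j x = gi i j x"
  by (simp add: G0_def)

lemma ip_apply: "alg.ip \<phi> \<psi> x = (\<Sum>a<n. \<Sum>b<n. G0 a b x * pd b \<phi> x * pd a \<psi> x)"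
  unfolding alg.ip_def alg.grad_def by (simp add: sum_fun_apply sum_distrib_right)

lemma lap_apply: "alg.lap \<phi> x = (\<Sum>i<n. \<Sum>b<n. G0 i b x * (pd b (pd i \<phi>) x - (\<Sum>k<n. \<Gamma>0 k b i x * pd k \<phi> x)))"
  unfolding alg.lap_def alg.A_def alg.Hess_def by (simp add: sum_fun_apply)

lemma ip_scale:
  assumes "\<And>i. i < n \<Longrightarrow> pd i \<phi> x = s * pd i \<alpha> x" "\<And>i. i < n \<Longrightarrow> pd i \<psi> x = t * pd i \<beta> x"
  shows "alg.ip \<phi> \<psi> x = s * t * alg.ip \<alpha> \<beta> x"
  unfolding ip_apply sum_distrib_left by (intro sum.cong refl) (simp add: assms)

lemma ip_nonneg:
  assumes "x \<in> U"
  shows "alg.ip \<phi> \<phi> x \<ge> 0"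
proof -
  have "alg.ip \<phi> \<phi> x = (\<Sum>a<n. \<Sum>b<n. pd a \<phi> x * pd b \<phi> x * gi a b x)"
    unfolding ip_apply by (intro sum.cong refl) (simp add: G0_gi assms)
  then show ?thesis using ginv_nonneg[OF assms] by simp
qed

text \<open>At a critical point the Christoffel terms disappear, and the Laplacian is the trace of
  the positive inverse metric against the nonpositive matrix of second derivatives.\<close>

lemma max_principle:
  assumes \<phi>: "\<phi> \<in> smooths" and x: "x \<in> U" and mx: "\<And>y. y \<in> U \<Longrightarrow> \<phi> y \<le> \<phi> x"
  shows "pd i \<phi> x = 0" "alg.lap \<phi> x \<le> 0"
proof -
  have p0: "pd i \<phi> x = 0" for i
    using partial_zero_at_max[OF U smoothsD[OF \<phi>] x mx, of i] by (simp add: pd_def)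
  then show "pd i \<phi> x = 0" .
  have "(\<Sum>i<n. \<Sum>j<n. gi i j x * partial j (partial i \<phi>) x) \<le> 0"
  proof (rule trace_psd_nsd_nonpos)
    show "gi i j x = gi j i x" if "i < n" "j < n" for i j by (rule ginv_sym[OF c x that])
    show "(\<Sum>i<n. \<Sum>j<n. \<xi> i * \<xi> j * gi i j x) \<ge> 0" for \<xi> by (rule ginv_nonneg[OF x])
    show "(\<Sum>i<n. \<Sum>j<n. \<xi> i * \<xi> j * partial j (partial i \<phi>) x) \<le> 0" for \<xi>
      using hessian_nonpos_at_max[OF U smoothsD[OF \<phi>] x mx, of \<xi>] by (simp only: mult_ac)
  qed
  moreover have "alg.lap \<phi> x = (\<Sum>i<n. \<Sum>j<n. gi i j x * partial j (partial i \<phi>) x)"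
  proof -
    have "pd b (pd i \<phi>) x = partial b (partial i \<phi>) x" if "b < n" "i < n" for b i
      unfolding pd_apply[OF that(1) x] by (rule partial_cong[OF U x that(1)]) (rule pd_apply[OF that(2)])
    then show ?thesis unfolding lap_apply by (intro sum.cong refl) (simp add: p0 G0_gi x)
  qed
  ultimately show "alg.lap \<phi> x \<le> 0" by simp
qed

lemma smooths_lin: "\<phi> \<in> smooths \<Longrightarrow> \<psi> \<in> smooths \<Longrightarrow> (\<lambda>x. a * \<phi> x + b * \<psi> x) \<in> smooths"
  unfolding smooths_def mem_Collect_eq by (intro smooth_on_add[OF U] smooth_on_mult[OF U] smooth_on_const[OF U])

lemma pd_lin:
  assumes "\<phi> \<in> smooths" "\<psi> \<in> smooths"
  shows "pd i (\<lambda>x. a * \<phi> x + b * \<psi> x) = (\<lambda>x. a * pd i \<phi> x + b * pd i \<psi> x)"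
proof -
  have "pd i ((\<lambda>_. a) * \<phi> + (\<lambda>_. b) * \<psi>) = (\<lambda>_. 0) * \<phi> + (\<lambda>_. a) * pd i \<phi> + ((\<lambda>_. 0) * \<psi> + (\<lambda>_. b) * pd i \<psi>)"
    using assms by (simp add: smooths_const pd_const)
  then show ?thesis by (simp add: plus_fun_def times_fun_def)
qed

lemma lap_lin:
  assumes "\<phi> \<in> smooths" "\<psi> \<in> smooths"
  shows "alg.lap (\<lambda>x. a * \<phi> x + b * \<psi> x) x = a * alg.lap \<phi> x + b * alg.lap \<psi> x"
proof -
  have "pd j (pd i (\<lambda>x. a * \<phi> x + b * \<psi> x)) = (\<lambda>x. a * pd j (pd i \<phi>) x + b * pd j (pd i \<psi>) x)" for i j
    unfolding pd_lin[OF assms] by (rule pd_lin) (simp_all add: assms)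
  then show ?thesis
    unfolding lap_apply pd_lin[OF assms] sum_distrib_left sum.distrib[symmetric]
    by (intro sum.cong refl) (simp add: algebra_simps sum.distrib sum_distrib_left)
qed

lemma lap_const: "alg.lap (\<lambda>_. k) x = 0"
  unfolding lap_apply by (simp add: pd_const)

lemma smooths_ln: "\<psi> \<in> smooths \<Longrightarrow> (\<And>x. x \<in> U \<Longrightarrow> \<psi> x > 0) \<Longrightarrow> (\<lambda>x. ln (\<psi> x)) \<in> smooths"
  unfolding smooths_def mem_Collect_eq by (rule smooth_on_ln[OF U])

lemma pd_ln:
  assumes \<psi>: "\<psi> \<in> smooths" and pos: "\<And>x. x \<in> U \<Longrightarrow> \<psi> x > 0"
  shows "pd i (\<lambda>x. ln (\<psi> x)) = (\<lambda>x. pd i \<psi> x * inverse (\<psi> x))"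
proof
  fix x
  show "pd i (\<lambda>x. ln (\<psi> x)) x = pd i \<psi> x * inverse (\<psi> x)"
  proof (cases "i < n \<and> x \<in> U")
    case True
    then have "partial i (\<lambda>x. ln (\<psi> x)) x = partial i \<psi> x * inverse (\<psi> x)"
      by (intro partial_ln smooth_on_differentiable[OF smoothsD[OF \<psi>]] pos) auto
    then show ?thesis using True by (simp add: pd_def)
  qed (auto simp: pd_def)
qed

lemma lap_ln:
  assumes \<psi>: "\<psi> \<in> smooths" and pos: "\<And>x. x \<in> U \<Longrightarrow> \<psi> x > 0" and x: "x \<in> U"
  shows "alg.lap (\<lambda>x. ln (\<psi> x)) x = alg.lap \<psi> x / \<psi> x - alg.ip \<psi> \<psi> x / (\<psi> x)\<^sup>2"
proof -
  have nz: "\<psi> x \<noteq> 0" if "x \<in> U" for x using pos[OF that] by simp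
  have pl: "pd i (\<lambda>x. ln (\<psi> x)) = (\<lambda>x. pd i \<psi> x * inverse (\<psi> x))" for i by (rule pd_ln[OF \<psi> pos])
  have inv: "(\<lambda>x. inverse (\<psi> x)) \<in> smooths"
    unfolding smooths_def mem_Collect_eq by (rule smooth_on_inverse[OF U smoothsD[OF \<psi>] nz])
  have dd: "pd j (pd i (\<lambda>x. ln (\<psi> x))) x = pd j (pd i \<psi>) x * inverse (\<psi> x) - pd i \<psi> x * (pd j \<psi> x * (inverse (\<psi> x) * inverse (\<psi> x)))" for i j
  proof -
    have "pd j (pd i \<psi> * (\<lambda>x. inverse (\<psi> x))) x = (pd j (pd i \<psi>) * (\<lambda>x. inverse (\<psi> x)) + pd i \<psi> * pd j (\<lambda>x. inverse (\<psi> x))) x"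
      by (subst pd_mult) (simp_all add: \<psi> inv)
    moreover have "pd j (\<lambda>x. inverse (\<psi> x)) x = - (pd j \<psi> x * (inverse (\<psi> x) * inverse (\<psi> x)))"
    proof (cases "j < n")
      case True
      have "partial j (\<lambda>x. inverse (\<psi> x)) x = - (partial j \<psi> x * (inverse (\<psi> x) * inverse (\<psi> x)))"
        by (rule partial_inverse[OF smooth_on_differentiable[OF smoothsD[OF \<psi>] True x] nz[OF x]])
      then show ?thesis using True x by (simp add: pd_def)
    qed (simp add: pd_def)
    ultimately show ?thesis unfolding pl by (simp add: times_fun_def)
  qed
  have "alg.lap (\<lambda>x. ln (\<psi> x)) x = (\<Sum>i<n. \<Sum>b<n. G0 i b x * (pd b (pd i \<psi>) x - (\<Sum>k<n. \<Gamma>0 k b i x * pd k \<psi> x)) * inverse (\<psi> x)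
      - G0 i b x * pd b \<psi> x * pd i \<psi> x * (inverse (\<psi> x) * inverse (\<psi> x)))"
    unfolding lap_apply dd unfolding pl
    by (intro sum.cong refl) (simp add: algebra_simps sum_distrib_left)
  also have "\<dots> = alg.lap \<psi> x * inverse (\<psi> x) - alg.ip \<psi> \<psi> x * (inverse (\<psi> x) * inverse (\<psi> x))"
    unfolding lap_apply ip_apply by (simp only: sum_subtractf sum_distrib_right)
  finally show ?thesis by (simp add: divide_inverse power2_eq_square)
qed

lemma lap_lap_at:
  assumes "x \<in> U"
  shows "alg.lap (h \<circ> chart_inv c) x = lap_at c h x"
  unfolding lap_at_def alg.lap_def alg.A_def
  using assms by (simp add: sum_fun_apply alg_Hess G0_gi)

lemma A_apply:
  assumes "x \<in> U" "i < n" "k < n"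
  shows "alg.A (h \<circ> chart_inv c) i k x = (\<Sum>b<n. gi i b x * hessian M c h b k x)"
  unfolding alg.A_def using assms by (simp add: sum_fun_apply alg_Hess G0_gi)

lemma ip_grad_sq:
  assumes "x \<in> U"
  shows "alg.ip (h \<circ> chart_inv c) (h \<circ> chart_inv c) x = grad_sq c h x"
  unfolding grad_sq_def ip_apply using assms by (intro sum.cong refl) (simp add: G0_gi pd_apply mult_ac)

lemma hessian_sym:
  assumes h: "h \<circ> chart_inv c \<in> smooths" and x: "x \<in> U" "i < n" "j < n"
  shows "hessian M c h i j x = hessian M c h j i x"
  using alg.Hess_sym[OF h, of i j] alg_Hess[OF x] alg_Hess[OF x(1,3,2)] by metis

lemma hess_sq_nonneg:
  assumes h: "h \<circ> chart_inv c \<in> smooths" and x: "x \<in> U"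
  shows "hess_sq c h x \<ge> 0"
  unfolding hess_sq_def
  by (rule trace_square_nonneg) (rule ginv_sym[OF c x] hessian_sym[OF h x] ginv_nonneg[OF x]; assumption)+

end

section \<open>Gradient solitons in a chart\<close>

locale soliton_chart = riem_chart M c for M :: "'a riem" and c +
  fixes f :: "'a \<Rightarrow> real" and lam :: real
  assumes sol: "gradient_ricci_soliton M f lam"
begin

abbreviation "F \<equiv> f \<circ> chart_inv c"

text \<open>The cutoff is needed for the soliton equation to hold as an equation of functions:
  outside \<open>U\<close> both \<open>alg.P\<close> and \<open>alg.A\<close> vanish.\<close>

definition "lam0 = (\<lambda>x. if x \<in> U then lam else 0)"

lemma smooth_f: "smooth_fun_on M (topspace (rtop M)) f"
  using sol by (simp add: gradient_ricci_soliton_def)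

lemma F_smooths: "F \<in> smooths"
  unfolding smooths_def mem_Collect_eq by (rule smooth_in_chart[OF smooth_f c])

lemma ricci_soliton: "x \<in> U \<Longrightarrow> i < n \<Longrightarrow> j < n \<Longrightarrow> ricci M c i j x = lam * gcomp M c i j x - hessian M c f i j x"
proof -
  assume x: "x \<in> U" and i: "i < n" and j: "j < n"
  have "\<forall>c\<in>ratlas M. \<forall>x\<in>snd c ` fst c. \<forall>i<n. \<forall>j<n. hessian M c f i j x + ricci M c i j x = lam * gcomp M c i j x"
    using sol unfolding gradient_ricci_soliton_def by blast
  then have "hessian M c f i j x + ricci M c i j x = lam * gcomp M c i j x" using c x i j by blast
  then show ?thesis by simp
qed

lemma P_soliton:
  assumes im: "i < n" "m < n"
  shows "alg.P i m = (if i = m then lam0 else 0) - alg.A F m i"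
proof
  fix x
  show "alg.P i m x = ((if i = m then lam0 else 0) - alg.A F m i) x"
  proof (cases "x \<in> U")
    case True
    have "alg.P i m x = (\<Sum>l<n. \<Sum>k<n. curvature M c l l i k x * gi k m x)"
      unfolding alg.P_def alg.Q_def using True im by (simp add: sum_fun_apply alg_Rm G0_gi)
    also have "\<dots> = (\<Sum>k<n. ricci M c i k x * gi k m x)"
      unfolding ricci_def sum_distrib_right by (rule sum.swap)
    also have "\<dots> = (\<Sum>k<n. lam * (gcomp M c i k x * gi k m x) - gi m k x * hessian M c f k i x)"
    proof (rule sum.cong[OF refl])
      fix k assume "k \<in> {..<n}"
      then have k: "k < n" by simp
      show "ricci M c i k x * gi k m x = lam * (gcomp M c i k x * gi k m x) - gi m k x * hessian M c f k i x"
        unfolding ricci_soliton[OF True im(1) k] hessian_sym[OF F_smooths True im(1) k] ginv_sym[OF c True k im(2)]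
        by (simp add: algebra_simps)
    qed
    also have "\<dots> = lam * (if i = m then 1 else 0) - alg.A F m i x"
      unfolding sum_subtractf sum_distrib_left[symmetric] A_apply[OF True im(2,1)] ginv_g(2)[OF c True im] ..
    finally show ?thesis using True by (simp add: lam0_def)
  next
    case False
    then have "alg.P i m x = 0" unfolding alg.P_def alg.Q_def by (simp add: sum_fun_apply G0_def)
    moreover have "alg.A F m i x = 0" using False unfolding alg.A_def by (simp add: sum_fun_apply G0_def)
    ultimately show ?thesis using False by (simp add: lam0_def)
  qed
qed

sublocale sol: soliton_algebra smooths pd n G0 \<Gamma>0 F lam0
proof
  show "F \<in> smooths" by (rule F_smooths)
  show "lam0 \<in> smooths" by (rule smooths_cong[OF smooth_on_const[OF U, of lam]]) (simp add: lam0_def)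
  show "pd i lam0 = 0" for i
  proof -
    have "pd i lam0 = pd i (\<lambda>_. lam)" by (rule pd_cong) (simp add: lam0_def)
    then show ?thesis by (simp add: pd_const zero_fun_def)
  qed
  show "alg.P i m = (if i = m then lam0 else 0) - alg.A F m i" if "i < n" "m < n" for i m by (rule P_soliton[OF that])
qed

lemma lap_lap_soliton:
  assumes x: "x \<in> U"
  shows "alg.lap (alg.lap F) x = 2 * hess_sq c f x - 2 * lam * lap_at c f x + alg.ip F (alg.lap F) x"
proof -
  have "(\<Sum>i<n. \<Sum>k<n. alg.A F i k * alg.A F k i) x = hess_sq c f x"
    unfolding hess_sq_def sum_fun_apply times_fun_apply by (intro sum.cong refl) (simp add: A_apply x)
  then show ?thesis
    unfolding sol.lap_lap using x by (simp add: lap_lap_at lam0_def)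
qed

lemma conserved:
  assumes "k < n" "x \<in> U"
  shows "partial k (\<lambda>x. grad_sq c f x - lap_at c f x - 2 * lam * f (chart_inv c x)) x = 0"
proof -
  have "partial k (\<lambda>x. grad_sq c f x - lap_at c f x - 2 * lam * f (chart_inv c x)) x =
      partial k (alg.ip F F - alg.lap F - (lam0 * F + lam0 * F)) x"
    by (rule partial_cong[OF U assms(2,1)]) (simp add: ip_grad_sq lap_lap_at lam0_def)
  also have "\<dots> = pd k (alg.ip F F - alg.lap F - (lam0 * F + lam0 * F)) x" using assms by (simp add: pd_def)
  also have "\<dots> = 0" unfolding sol.conservation[OF assms(1)] by simp
  finally show ?thesis .
qed

lemma lap_at_smooth: "smooth_on n U (lap_at c f)"
  by (rule smooth_on_cong[OF U smoothsD[OF alg.S_lap[OF F_smooths]]]) (rule lap_lap_at)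

lemma grad_sq_smooth: "smooth_on n U (grad_sq c f)"
  by (rule smooth_on_cong[OF U smoothsD[OF alg.S_ip[OF F_smooths F_smooths]]]) (rule ip_grad_sq)

lemma conserved_smooth: "smooth_on n U (\<lambda>x. grad_sq c f x - lap_at c f x - 2 * lam * f (chart_inv c x))"
  using smoothsD[OF F_smooths]
  by (intro smooth_on_diff[OF U] grad_sq_smooth lap_at_smooth smooth_on_mult[OF U] smooth_on_const[OF U]) (simp add: o_def)

lemma lap_at_max:
  assumes "x \<in> U" "\<And>y. y \<in> U \<Longrightarrow> f (chart_inv c y) \<le> f (chart_inv c x)"
  shows "lap_at c f x \<le> 0"
  using max_principle(2)[OF F_smooths assms(1)] assms lap_lap_at[OF assms(1)] by simp

lemma lap_at_min:
  assumes x: "x \<in> U" and mn: "\<And>y. y \<in> U \<Longrightarrow> f (chart_inv c x) \<le> f (chart_inv c y)"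
  shows "lap_at c f x \<ge> 0"
proof -
  \<comment> \<open>The maximum principle for - f, written as a linear combination to fit
    \<open>lap_lin\<close>.\<close>
  have "alg.lap (\<lambda>x. (-1) * F x + 0 * F x) x \<le> 0"
    by (rule max_principle(2)[OF smooths_lin[OF F_smooths F_smooths] x]) (use mn in simp)
  then show ?thesis unfolding lap_lin[OF F_smooths F_smooths] using lap_lap_at[OF x] by simp
qed

text \<open>The gradient term of \<open>lap_lap_soliton\<close> vanishes at the maximum, which
  leaves u (u - lam) <= 0.\<close>

lemma lap_at_bound_at_max:
  assumes x: "x \<in> U" and mx: "\<And>y. y \<in> U \<Longrightarrow> lap_at c f y \<le> lap_at c f x"
    and sq: "hess_sq c f x \<ge> (lap_at c f x)\<^sup>2" and lam: "lam > 0"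
  shows "lap_at c f x \<le> lam"
proof -
  have mx': "alg.lap F y \<le> alg.lap F x" if "y \<in> U" for y using mx[OF that] by (simp add: lap_lap_at that x)
  have S: "alg.lap F \<in> smooths" by (rule alg.S_lap[OF F_smooths])
  have "alg.ip F (alg.lap F) x = 0"
    unfolding ip_apply by (simp add: max_principle(1)[OF S x mx'])
  then have "2 * hess_sq c f x - 2 * lam * lap_at c f x \<le> 0"
    using max_principle(2)[OF S x mx'] lap_lap_soliton[OF x] by simp
  then have *: "lap_at c f x * (lap_at c f x - lam) \<le> 0" using sq by (simp add: power2_eq_square algebra_simps)
  show ?thesis
  proof (rule ccontr)
    assume "\<not> ?thesis"
    then have "lap_at c f x * (lap_at c f x - lam) > 0" using lam by (intro mult_pos_pos) auto
    then show False using * by simp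
  qed
qed

definition "pot \<kappa> x = (3/2) * (f (chart_inv c x) + \<kappa>) - (1/2) * ln (1 + (f (chart_inv c x) + \<kappa>)) - ln (2 * lam - lap_at c f x)"

text \<open>At a maximum of \<open>pot\<close> with \<open>t = f + \<kappa>\<close>, \<open>u = \<Delta>f\<close>, \<open>v = 2\<lambda> - u\<close>, \<open>w = |\<nabla>f|\<^sup>2\<close> one has \<open>\<nabla>u = - v p \<nabla>f\<close> where
  \<open>p = 3/2 - 1/(2(1 + t))\<close>, so \<open>v \<Delta>pot\<close> is an expression in \<open>u\<close>, \<open>w\<close> and \<open>t\<close>.\<close>

lemma pot_max:
  assumes x: "x \<in> U" and mx: "\<And>y. y \<in> U \<Longrightarrow> pot \<kappa> y \<le> pot \<kappa> x"
    and pos: "\<And>y. y \<in> U \<Longrightarrow> 1 + (f (chart_inv c y) + \<kappa>) > 0" "\<And>y. y \<in> U \<Longrightarrow> 2 * lam - lap_at c f y > 0"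
  defines "t \<equiv> f (chart_inv c x) + \<kappa>" and "u \<equiv> lap_at c f x" and "w \<equiv> grad_sq c f x"
  defines "p \<equiv> 3/2 - 1 / (2 * (1 + t))"
  shows "(2 * lam - u) * (p * u + w / (2 * (1 + t)\<^sup>2) + p\<^sup>2 * w - p * w) + 2 * hess_sq c f x - 2 * lam * u \<le> 0"
proof -
  \<comment> \<open>\<alpha> = 1 + t and \<beta> = v are the arguments of the two logarithms, again
    written as linear combinations.\<close>
  define \<alpha> where "\<alpha> x = 1 * F x + (1 + \<kappa>) * (\<lambda>_. 1) x" for x
  define \<beta> where "\<beta> x = (-1) * alg.lap F x + (2 * lam) * (\<lambda>_. 1) x" for x
  have LS: "alg.lap F \<in> smooths" by (rule alg.S_lap[OF F_smooths])
  have one: "(\<lambda>_. 1) \<in> smooths" by (rule smooths_const)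
  have \<alpha>S: "\<alpha> \<in> smooths" unfolding \<alpha>_def[abs_def] by (rule smooths_lin[OF F_smooths one])
  have \<beta>S: "\<beta> \<in> smooths" unfolding \<beta>_def[abs_def] by (rule smooths_lin[OF LS one])
  have \<alpha>p: "\<alpha> y > 0" if "y \<in> U" for y using pos(1)[OF that] by (simp add: \<alpha>_def)
  have \<beta>p: "\<beta> y > 0" if "y \<in> U" for y using pos(2)[OF that] by (simp add: \<beta>_def lap_lap_at that)
  have ln\<alpha>: "(\<lambda>x. ln (\<alpha> x)) \<in> smooths" by (rule smooths_ln[OF \<alpha>S \<alpha>p])
  have ln\<beta>: "(\<lambda>x. ln (\<beta> x)) \<in> smooths" by (rule smooths_ln[OF \<beta>S \<beta>p])
  define \<gamma> where "\<gamma> x = (-1/2) * ln (\<alpha> x) + (-1) * ln (\<beta> x)" for x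
  have \<gamma>S: "\<gamma> \<in> smooths" unfolding \<gamma>_def[abs_def] by (rule smooths_lin[OF ln\<alpha> ln\<beta>])
  define \<Phi> where "\<Phi> x = (3/2) * F x + 1 * \<gamma> x" for x
  have \<Phi>S: "\<Phi> \<in> smooths" unfolding \<Phi>_def[abs_def] by (rule smooths_lin[OF F_smooths \<gamma>S])
  \<comment> \<open>The two functions differ by a constant, so they have the same maxima.\<close>
  have \<Phi>pot: "\<Phi> y = pot \<kappa> y - (3/2) * \<kappa>" if "y \<in> U" for y
    unfolding \<Phi>_def \<gamma>_def \<alpha>_def \<beta>_def pot_def by (simp add: lap_lap_at that algebra_simps)
  have mx\<Phi>: "\<Phi> y \<le> \<Phi> x" if "y \<in> U" for y using mx[OF that] by (simp add: \<Phi>pot that x)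
  define a where "a = \<alpha> x"
  define v where "v = \<beta> x"
  have a: "a = 1 + t" "a > 0" using \<alpha>p[OF x] by (simp_all add: a_def \<alpha>_def t_def)
  have v: "v = 2 * lam - u" "v > 0" using \<beta>p[OF x] by (simp_all add: v_def \<beta>_def u_def lap_lap_at x)
  have pd\<alpha>: "pd i \<alpha> x = pd i F x" for i unfolding \<alpha>_def[abs_def] pd_lin[OF F_smooths one] by (simp add: pd_const)
  have pd\<beta>: "pd i \<beta> x = - pd i (alg.lap F) x" for i unfolding \<beta>_def[abs_def] pd_lin[OF LS one] by (simp add: pd_const)
  have pln: "pd i (\<lambda>x. ln (\<alpha> x)) x = pd i F x / a" "pd i (\<lambda>x. ln (\<beta> x)) x = - pd i (alg.lap F) x / v" for i
    using pd_ln[OF \<alpha>S \<alpha>p, of i] pd_ln[OF \<beta>S \<beta>p, of i] by (simp_all add: pd\<alpha> pd\<beta> a_def v_def divide_inverse)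
  have pd\<gamma>: "pd i \<gamma> = (\<lambda>x. (-1/2) * pd i (\<lambda>x. ln (\<alpha> x)) x + (-1) * pd i (\<lambda>x. ln (\<beta> x)) x)" for i
    unfolding \<gamma>_def[abs_def] by (rule pd_lin[OF ln\<alpha> ln\<beta>])
  have pd\<Phi>: "pd i \<Phi> = (\<lambda>x. (3/2) * pd i F x + 1 * pd i \<gamma> x)" for i
    unfolding \<Phi>_def[abs_def] by (rule pd_lin[OF F_smooths \<gamma>S])
  have lap\<gamma>: "alg.lap \<gamma> x = (-1/2) * alg.lap (\<lambda>x. ln (\<alpha> x)) x + (-1) * alg.lap (\<lambda>x. ln (\<beta> x)) x"
    unfolding \<gamma>_def[abs_def] by (rule lap_lin[OF ln\<alpha> ln\<beta>])
  have lap\<Phi>: "alg.lap \<Phi> x = (3/2) * alg.lap F x + 1 * alg.lap \<gamma> x"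
    unfolding \<Phi>_def[abs_def] by (rule lap_lin[OF F_smooths \<gamma>S])
  have crit0: "pd i \<Phi> x = 0" for i by (rule max_principle(1)[OF \<Phi>S x mx\<Phi>])
  have crit: "(3/2) * pd i F x - (1/2) * (pd i F x / a) + pd i (alg.lap F) x / v = 0" for i
    using crit0[of i] by (simp add: pd\<Phi> pd\<gamma> pln algebra_simps)
  \<comment> \<open>The vanishing of the gradient of \<Phi>, solved for the gradient of u.\<close>
  then have dq: "pd i (alg.lap F) x = (- v * p) * pd i F x" for i
  proof -
    have "pd i (alg.lap F) x / v = - p * pd i F x"
      using crit[of i]
      by (simp add: p_def a(1)[symmetric] algebra_simps)
    then show ?thesis using v(2) by (simp add: field_simps)
  qed
  have w: "alg.ip F F x = w" unfolding w_def by (rule ip_grad_sq[OF x])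
  have ipFL: "alg.ip F (alg.lap F) x = - v * p * w"
    using ip_scale[of F x 1 F "alg.lap F" "- v * p" F] dq w by simp
  have ipLL: "alg.ip \<beta> \<beta> x = v\<^sup>2 * p\<^sup>2 * w"
    using ip_scale[of \<beta> x "v * p" F \<beta> "v * p" F] w by (simp add: pd\<beta> dq power2_eq_square mult_ac)
  have ip\<alpha>: "alg.ip \<alpha> \<alpha> x = w" using ip_scale[of \<alpha> x 1 F \<alpha> 1 F] w by (simp add: pd\<alpha>)
  have lu: "alg.lap F x = u" unfolding u_def by (rule lap_lap_at[OF x])
  have lap\<alpha>: "alg.lap \<alpha> x = u" unfolding \<alpha>_def[abs_def] lap_lin[OF F_smooths one] by (simp add: lap_const lu)
  \<comment> \<open>This is \<Delta>u at \<open>x\<close>, after the gradient term has been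
    evaluated by \<open>ipFL\<close>.\<close>
  define L where "L = 2 * hess_sq c f x - 2 * lam * u - v * p * w"
  have lap\<beta>: "alg.lap \<beta> x = - L"
    unfolding \<beta>_def[abs_def] lap_lin[OF LS one] using lap_lap_soliton[OF x] ipFL by (simp add: lap_const u_def L_def)
  have "alg.lap (\<lambda>x. ln (\<alpha> x)) x = u / a - w / a\<^sup>2"
    using lap_ln[OF \<alpha>S \<alpha>p x] by (simp only: lap\<alpha> ip\<alpha> a_def)
  moreover have "alg.lap (\<lambda>x. ln (\<beta> x)) x = - (L / v) - p\<^sup>2 * w"
  proof -
    have "alg.lap (\<lambda>x. ln (\<beta> x)) x = alg.lap \<beta> x / v - alg.ip \<beta> \<beta> x / v\<^sup>2"
      using lap_ln[OF \<beta>S \<beta>p x] by (simp only: v_def)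
    then show ?thesis unfolding lap\<beta> ipLL using v(2) by simp
  qed
  ultimately have "alg.lap \<Phi> x = (3/2) * u - (1/2) * (u / a - w / a\<^sup>2) + L / v + p\<^sup>2 * w"
    unfolding lap\<Phi> lap\<gamma> lu by simp
  moreover have "alg.lap \<Phi> x \<le> 0" by (rule max_principle(2)[OF \<Phi>S x mx\<Phi>])
  ultimately have "v * ((3/2) * u - (1/2) * (u / a - w / a\<^sup>2) + L / v + p\<^sup>2 * w) \<le> 0"
    using v(2) by (simp add: mult_nonneg_nonpos)
  moreover have "v * ((3/2) * u - (1/2) * (u / a - w / a\<^sup>2) + L / v + p\<^sup>2 * w)
      = v * (p * u + w / (2 * a\<^sup>2) + p\<^sup>2 * w) + L"
  proof -
    have "(3/2) * u - (1/2) * (u / a - w / a\<^sup>2) = p * u + w / (2 * a\<^sup>2)"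
      unfolding p_def a(1)[symmetric] by (simp add: left_diff_distrib right_diff_distrib)
    moreover have "v * (L / v) = L" using v(2) by simp
    ultimately show ?thesis by (simp add: distrib_left)
  qed
  moreover have "v * (p * u + w / (2 * a\<^sup>2) + p\<^sup>2 * w) + L
      = v * (p * u + w / (2 * a\<^sup>2) + p\<^sup>2 * w - p * w) + 2 * hess_sq c f x - 2 * lam * u"
    unfolding L_def by (simp add: right_diff_distrib)
  ultimately show ?thesis unfolding v(1)[symmetric] a(1)[symmetric] by simp
qed

end

text \<open>In the normalization \<open>2\<lambda> = 1\<close> the left-hand side of the first hypothesis is at least
  \<open>u\<^sup>2/2\<close> plus a positive multiple of \<open>w\<close>.\<close>

lemma soliton_inequality:
  fixes lam t u w s p :: real
  assumes le: "(2 * lam - u) * (p * u + w / (2 * (1 + t)\<^sup>2) + p\<^sup>2 * w - p * w) + 2 * s - 2 * lam * u \<le> 0"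
    and p: "p = 3/2 - 1 / (2 * (1 + t))"
    and lam: "lam > 0" and t: "1 + t > 0" and u: "u \<le> lam" and w: "w \<ge> 0" and wu: "w = u + 2 * lam * t" and s: "s \<ge> u\<^sup>2"
  shows "u = 0" "w = 0" "t = 0"
proof -
  \<comment> \<open>Dividing u and w by 2 lam normalises to 2 lam = 1, where t = w' - u'.\<close>
  define u' where "u' = u / (2 * lam)"
  define w' where "w' = w / (2 * lam)"
  define a where "a = 1 + t"
  have a: "a > 0" using t by (simp add: a_def)
  have uw: "u = 2 * lam * u'" "w = 2 * lam * w'" using lam by (simp_all add: u'_def w'_def)
  have w': "w' \<ge> 0" "u' = w' - t" "u' \<le> 1/2"
    using w wu u lam by (simp_all add: u'_def w'_def field_simps)
  have "(2 * lam - u) * (p * u + w / (2 * (1 + t)\<^sup>2) + p\<^sup>2 * w - p * w) + 2 * u\<^sup>2 - 2 * lam * u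
      = (2 * lam)\<^sup>2 * ((1 - u') * (p * u' + w' / (2 * a\<^sup>2) + p\<^sup>2 * w' - p * w') + 2 * u'\<^sup>2 - u')"
    unfolding uw a_def by (simp add: power2_eq_square algebra_simps)
  moreover have "(2 * lam - u) * (p * u + w / (2 * (1 + t)\<^sup>2) + p\<^sup>2 * w - p * w) + 2 * u\<^sup>2 - 2 * lam * u \<le> 0"
    using le s by simp
  ultimately have Q: "(1 - u') * (p * u' + w' / (2 * a\<^sup>2) + p\<^sup>2 * w' - p * w') + 2 * u'\<^sup>2 - u' \<le> 0"
    using lam by (simp add: mult_le_0_iff)
  have pa: "p = (3 * a - 1) / (2 * a)" using a unfolding p a_def by (simp add: field_simps)
  have ta: "t = a - 1" by (simp add: a_def)
  \<comment> \<open>The factor of 2 w' that remains after multiplying by 4 a^2 and eliminating u'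
    from the terms other than 2 a^2 u'^2.\<close>
  define B where "B = a * (1 + (3/2) * t\<^sup>2) - (3/2) * t\<^sup>2 * w'"
  have "4 * a\<^sup>2 * ((1 - u') * (p * u' + w' / (2 * a\<^sup>2) + p\<^sup>2 * w' - p * w') + 2 * u'\<^sup>2 - u') = 2 * a\<^sup>2 * u'\<^sup>2 + 2 * (w' * B)"
  proof -
    have e1: "4 * a\<^sup>2 * (p * u') = 2 * a * (3 * a - 1) * u'" and e2: "4 * a\<^sup>2 * (w' / (2 * a\<^sup>2)) = 2 * w'"
      and e3: "4 * a\<^sup>2 * (p\<^sup>2 * w') = (3 * a - 1)\<^sup>2 * w'" and e4: "4 * a\<^sup>2 * (p * w') = 2 * a * (3 * a - 1) * w'"
      using a unfolding pa by (simp_all add: field_simps power2_eq_square)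
    have "4 * a\<^sup>2 * ((1 - u') * (p * u' + w' / (2 * a\<^sup>2) + p\<^sup>2 * w' - p * w') + 2 * u'\<^sup>2 - u')
      = (1 - u') * (4 * a\<^sup>2 * (p * u') + 4 * a\<^sup>2 * (w' / (2 * a\<^sup>2)) + 4 * a\<^sup>2 * (p\<^sup>2 * w') - 4 * a\<^sup>2 * (p * w')) + 4 * a\<^sup>2 * (2 * u'\<^sup>2 - u')"
    proof -
      have "A * ((1 - u') * (x1 + x2 + x3 - x4) + y - z) = (1 - u') * (A * x1 + A * x2 + A * x3 - A * x4) + A * (y - z)"
        for A x1 x2 x3 x4 y z :: real by (simp add: algebra_simps)
      then show ?thesis .
    qed
    also have "\<dots> = 2 * a\<^sup>2 * u'\<^sup>2 + 2 * (w' * B)"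
      unfolding e1 e2 e3 e4 B_def unfolding w'(2) ta by (simp add: power2_eq_square field_simps)
    finally show ?thesis .
  qed
  then have le0: "2 * a\<^sup>2 * u'\<^sup>2 + 2 * (w' * B) \<le> 0" using Q a by (metis mult_nonneg_nonpos zero_le_mult_iff zero_le_numeral zero_le_power2)
  \<comment> \<open>Here u <= lam enters: the bound makes the terms in t^3 cancel and leaves B >= a
    + 3/4 t^2 > 0.\<close>
  have "w' \<le> t + 1/2" using w' by simp
  then have "t\<^sup>2 * w' \<le> t\<^sup>2 * (t + 1/2)" by (intro mult_left_mono) auto
  then have "B \<ge> a + (3/4) * t\<^sup>2" unfolding B_def a_def by (simp add: algebra_simps)
  then have B: "B > 0" using a zero_le_power2[of t] by linarith
  have "a\<^sup>2 * u'\<^sup>2 \<ge> 0" "w' * B \<ge> 0" using w' B by simp_all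
  then have "a\<^sup>2 * u'\<^sup>2 = 0" "w' * B = 0" using le0 by linarith+
  then have "u' = 0" "w' = 0" using a B by auto
  then show "u = 0" "w = 0" "t = 0" using uw w'(2) by simp_all
qed

section \<open>The global argument\<close>

context riemannian
begin

lemma continuous_from_charts:
  assumes "\<And>c. c \<in> ratlas M \<Longrightarrow> \<exists>\<phi>. continuous_map (subtopology (Euclidean_space n) (snd c ` fst c)) euclideanreal \<phi> \<and>
      (\<forall>p\<in>fst c. h p = \<phi> (snd c p))"
  shows "continuous_map (rtop M) euclideanreal h"
  unfolding continuous_map
proof (intro conjI allI impI)
  fix W assume W: "openin euclideanreal W"
  show "openin (rtop M) {p \<in> topspace (rtop M). h p \<in> W}"
  proof (subst openin_subopen, intro ballI)
    fix p assume p: "p \<in> {p \<in> topspace (rtop M). h p \<in> W}"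
    then obtain c where c: "c \<in> ratlas M" "p \<in> fst c" using atlas_cover by blast
    obtain \<phi> where \<phi>: "continuous_map (subtopology (Euclidean_space n) (snd c ` fst c)) euclideanreal \<phi>"
        "\<And>q. q \<in> fst c \<Longrightarrow> h q = \<phi> (snd c q)" using assms[OF c(1)] by blast
    let ?T = "{q \<in> topspace (subtopology (rtop M) (fst c)). \<phi> (snd c q) \<in> W}"
    have "openin (subtopology (rtop M) (fst c)) ?T"
      by (rule openin_continuous_map_preimage[OF chart_continuous_map[OF chart[OF c(1)] \<phi>(1)] W])
    then have "openin (rtop M) ?T" using chart_open[OF c(1)] openin_trans_full by blast
    moreover have "p \<in> ?T" using p c \<phi>(2) by auto
    moreover have "?T \<subseteq> {p \<in> topspace (rtop M). h p \<in> W}" using \<phi>(2) by auto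
    ultimately show "\<exists>T. openin (rtop M) T \<and> p \<in> T \<and> T \<subseteq> {p \<in> topspace (rtop M). h p \<in> W}" by blast
  qed
qed simp

lemma nonempty: "topspace (rtop M) \<noteq> {}"
  using rm by (simp add: riemannian_manifold_def)

lemma connected: "connected_space (rtop M)"
  using rm by (simp add: riemannian_manifold_def)

lemma attains_max:
  assumes "compact_space (rtop M)" "continuous_map (rtop M) euclideanreal h"
  obtains p where "p \<in> topspace (rtop M)" "\<And>q. q \<in> topspace (rtop M) \<Longrightarrow> h q \<le> h p"
proof -
  have "compactin (rtop M) (topspace (rtop M))" using assms(1) by (simp add: compact_space_def)
  then have "compactin euclideanreal (h ` topspace (rtop M))" by (rule image_compactin[OF _ assms(2)])
  then have "compact (h ` topspace (rtop M))" by simp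
  then obtain s where "s \<in> h ` topspace (rtop M)" "\<forall>t\<in>h ` topspace (rtop M). t \<le> s"
    using compact_attains_sup[of "h ` topspace (rtop M)"] nonempty by blast
  then show thesis using that by auto
qed

lemma attains_min:
  assumes "compact_space (rtop M)" "continuous_map (rtop M) euclideanreal h"
  obtains p where "p \<in> topspace (rtop M)" "\<And>q. q \<in> topspace (rtop M) \<Longrightarrow> h p \<le> h q"
proof -
  have "continuous_map (rtop M) euclideanreal (\<lambda>p. - h p)"
    using assms(2) by (rule continuous_map_minus)
  then obtain p where p: "p \<in> topspace (rtop M)" "\<And>q. q \<in> topspace (rtop M) \<Longrightarrow> - h q \<le> - h p"
    using attains_max[OF assms(1), of "\<lambda>p. - h p"] by blast
  show thesis by (rule that[OF p(1)]) (use p(2) in force)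
qed

lemma intermediate_value:
  assumes h: "continuous_map (rtop M) euclideanreal h" and pq: "p \<in> topspace (rtop M)" "q \<in> topspace (rtop M)"
    and "h p \<le> y" "y \<le> h q"
  shows "\<exists>r\<in>topspace (rtop M). h r = y"
proof -
  have "connectedin (rtop M) (topspace (rtop M))" using connected by (simp add: connectedin_topspace)
  then have "connectedin euclideanreal (h ` topspace (rtop M))"
    by (rule connectedin_continuous_map_image[OF h])
  then have "connected (h ` topspace (rtop M))" by (simp add: connectedin_iff_connected)
  then have "y \<in> h ` topspace (rtop M)"
    using connected_contains_Icc[of "h ` topspace (rtop M)" "h p" "h q"] assms by auto
  then show ?thesis by blast
qed

lemma locally_constant_imp_constant:
  assumes loc: "\<And>p. p \<in> topspace (rtop M) \<Longrightarrow> \<exists>W. openin (rtop M) W \<and> p \<in> W \<and> (\<forall>q\<in>W. h q = h p)"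
    and pq: "p \<in> topspace (rtop M)" "q \<in> topspace (rtop M)"
  shows "h q = (h p :: real)"
proof (rule ccontr)
  assume ne: "h q \<noteq> h p"
  define A where "A = {r \<in> topspace (rtop M). h r = h p}"
  define B where "B = {r \<in> topspace (rtop M). h r \<noteq> h p}"
  have "openin (rtop M) A"
  proof (subst openin_subopen, intro ballI)
    fix r assume r: "r \<in> A"
    then have "r \<in> topspace (rtop M)" by (simp add: A_def)
    from loc[OF this] obtain W where W: "openin (rtop M) W" "r \<in> W" "\<forall>q\<in>W. h q = h r" by (elim exE conjE)
    have hr: "h r = h p" using r by (simp add: A_def)
    have "W \<subseteq> A"
    proof
      fix q assume q: "q \<in> W"
      have "h q = h r" by (rule bspec[OF W(3) q])
      moreover have "q \<in> topspace (rtop M)" using openin_subset[OF W(1)] q by blast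
      ultimately show "q \<in> A" using hr by (simp add: A_def)
    qed
    then show "\<exists>T. openin (rtop M) T \<and> r \<in> T \<and> T \<subseteq> A" using W(1,2) by blast
  qed
  moreover have "openin (rtop M) B"
  proof (subst openin_subopen, intro ballI)
    fix r assume r: "r \<in> B"
    then have "r \<in> topspace (rtop M)" by (simp add: B_def)
    from loc[OF this] obtain W where W: "openin (rtop M) W" "r \<in> W" "\<forall>q\<in>W. h q = h r" by (elim exE conjE)
    have hr: "h r \<noteq> h p" using r by (simp add: B_def)
    have "W \<subseteq> B"
    proof
      fix q assume q: "q \<in> W"
      have "h q = h r" by (rule bspec[OF W(3) q])
      moreover have "q \<in> topspace (rtop M)" using openin_subset[OF W(1)] q by blast
      ultimately show "q \<in> B" using hr by (simp add: B_def)
    qed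
    then show "\<exists>T. openin (rtop M) T \<and> r \<in> T \<and> T \<subseteq> B" using W(1,2) by blast
  qed
  moreover have "topspace (rtop M) \<subseteq> A \<union> B" "A \<inter> B = {}" by (auto simp: A_def B_def)
  moreover have "A \<noteq> {}" "B \<noteq> {}" using pq ne by (auto simp: A_def B_def)
  ultimately have "\<exists>E1 E2. openin (rtop M) E1 \<and> openin (rtop M) E2 \<and> topspace (rtop M) \<subseteq> E1 \<union> E2 \<and> E1 \<inter> E2 = {} \<and> E1 \<noteq> {} \<and> E2 \<noteq> {}"
    by (intro exI[of _ A] exI[of _ B] conjI)
  then show False using connected[unfolded connected_space_def] by (rule notE[rotated])
qed

end

locale soliton = riemannian M for M :: "'a riem" +
  fixes f :: "'a \<Rightarrow> real" and lam :: real
  assumes sol: "gradient_ricci_soliton M f lam"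
begin

lemma soliton_chart: "c \<in> ratlas M \<Longrightarrow> soliton_chart M c f lam"
  using sol by unfold_locales

lemma smooth_f: "smooth_fun_on M (topspace (rtop M)) f"
  using sol by (simp add: gradient_ricci_soliton_def)

text \<open>The same choice as in \<open>hessian_invariant\<close>, so that
  \<open>S2_formula\<close> only has to unfold it; by \<open>in_chart\<close> any other chart gives
  the same values.\<close>

definition "some_chart p = (SOME c. c \<in> ratlas M \<and> p \<in> fst c)"

lemma some_chart: 
  assumes "p \<in> topspace (rtop M)"
  shows "some_chart p \<in> ratlas M" "p \<in> fst (some_chart p)"
proof -
  have "\<exists>c. c \<in> ratlas M \<and> p \<in> fst c" using atlas_cover[OF assms] by blast
  then have "some_chart p \<in> ratlas M \<and> p \<in> fst (some_chart p)" unfolding some_chart_def by (rule someI_ex)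
  then show "some_chart p \<in> ratlas M" "p \<in> fst (some_chart p)" by auto
qed

definition "lapM p = lap_at (some_chart p) f (snd (some_chart p) p)"
definition "hessM p = hess_sq (some_chart p) f (snd (some_chart p) p)"
definition "gradM p = grad_sq (some_chart p) f (snd (some_chart p) p)"

lemma in_chart:
  assumes c: "c \<in> ratlas M" and p: "p \<in> fst c"
  shows "lapM p = lap_at c f (snd c p)" "hessM p = hess_sq c f (snd c p)" "gradM p = grad_sq c f (snd c p)"
  unfolding lapM_def hessM_def gradM_def
  using chart_invariance[OF c some_chart(1)[OF chart_subset[OF c p]] p some_chart(2)[OF chart_subset[OF c p]] smooth_f]
  by simp_all

lemma f_continuous: "continuous_map (rtop M) euclideanreal f"
proof (rule continuous_from_charts)
  fix c assume c: "c \<in> ratlas M"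
  show "\<exists>\<phi>. continuous_map (subtopology (Euclidean_space n) (snd c ` fst c)) euclideanreal \<phi> \<and> (\<forall>p\<in>fst c. f p = \<phi> (snd c p))"
    using smooth_on_continuous[OF smooth_in_chart[OF smooth_f c]] chart_inv_left[OF chart[OF c]]
    by (intro exI[of _ "f \<circ> chart_inv c"]) simp
qed

lemma lapM_continuous: "continuous_map (rtop M) euclideanreal lapM"
proof (rule continuous_from_charts)
  fix c assume c: "c \<in> ratlas M"
  interpret soliton_chart M c f lam by (rule soliton_chart[OF c])
  show "\<exists>\<phi>. continuous_map (subtopology (Euclidean_space n) (snd c ` fst c)) euclideanreal \<phi> \<and> (\<forall>p\<in>fst c. lapM p = \<phi> (snd c p))"
    using smooth_on_continuous[OF lap_at_smooth] in_chart(1)[OF c] by blast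
qed

text \<open>The partial derivatives vanish in every chart, so the function is constant on a cube
  around each point, and connectedness does the rest.\<close>

lemma conserved_constant:
  assumes "p \<in> topspace (rtop M)" "q \<in> topspace (rtop M)"
  shows "gradM q - lapM q - 2 * lam * f q = gradM p - lapM p - 2 * lam * f p"
proof (rule locally_constant_imp_constant[OF _ assms])
  fix p assume p: "p \<in> topspace (rtop M)"
  obtain c where cc: "c \<in> ratlas M" "p \<in> fst c" using atlas_cover[OF p] by blast
  interpret soliton_chart M c f lam by (rule soliton_chart[OF cc(1)])
  define h where "h x = grad_sq c f x - lap_at c f x - 2 * lam * f (chart_inv c x)" for x
  have hs: "smooth_on n U h" unfolding h_def[abs_def] by (rule conserved_smooth)
  have hp: "gradM q - lapM q - 2 * lam * f q = h (snd c q)" if "q \<in> fst c" for q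
    by (simp add: h_def in_chart[OF cc(1) that] chart_inv_left[OF chart[OF cc(1)] that])
  have pU: "snd c p \<in> U" using cc(2) by blast
  obtain e where e: "e > 0" "ebox n (snd c p) e \<subseteq> U" using openin_Euclidean_ebox[OF U pU] by blast
  have const: "h y = h (snd c p)" if "y \<in> ebox n (snd c p) e" for y
    by (rule constant_on_ebox[OF U hs pU e(2) that]) (unfold h_def[abs_def], rule conserved)
  have "continuous_map (subtopology (Euclidean_space n) U) euclideanreal (\<lambda>x. \<bar>x i - snd c p i\<bar>)" for i
    using smooth_on_continuous[OF smooth_on_coord[OF U, of i]] by (intro continuous_map_real_abs continuous_map_diff) auto
  then have cont: "continuous_map (subtopology (rtop M) (fst c)) euclideanreal (\<lambda>q. \<bar>snd c q i - snd c p i\<bar>)" for i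
    by (rule chart_continuous_map[OF chart[OF cc(1)]])
  define W where "W = {q \<in> fst c. \<forall>i<n. \<bar>snd c q i - snd c p i\<bar> < e}"
  have top: "topspace (subtopology (rtop M) (fst c)) = fst c" using is_chart_facts(4)[OF chart[OF cc(1)]] by auto
  have "openin (subtopology (rtop M) (fst c)) {q \<in> topspace (subtopology (rtop M) (fst c)). \<bar>snd c q i - snd c p i\<bar> \<in> {..<e}}" for i
    by (rule openin_continuous_map_preimage[OF cont]) simp
  then have op: "openin (subtopology (rtop M) (fst c)) {q \<in> fst c. \<bar>snd c q i - snd c p i\<bar> < e}" for i unfolding top by simp
  have "openin (subtopology (rtop M) (fst c)) (fst c \<inter> (\<Inter>i\<in>{..<n}. {q \<in> fst c. \<bar>snd c q i - snd c p i\<bar> < e}))"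
  \<comment> \<open>For \<open>n = 0\<close> the intersection runs over an empty family and does not
    bound the set by itself.\<close>
  proof (cases "n = 0")
    case True
    then show ?thesis using openin_topspace[of "subtopology (rtop M) (fst c)"] unfolding top by simp
  next
    case False
    have "openin (subtopology (rtop M) (fst c)) (\<Inter>i\<in>{..<n}. {q \<in> fst c. \<bar>snd c q i - snd c p i\<bar> < e})"
      by (rule openin_INT2) (use False op in auto)
    then show ?thesis using openin_topspace[of "subtopology (rtop M) (fst c)"] unfolding top by (intro openin_Int)
  qed
  moreover have "fst c \<inter> (\<Inter>i\<in>{..<n}. {q \<in> fst c. \<bar>snd c q i - snd c p i\<bar> < e}) = W" by (auto simp: W_def)
  ultimately have "openin (rtop M) W" using chart_open[OF cc(1)] openin_trans_full by (simp only:) blast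
  moreover have "p \<in> W" using cc e by (simp add: W_def)
  moreover have "gradM q - lapM q - 2 * lam * f q = gradM p - lapM p - 2 * lam * f p" if "q \<in> W" for q
  proof -
    have q: "q \<in> fst c" "snd c q \<in> ebox n (snd c p) e"
      using that openin_Euclidean_subset[OF U] by (auto simp: W_def ebox_def)
    show ?thesis unfolding hp[OF q(1)] hp[OF cc(2)] by (rule const[OF q(2)])
  qed
  ultimately show "\<exists>W. openin (rtop M) W \<and> p \<in> W \<and> (\<forall>q\<in>W. gradM q - lapM q - 2 * lam * f q = gradM p - lapM p - 2 * lam * f p)" by blast
qed

lemma S2_formula:
  assumes p: "p \<in> topspace (rtop M)"
  shows "2 * hessian_invariant M f 2 p = (lapM p)\<^sup>2 - hessM p"
proof -
  let ?c = "some_chart p" and ?x = "snd (some_chart p) p"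
  have c: "?c \<in> ratlas M" and x: "?x \<in> snd ?c ` fst ?c" using some_chart[OF p] by auto
  have A: "hessian_endo M ?c f ?x \<in> carrier_mat n n"
    unfolding hessian_endo_def using ginv_mat(1)[OF c x] by simp
  have ent: "hessian_endo M ?c f ?x $$ (i, j) = (\<Sum>b<n. ginv_mat M ?c ?x $$ (i, b) * hessian M ?c f b j ?x)" if "i < n" "j < n" for i j
    unfolding hessian_endo_def using ginv_mat(1)[OF c x] that
    by (auto simp: scalar_prod_def lessThan_atLeast0 intro!: sum.cong)
  have "2 * coeff (det_poly n (hessian_endo M ?c f ?x)) 2 = (lapM p)\<^sup>2 - hessM p"
    unfolding det_poly_coeff_2[OF A] lapM_def hessM_def lap_at_def hess_sq_def by (simp add: ent)
  then show ?thesis by (simp add: hessian_invariant_def some_chart_def[symmetric] Let_def)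
qed

lemma gradM_nonneg: "p \<in> topspace (rtop M) \<Longrightarrow> gradM p \<ge> 0"
proof -
  assume p: "p \<in> topspace (rtop M)"
  interpret soliton_chart M "some_chart p" f lam by (rule soliton_chart[OF some_chart(1)[OF p]])
  have x: "snd (some_chart p) p \<in> U" using some_chart(2)[OF p] by blast
  show ?thesis using ip_nonneg[OF x, of F] unfolding gradM_def ip_grad_sq[OF x] .
qed

lemma hessM_nonneg: "p \<in> topspace (rtop M) \<Longrightarrow> hessM p \<ge> 0"
proof -
  assume p: "p \<in> topspace (rtop M)"
  interpret soliton_chart M "some_chart p" f lam by (rule soliton_chart[OF some_chart(1)[OF p]])
  have "snd (some_chart p) p \<in> U" using some_chart(2)[OF p] by blast
  then show ?thesis unfolding hessM_def by (rule hess_sq_nonneg[OF F_smooths])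
qed

lemma chart_transfer:
  assumes c: "c \<in> ratlas M" and y: "y \<in> snd c ` fst c"
  shows "chart_inv c y \<in> topspace (rtop M)" "lapM (chart_inv c y) = lap_at c f y"
  using chart_subset[OF c chart_inv_in[OF y]] in_chart(1)[OF c chart_inv_in[OF y]] chart_inv_right[OF y] by simp_all

theorem potential_constant:
  assumes lam: "lam > 0" and comp: "compact_space (rtop M)"
    and S2: "hessian_invariant M f 2 constant_on topspace (rtop M)"
  obtains k where "\<And>p. p \<in> topspace (rtop M) \<Longrightarrow> f p = k"
proof -
  obtain k2 where k2: "\<And>p. p \<in> topspace (rtop M) \<Longrightarrow> hessian_invariant M f 2 p = k2"
    using S2 unfolding constant_on_def by blast
  have k2': "hessM p = (lapM p)\<^sup>2 - 2 * k2" if "p \<in> topspace (rtop M)" for p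
    using S2_formula[OF that] k2[OF that] by simp
  obtain p1 where p1: "p1 \<in> topspace (rtop M)" "\<And>q. q \<in> topspace (rtop M) \<Longrightarrow> f q \<le> f p1"
    using attains_max[OF comp f_continuous] by blast
  obtain p2 where p2: "p2 \<in> topspace (rtop M)" "\<And>q. q \<in> topspace (rtop M) \<Longrightarrow> f p2 \<le> f q"
    using attains_min[OF comp f_continuous] by blast
  have "lapM p1 \<le> 0"
  proof -
    interpret soliton_chart M "some_chart p1" f lam by (rule soliton_chart[OF some_chart(1)[OF p1(1)]])
    have x: "snd (some_chart p1) p1 \<in> U" using some_chart(2)[OF p1(1)] by blast
    show ?thesis unfolding lapM_def
      by (rule lap_at_max[OF x]) (use p1 chart_transfer(1)[OF c] chart_inv_left[OF chart[OF c] some_chart(2)[OF p1(1)]] in simp)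
  qed
  moreover have "lapM p2 \<ge> 0"
  proof -
    interpret soliton_chart M "some_chart p2" f lam by (rule soliton_chart[OF some_chart(1)[OF p2(1)]])
    have x: "snd (some_chart p2) p2 \<in> U" using some_chart(2)[OF p2(1)] by blast
    show ?thesis unfolding lapM_def
      by (rule lap_at_min[OF x]) (use p2 chart_transfer(1)[OF c] chart_inv_left[OF chart[OF c] some_chart(2)[OF p2(1)]] in simp)
  qed
  ultimately obtain p0 where p0: "p0 \<in> topspace (rtop M)" "lapM p0 = 0"
    using intermediate_value[OF lapM_continuous p1(1) p2(1)] by blast
  have "k2 \<le> 0" using k2'[OF p0(1)] p0(2) hessM_nonneg[OF p0(1)] by simp
  then have sq: "hessM p \<ge> (lapM p)\<^sup>2" if "p \<in> topspace (rtop M)" for p using k2'[OF that] by simp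
  obtain p3 where p3: "p3 \<in> topspace (rtop M)" "\<And>q. q \<in> topspace (rtop M) \<Longrightarrow> lapM q \<le> lapM p3"
    using attains_max[OF comp lapM_continuous] by blast
  have "lapM p3 \<le> lam"
  proof -
    interpret soliton_chart M "some_chart p3" f lam by (rule soliton_chart[OF some_chart(1)[OF p3(1)]])
    have x: "snd (some_chart p3) p3 \<in> U" using some_chart(2)[OF p3(1)] by blast
    show ?thesis unfolding lapM_def
    proof (rule lap_at_bound_at_max[OF x _ _ lam])
      show "lap_at (some_chart p3) f y \<le> lap_at (some_chart p3) f (snd (some_chart p3) p3)" if "y \<in> U" for y
        using p3(2)[OF chart_transfer(1)[OF c that]] unfolding chart_transfer(2)[OF c that] lapM_def[of p3] .
      show "(lap_at (some_chart p3) f (snd (some_chart p3) p3))\<^sup>2 \<le> hess_sq (some_chart p3) f (snd (some_chart p3) p3)"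
        using sq[OF p3(1)] unfolding lapM_def hessM_def .
    qed
  qed
  then have ulam: "lapM p \<le> lam" if "p \<in> topspace (rtop M)" for p using p3(2)[OF that] by simp
  \<comment> \<open>The shift that absorbs the conserved constant, evaluated at the reference point
    \<open>p0\<close>.\<close>
  define \<kappa> where "\<kappa> = (gradM p0 - lapM p0 - 2 * lam * f p0) / (2 * lam)"
  have w: "gradM p = lapM p + 2 * lam * (f p + \<kappa>)" if "p \<in> topspace (rtop M)" for p
  proof -
    have "2 * lam * \<kappa> = gradM p0 - lapM p0 - 2 * lam * f p0" using lam by (simp add: \<kappa>_def)
    then show ?thesis using conserved_constant[OF p0(1) that] by (simp add: distrib_left)
  qed
  have pos: "1 + (f p + \<kappa>) > 0" "2 * lam - lapM p > 0" if "p \<in> topspace (rtop M)" for p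
  proof -
    show "2 * lam - lapM p > 0" using ulam[OF that] lam by simp
    \<comment> \<open>The sum v + w equals 2 lam (1 + t), so positivity of v carries over to 1 +
      t.\<close>
    have "0 < 2 * lam - lapM p + gradM p" using gradM_nonneg[OF that] ulam[OF that] lam by simp
    also have "\<dots> = 2 * lam * (1 + (f p + \<kappa>))" using w[OF that] by (simp add: distrib_left)
    finally show "1 + (f p + \<kappa>) > 0" using lam by (simp add: zero_less_mult_iff)
  qed
  define potM where "potM p = (3/2) * (f p + \<kappa>) - (1/2) * ln (1 + (f p + \<kappa>)) - ln (2 * lam - lapM p)" for p
  \<comment> \<open>The logarithm is continuous on the positive reals, so its arguments are treated
    as maps into that subspace.\<close>
  have "continuous_map (rtop M) (top_of_set {0<..}) (\<lambda>p. 1 + (f p + \<kappa>))"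
    "continuous_map (rtop M) (top_of_set {0<..}) (\<lambda>p. 2 * lam - lapM p)"
    using pos f_continuous lapM_continuous
    by (auto simp: continuous_map_in_subtopology image_subset_iff intro!: continuous_intros)
  moreover have "continuous_map (top_of_set {0<..}) euclideanreal (ln :: real \<Rightarrow> real)"
    unfolding continuous_map_iff_continuous by (intro continuous_intros) auto
  ultimately have "continuous_map (rtop M) euclideanreal (ln \<circ> (\<lambda>p. 1 + (f p + \<kappa>)))"
    "continuous_map (rtop M) euclideanreal (ln \<circ> (\<lambda>p. 2 * lam - lapM p))"
    by (blast intro: continuous_map_compose)+
  then have "continuous_map (rtop M) euclideanreal potM"
    unfolding potM_def[abs_def] o_def using f_continuous
    by (intro continuous_map_diff continuous_map_real_mult continuous_map_add) auto
  then obtain p where p: "p \<in> topspace (rtop M)" "\<And>q. q \<in> topspace (rtop M) \<Longrightarrow> potM q \<le> potM p"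
    using attains_max[OF comp] by blast
  have at_p: "lapM p = 0 \<and> f p + \<kappa> = 0"
  proof -
    interpret soliton_chart M "some_chart p" f lam by (rule soliton_chart[OF some_chart(1)[OF p(1)]])
    let ?c = "some_chart p" and ?x = "snd (some_chart p) p"
    have x: "?x \<in> U" using some_chart(2)[OF p(1)] by blast
    have inv: "chart_inv ?c ?x = p" by (rule chart_inv_left[OF chart[OF c] some_chart(2)[OF p(1)]])
    have pot: "pot \<kappa> y = potM (chart_inv ?c y)" if "y \<in> U" for y
      unfolding pot_def potM_def chart_transfer(2)[OF c that] ..
    have "pot \<kappa> y \<le> pot \<kappa> ?x" if "y \<in> U" for y
      unfolding pot[OF that] pot[OF x] inv by (rule p(2)[OF chart_transfer(1)[OF c that]])
    moreover have "1 + (f (chart_inv ?c y) + \<kappa>) > 0" "2 * lam - lap_at ?c f y > 0" if "y \<in> U" for y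
      using pos[OF chart_transfer(1)[OF c that]] unfolding chart_transfer(2)[OF c that] by simp_all
    ultimately have le: "(2 * lam - lapM p) * ((3/2 - 1 / (2 * (1 + (f p + \<kappa>)))) * lapM p + gradM p / (2 * (1 + (f p + \<kappa>))\<^sup>2)
        + (3/2 - 1 / (2 * (1 + (f p + \<kappa>))))\<^sup>2 * gradM p - (3/2 - 1 / (2 * (1 + (f p + \<kappa>)))) * gradM p) + 2 * hessM p - 2 * lam * lapM p \<le> 0"
      using pot_max[OF x, of \<kappa>] unfolding inv lapM_def gradM_def hessM_def by blast
    note I = soliton_inequality[OF le refl lam pos(1)[OF p(1)] ulam[OF p(1)] gradM_nonneg[OF p(1)] w[OF p(1)] sq[OF p(1)]]
    show ?thesis using I(1,3) by blast
  qed
  have "f q = - \<kappa>" if q: "q \<in> topspace (rtop M)" for q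
  proof -
    define t where "t = f q + \<kappa>"
    have t: "1 + t > 0" using pos(1)[OF q] by (simp add: t_def)
    have "potM q \<le> potM p" by (rule p(2)[OF q])
    also have "potM p = - ln (2 * lam)" unfolding potM_def using at_p by simp
    finally have 1: "(3/2) * t - (1/2) * ln (1 + t) + ln (2 * lam) \<le> ln (2 * lam - lapM q)"
      unfolding potM_def t_def by simp
    \<comment> \<open>This is w >= 0 in disguise.\<close>
    have "2 * lam - lapM q \<le> 2 * lam * (1 + t)"
      using w[OF q] gradM_nonneg[OF q] by (simp add: t_def algebra_simps)
    then have "ln (2 * lam - lapM q) \<le> ln (2 * lam * (1 + t))"
      using pos(2)[OF q] by (subst ln_le_cancel_iff) linarith+
    also have "\<dots> = ln (2 * lam) + ln (1 + t)" using lam t by (subst ln_mult) auto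
    finally have "t \<le> ln (1 + t)" using 1 by simp
    then have "ln (1 + t) = (1 + t) - 1" using ln_add_one_self_le_self2[of t] t by simp
    then have "1 + t = 1" by (rule ln_eq_minus_one[OF t])
    then show ?thesis by (simp add: t_def)
  qed
  then show thesis by (rule that)
qed

lemma constant_potential_einstein:
  assumes k: "\<And>p. p \<in> topspace (rtop M) \<Longrightarrow> f p = k"
  shows "einstein M"
proof -
  have "ricci M c i j x = lam * gcomp M c i j x" if c: "c \<in> ratlas M" and x: "x \<in> snd c ` fst c" and ij: "i < n" "j < n" for c x i j
  proof -
    interpret soliton_chart M c f lam by (rule soliton_chart[OF c])
    have F: "F y = k" if "y \<in> U" for y using k[OF chart_transfer(1)[OF c that]] by simp
    have p1: "partial i F y = 0" if "y \<in> U" "i < n" for y i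
      using partial_cong[OF U that, of F "\<lambda>_. k"] F by simp
    have "partial i (partial j F) x = partial i (\<lambda>_. 0) x"
      by (rule partial_cong[OF U x ij(1)]) (rule p1[OF _ ij(2)])
    then have "hessian M c f i j x = 0" unfolding hessian_def using p1[OF x] by simp
    then show ?thesis using ricci_soliton[OF x ij] by simp
  qed
  then show ?thesis unfolding einstein_def by blast
qed

end

section \<open>Einstein manifolds are rigid\<close>

context riemannian
begin

text \<open>Stated for maps that are the identity on the carrier only: the unit of
  \<open>BijGroup\<close> and the maps produced by \<open>inv_into\<close> are not controlled
  elsewhere.\<close>

lemma smooth_map_self:
  assumes g: "\<And>p. p \<in> topspace (rtop M) \<Longrightarrow> g p = p"
  shows "smooth_map M M g"
  unfolding smooth_map_def
proof (intro conjI ballI allI impI)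
  show "continuous_map (rtop M) (rtop M) g"
    by (rule continuous_map_eq[OF continuous_map_id]) (simp add: g)
  fix c d i assume c: "c \<in> ratlas M" and d: "d \<in> ratlas M" and i: "i < n"
  have eq: "{p \<in> fst c. g p \<in> fst d} = fst c \<inter> fst d" using g chart_subset[OF c] by auto
  show "smooth_on n (snd c ` {p \<in> fst c. g p \<in> fst d}) (\<lambda>x. snd d (g (chart_inv c x)) i)"
    unfolding eq
  proof (rule smooth_on_cong[OF chart_image_open[OF chart[OF c] chart_open[OF d]] transition_smooth[OF c d i]])
    fix y assume "y \<in> snd c ` (fst c \<inter> fst d)"
    then have "chart_inv c y \<in> topspace (rtop M)" by (intro chart_subset[OF c] chart_inv_in) blast
    then show "transition c d i y = snd d (g (chart_inv c y)) i" by (simp add: transition_def g)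
  qed
qed

lemma inv_into_self:
  assumes "\<And>p. p \<in> S \<Longrightarrow> g p = p" "p \<in> S"
  shows "inv_into S g p = p"
proof -
  have "inv_into S g (g p) = p"
    by (rule inv_into_f_f) (use assms in \<open>auto intro: inj_onI\<close>)
  then show ?thesis using assms by simp
qed

lemma bij_betw_self: "(\<And>p. p \<in> S \<Longrightarrow> g p = p) \<Longrightarrow> bij_betw g S S"
  using bij_betw_cong[of S g id S] by simp

lemma isometry_self: "isometry M M (\<lambda>p. p)"
  unfolding isometry_def
proof (intro conjI)
  show "bij_betw (\<lambda>p. p) (topspace (rtop M)) (topspace (rtop M))" by (rule bij_betw_self) simp
  show "smooth_map M M (\<lambda>p. p)" by (rule smooth_map_self) simp
  show "smooth_map M M (inv_into (topspace (rtop M)) (\<lambda>p. p))" by (rule smooth_map_self) (rule inv_into_self, auto)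
  show "preserves_metric M M (\<lambda>p. p)"
    unfolding preserves_metric_def
  proof (intro ballI)
    \<comment> \<open>On functions not smooth near \<open>p\<close> both sides are 0, by the
      convention for derivations.\<close>
    have push: "pushforward M (\<lambda>p. p) p v = v" if "v \<in> tangent_space M p" for p v
    proof
      fix h
      have "v h = 0" if "\<not> smooth_near M p h"
        using \<open>v \<in> tangent_space M p\<close>[unfolded tangent_space_def mem_Collect_eq, THEN conjunct2, THEN conjunct2, THEN conjunct2,
            THEN spec, THEN mp, OF that] .
      then show "pushforward M (\<lambda>p. p) p v h = v h" by (auto simp: pushforward_def o_def)
    qed
    fix p v w assume "v \<in> tangent_space M p" "w \<in> tangent_space M p"
    then show "rmetric M p (pushforward M (\<lambda>p. p) p v) (pushforward M (\<lambda>p. p) p w) = rmetric M p v w"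
      by (simp add: push)
  qed
qed

text \<open>Rigidity will be witnessed by the product with a point, of which \<open>M\<close> is the
  quotient by the trivial group.\<close>

abbreviation "E0 \<equiv> euclidean_riem 0"

abbreviation "P0 \<equiv> prod_riem M E0"

abbreviation "pc c \<equiv> prod_chart n c (topspace (Euclidean_space 0), \<lambda>x. x)"

lemma topspace_E0: "topspace (Euclidean_space 0) = {\<lambda>_. 0}"
  by (auto simp: topspace_Euclidean_space)

lemma P0_simps:
  "rtop P0 = prod_topology (rtop M) (Euclidean_space 0)" "rdim P0 = n" "ratlas P0 = pc ` ratlas M"
  "rmetric P0 = (\<lambda>z v w. rmetric M (fst z) (pushforward M fst z v) (pushforward M fst z w))"
  by (auto simp: prod_riem_def euclidean_riem_def)

lemma topspace_P0: "topspace (rtop P0) = topspace (rtop M) \<times> {\<lambda>_. 0}"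
  by (simp add: P0_simps topspace_E0)

lemma fst_pc: "fst (pc c) = fst c \<times> {\<lambda>_. 0}"
  by (simp add: prod_chart_def topspace_E0)

text \<open>The product chart reads coordinates from \<open>n\<close> on in the point factor, where
  they are 0, as they are in every chart of \<open>M\<close>. So both manifolds have literally the
  same coordinates.\<close>

lemma snd_pc:
  assumes "c \<in> ratlas M" "p \<in> fst c"
  shows "snd (pc c) (p, \<lambda>_. 0) = snd c p"
proof
  fix i
  have "snd c p \<in> topspace (Euclidean_space n)"
    using openin_subset[OF is_chart_facts(2)[OF chart[OF assms(1)]]] assms(2) by blast
  then show "snd (pc c) (p, \<lambda>_. 0) i = snd c p i" by (simp add: prod_chart_def mem_topspace_Euclidean)
qed

lemma snd_pc_image:
  assumes "c \<in> ratlas M" "B \<subseteq> fst c"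
  shows "snd (pc c) ` (B \<times> {\<lambda>_. 0}) = snd c ` B"
proof -
  have *: "snd (pc c) z = snd c (fst z)" if "z \<in> B \<times> {\<lambda>_. 0}" for z
    using that assms(2) snd_pc[OF assms(1), of "fst z"] by auto
  have "snd (pc c) ` (B \<times> {\<lambda>_. 0}) = (\<lambda>z. snd c (fst z)) ` (B \<times> {\<lambda>_ :: nat. 0 :: real})" by (intro image_cong refl *)
  then show ?thesis by force
qed

lemma chart_inv_pc:
  assumes c: "c \<in> ratlas M" and x: "x \<in> snd c ` fst c"
  shows "chart_inv (pc c) x = (chart_inv c x, \<lambda>_. 0)"
proof -
  have inj: "inj_on (snd (pc c)) (fst (pc c))"
  proof (rule inj_onI)
    fix z z' assume z: "z \<in> fst (pc c)" "z' \<in> fst (pc c)" "snd (pc c) z = snd (pc c) z'"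
    then have "snd c (fst z) = snd c (fst z')" "fst z \<in> fst c" "fst z' \<in> fst c" "snd z = snd z'"
      using snd_pc[OF c] by (auto simp: fst_pc)
    then show "z = z'" using is_chart_facts(3)[OF chart[OF c]] by (auto dest: inj_onD intro: prod_eqI)
  qed
  have p: "chart_inv c x \<in> fst c" "snd c (chart_inv c x) = x" by (rule chart_inv_in[OF x], rule chart_inv_right[OF x])
  have "inv_into (fst (pc c)) (snd (pc c)) (snd (pc c) (chart_inv c x, \<lambda>_. 0)) = (chart_inv c x, \<lambda>_. 0)"
    by (rule inv_into_f_f[OF inj]) (simp add: fst_pc p)
  then show ?thesis unfolding snd_pc[OF c p(1)] p(2) chart_inv_def[of "pc c"] .
qed

lemma smooth_map_self_P0:
  assumes g: "\<And>z. z \<in> topspace (rtop P0) \<Longrightarrow> g z = z"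
  shows "smooth_map P0 P0 g"
  unfolding smooth_map_def
proof (intro conjI ballI allI impI)
  show "continuous_map (rtop P0) (rtop P0) g"
    by (rule continuous_map_eq[OF continuous_map_id]) (simp add: g)
  fix c' d' i assume "c' \<in> ratlas P0" "d' \<in> ratlas P0" and i': "i < rdim P0"
  then obtain c d where c: "c \<in> ratlas M" "c' = pc c" and d: "d \<in> ratlas M" "d' = pc d" and i: "i < n"
    by (auto simp: P0_simps)
  have gz: "g (p, \<lambda>_. 0) = (p, \<lambda>_. 0)" if "p \<in> fst c" for p
    by (rule g) (use chart_subset[OF c(1) that] in \<open>simp add: topspace_P0\<close>)
  have "{z \<in> fst c'. g z \<in> fst d'} = (fst c \<inter> fst d) \<times> {\<lambda>_. 0}"
    unfolding c(2) d(2) fst_pc using gz by auto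
  then have eq: "snd c' ` {z \<in> fst c'. g z \<in> fst d'} = snd c ` (fst c \<inter> fst d)"
    unfolding c(2) by (simp only: snd_pc_image[OF c(1) Int_lower1])
  show "smooth_on (rdim P0) (snd c' ` {z \<in> fst c'. g z \<in> fst d'}) (\<lambda>x. snd d' (g (chart_inv c' x)) i)"
    unfolding eq P0_simps(2)
  proof (rule smooth_on_cong[OF chart_image_open[OF chart[OF c(1)] chart_open[OF d(1)]] transition_smooth[OF c(1) d(1) i]])
    fix y assume y: "y \<in> snd c ` (fst c \<inter> fst d)"
    then have y': "y \<in> snd c ` fst c" by blast
    have "chart_inv c y \<in> fst d" using y chart_inv_left[OF chart[OF c(1)]] by auto
    then show "transition c d i y = snd d' (g (chart_inv c' y)) i"
      unfolding c(2) d(2) chart_inv_pc[OF c(1) y'] gz[OF chart_inv_in[OF y']] snd_pc[OF d(1)]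
      by (simp add: transition_def snd_pc[OF d(1)])
  qed
qed

text \<open>\<open>h \<circ> g\<close> and \<open>h\<close> may differ off the carrier, so locality
  of derivations is invoked, which requires \<open>h \<circ> g\<close> to be smooth near
  \<open>z\<close> as well.\<close>

lemma pushforward_self_P0:
  assumes g: "\<And>z. z \<in> topspace (rtop P0) \<Longrightarrow> g z = z" and z: "z \<in> topspace (rtop P0)" and v: "v \<in> tangent_space P0 z"
  shows "pushforward P0 g z v = v"
proof
  fix h
  note T = v[unfolded tangent_space_def mem_Collect_eq]
  show "pushforward P0 g z v h = v h"
  proof (cases "smooth_near P0 z h")
    case True
    then obtain W where W: "openin (rtop P0) W" "z \<in> W" "smooth_fun_on P0 W h" by (auto simp: smooth_near_def)
    have Ws: "W \<subseteq> topspace (rtop M) \<times> {\<lambda>_. 0}" using openin_subset[OF W(1)] by (simp add: topspace_P0)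
    have "smooth_fun_on P0 W (h \<circ> g)"
      unfolding smooth_fun_on_def
    proof
      fix c' assume c': "c' \<in> ratlas P0"
      then obtain c where c: "c \<in> ratlas M" "c' = pc c" by (auto simp: P0_simps)
      \<comment> \<open>Continuity of this section turns open sets of the product into open sets of
        \<open>M\<close>.\<close>
      have "continuous_map (rtop M) (rtop P0) (\<lambda>p. (p, \<lambda>_. 0))"
        unfolding P0_simps by (intro continuous_map_pairedI continuous_map_id[unfolded id_def]) (simp add: topspace_E0)
      then have B: "openin (rtop M) {p \<in> topspace (rtop M). (p, \<lambda>_. 0) \<in> W}"
        using W(1) openin_continuous_map_preimage by blast
      let ?B = "{p \<in> topspace (rtop M). (p, \<lambda>_. 0) \<in> W}"
      have "fst c' \<inter> W = (fst c \<inter> ?B) \<times> {\<lambda>_. 0}"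
        unfolding c(2) fst_pc using chart_subset[OF c(1)] by auto
      then have im: "snd c' ` (fst c' \<inter> W) = snd c ` (fst c \<inter> ?B)"
        unfolding c(2) by (simp only: snd_pc_image[OF c(1) Int_lower1])
      have s: "smooth_on (rdim P0) (snd c' ` (fst c' \<inter> W)) (h \<circ> chart_inv c')"
        using W(3) c' unfolding smooth_fun_on_def by (rule bspec)
      show "smooth_on (rdim P0) (snd c' ` (fst c' \<inter> W)) (h \<circ> g \<circ> chart_inv c')"
        unfolding im P0_simps(2)
      proof (rule smooth_on_cong[OF chart_image_open[OF chart[OF c(1)] B] s[unfolded im P0_simps(2)]])
        fix y assume "y \<in> snd c ` (fst c \<inter> ?B)"
        then have y': "y \<in> snd c ` fst c" by blast
        have "chart_inv c' y \<in> topspace (rtop P0)"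
          unfolding c(2) chart_inv_pc[OF c(1) y'] topspace_P0 using chart_subset[OF c(1) chart_inv_in[OF y']] by simp
        then show "(h \<circ> chart_inv c') y = (h \<circ> g \<circ> chart_inv c') y" by (simp add: g)
      qed
    qed
    then have hg: "smooth_near P0 z (h \<circ> g)" using W by (auto simp: smooth_near_def)
    have "\<forall>q\<in>W. (h \<circ> g) q = h q" using openin_subset[OF W(1)] g by auto
    then have "v (h \<circ> g) = v h"
      by (rule T[THEN conjunct2, THEN conjunct2, THEN conjunct1, THEN spec, THEN spec, THEN spec, THEN mp, OF hg,
            THEN mp, OF True, THEN mp, OF W(1), THEN mp, OF W(2), THEN mp])
    then show ?thesis using True by (simp add: pushforward_def g[OF z])
  next
    case False
    have "v h = 0" by (rule T[THEN conjunct2, THEN conjunct2, THEN conjunct2, THEN spec, THEN mp, OF False])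
    then show ?thesis using False by (simp add: pushforward_def g[OF z])
  qed
qed

lemma isometry_self_P0:
  assumes g: "\<And>z. z \<in> topspace (rtop P0) \<Longrightarrow> g z = z"
  shows "isometry P0 P0 g"
  unfolding isometry_def
proof (intro conjI)
  show "bij_betw g (topspace (rtop P0)) (topspace (rtop P0))" by (rule bij_betw_self[OF g])
  show "smooth_map P0 P0 g" by (rule smooth_map_self_P0[OF g])
  show "smooth_map P0 P0 (inv_into (topspace (rtop P0)) g)"
    by (rule smooth_map_self_P0[OF inv_into_self[OF g]])
  show "preserves_metric P0 P0 g"
    unfolding preserves_metric_def
  proof (intro ballI)
    fix z v w assume z: "z \<in> topspace (rtop P0)" and v: "v \<in> tangent_space P0 z" and w: "w \<in> tangent_space P0 z"
    show "rmetric P0 (g z) (pushforward P0 g z v) (pushforward P0 g z w) = rmetric P0 z v w"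
    proof -
      have "pushforward P0 g z v = v" by (rule pushforward_self_P0[OF g z v])
      moreover have "pushforward P0 g z w = w" by (rule pushforward_self_P0[OF g z w])
      ultimately show ?thesis by (simp only: g[OF z])
    qed
  qed
qed

text \<open>The product metric is the pullback of the metric of \<open>M\<close> along
  \<open>fst\<close>, since the sum for the point factor is empty.\<close>

lemma local_isometry_fst: "local_isometry P0 M fst"
  unfolding local_isometry_def
proof (intro conjI)
  show "rdim P0 = n" by (rule P0_simps)
  show "preserves_metric P0 M fst" unfolding preserves_metric_def P0_simps by simp
  show "smooth_map P0 M fst"
    unfolding smooth_map_def
  proof (intro conjI ballI allI impI)
    show "continuous_map (rtop P0) (rtop M) fst" unfolding P0_simps by (rule continuous_map_fst)
    fix c' d i assume "c' \<in> ratlas P0" and d: "d \<in> ratlas M" and i: "i < n"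
    then obtain c where c: "c \<in> ratlas M" "c' = pc c" by (auto simp: P0_simps)
    have "{z \<in> fst c'. fst z \<in> fst d} = (fst c \<inter> fst d) \<times> {\<lambda>_. 0}" unfolding c(2) fst_pc by auto
    then have eq: "snd c' ` {z \<in> fst c'. fst z \<in> fst d} = snd c ` (fst c \<inter> fst d)"
      unfolding c(2) by (simp only: snd_pc_image[OF c(1) Int_lower1])
    show "smooth_on (rdim P0) (snd c' ` {z \<in> fst c'. fst z \<in> fst d}) (\<lambda>x. snd d (fst (chart_inv c' x)) i)"
      unfolding eq P0_simps(2)
    proof (rule smooth_on_cong[OF chart_image_open[OF chart[OF c(1)] chart_open[OF d]] transition_smooth[OF c(1) d i]])
      fix y assume "y \<in> snd c ` (fst c \<inter> fst d)"
      then have y': "y \<in> snd c ` fst c" by blast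
      show "transition c d i y = snd d (fst (chart_inv c' y)) i"
        unfolding c(2) chart_inv_pc[OF c(1) y'] by (simp add: transition_def)
    qed
  qed
qed

lemma einstein_imp_rigid:
  assumes "einstein M"
  shows "rigid M"
proof -
  let ?X = "topspace (rtop P0)"
  define e where "e = \<one>\<^bsub>BijGroup ?X\<^esub>"
  have e: "e z = z" if "z \<in> ?X" for z using that by (simp add: e_def BijGroup_def)
  have "quotient_by P0 {e} M fst"
    unfolding quotient_by_def
  proof (intro conjI)
    show "riemannian_manifold M" by (rule rm)
    show "deck_group P0 {e}"
      unfolding deck_group_def
    proof (intro conjI ballI)
      show "subgroup {e} (BijGroup ?X)"
        unfolding e_def by (rule group.triv_subgroup[OF group_BijGroup])
      show "isometry P0 P0 \<gamma>" if "\<gamma> \<in> {e}" for \<gamma> using that isometry_self_P0[OF e] by simp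
      \<comment> \<open>The condition is vacuous for the trivial group, so the whole space serves as
        neighbourhood.\<close>
      show "\<exists>U. openin (rtop P0) U \<and> z \<in> U \<and> (\<forall>\<gamma>\<in>{e}. \<gamma> \<noteq> \<one>\<^bsub>BijGroup ?X\<^esub> \<longrightarrow> \<gamma> ` U \<inter> U = {})" if "z \<in> ?X" for z
        using that by (intro exI[of _ ?X]) (simp add: e_def)
    qed
    show "fst ` ?X = topspace (rtop M)" unfolding topspace_P0 by simp
    show "\<forall>z\<in>?X. \<forall>z'\<in>?X. fst z = fst z' \<longleftrightarrow> (\<exists>\<gamma>\<in>{e}. \<gamma> z = z')"
    proof (intro ballI)
      fix z z' assume z: "z \<in> ?X" "z' \<in> ?X"
      then show "fst z = fst z' \<longleftrightarrow> (\<exists>\<gamma>\<in>{e}. \<gamma> z = z')" using e[OF z(1)] by (auto simp: topspace_P0)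
    qed
    show "local_isometry P0 M fst" by (rule local_isometry_fst)
  qed
  then show ?thesis unfolding rigid_def using rm assms isometry_self by blast
qed

end

theorem theorem1p4:
  fixes M :: "'a riem" and f :: "'a \<Rightarrow> real" and lam :: real
  assumes "gradient_ricci_soliton M f lam"
    and "lam > 0"
    and "compact_space (rtop M)"
    and "(hessian_invariant M f 2) constant_on (topspace (rtop M))"
  shows "rigid M"
proof -
  interpret soliton M f lam
    by unfold_locales (use assms(1) in \<open>simp_all add: gradient_ricci_soliton_def\<close>)
  obtain k where "\<And>p. p \<in> topspace (rtop M) \<Longrightarrow> f p = k"
    using potential_constant[OF assms(2-4)] by blast
  then have "einstein M" by (rule constant_potential_einstein)
  then show ?thesis by (rule einstein_imp_rigid)
qed

end
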